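(* Let $L$ be a finite set of labels and let $M$ be a closed labeled $\mathsf{pPCF}$ term of type $\mathsf{nat}$ all of whose labels belong to $L$. Let $s=\langle M,\varepsilon\rangle$, $s_0=\mathrm{strip}(s)=\langle\mathrm{strip}(M),\varepsilon\rangle$, and let $g:[0,1]^L\to[0,1]$ be $g(\vec r)=\big(\llbracket \mathrm{Spy}_{\vec x}(M)\rrbracket_{\vec x}((r_l e_0)_{l\in L})\big)_0$. Then for every $l\in L$, $$\mathbb E\big[X_l \mid \mathrm{Conv}\big]=\frac{\partial g}{\partial r_l}(1,\dots,1)\Big/\big(\llbracket \mathrm{strip}(M)\rrbracket\big)_0\in[0,+\infty].$$
   Context: **Language pPCF.** Types $\sigma,\tau::=\mathsf{nat}\mid\sigma\Rightarrow\tau$. Terms $M::=\underline n\ (n\in\mathbb N)\mid\mathsf{succ}(M)\mid\mathsf{pred}(M)\mid x\mid\mathsf{coin}(r)\ (r\in[0,1]\cap\mathbb Q)\mid\mathsf{let}\,x=M\,\mathsf{in}\,N\mid\mathsf{if}(M,N,P)\mid(M)N\mid\lambda x^\sigma M\mid\mathsf{fix}(M)$, simply typed in the usual way: $\underline n,\mathsf{coin}(r):\mathsf{nat}$; $\mathsf{succ},\mathsf{pred}$ take and return $\mathsf{nat}$; $\mathsf{let}\,x=M\,\mathsf{in}\,N$ requires $M:\mathsf{nat}$ and $N:\sigma$ under $x:\mathsf{nat}$, and has type $\sigma$; $\mathsf{if}(M,N,P):\sigma$ requires $M:\mathsf{nat}$, $N,P:\sigma$; $\mathsf{fix}(M):\sigma$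 for $M:\sigma\Rightarrow\sigma$; application/abstraction as usual. $\Omega_\sigma=\mathsf{fix}(\lambda x^\sigma x)$. **Labeled terms.** Add a construct $N^l$ ($l$ a label), of the same type as $N$. $\mathrm{strip}(M)$ erases all labels. **Machine.** Stacks $\pi::=\varepsilon\mid\mathsf{arg}(M)\cdot\pi\mid\mathsf{succ}\cdot\pi\mid\mathsf{pred}\cdot\pi\mid\mathsf{if}(N,P)\cdot\pi\mid\mathsf{let}(x,N)\cdot\pi$ (closed terms); a state $\langle M,\pi\rangle$ is a closed term $M:\sigma$ with a well-typed stack $\pi$ turning a $\sigma$ into a $\mathsf{nat}$. For unlabeled states, the partial function $\mathrm{Eval}(s,\alpha)\in[0,1]$, $\alpha\in\{0,1\}^{<\omega}$, is the least one with: $\mathrm{Eval}(\langle\mathsf{let}\,x=M\,\mathsf{in}\,N,\pi\rangle,\alpha)=\mathrm{Eval}(\langle M,\mathsf{let}(x,N)\cdot\pi\rangle,\alpha)$; $\mathrm{Eval}(\langle\underline n,\mathsf{let}(x,N)\cdot\pi\rangle,\alpha)=\mathrm{Eval}(\langle N[\underline n/x],\pi\rangle,\alpha)$; $\mathrm{Eval}(\langle(M)N,\pi\rangle,\alpha)=\mathrm{Eval}(\langle M,\mathsf{arg}(N)\cdot\pi\rangle,\alpha)$; $\mathrm{Eval}(\langle\lambda x^\sigma M,\mathsf{arg}(N)\cdot\pi\rangle,\alpha)=\mathrm{Eval}(\langle M[N/x],\pi\rangle,\alpha)$; $\mathrm{Eval}(\langle\mathsf{if}(M,N,P),\pi\rangle,\alpha)=\mathrm{Eval}(\langle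 M,\mathsf{if}(N,P)\cdot\pi\rangle,\alpha)$; $\mathrm{Eval}(\langle\underline 0,\mathsf{if}(N,P)\cdot\pi\rangle,\alpha)=\mathrm{Eval}(\langle N,\pi\rangle,\alpha)$; $\mathrm{Eval}(\langle\underline{n+1},\mathsf{if}(N,P)\cdot\pi\rangle,\alpha)=\mathrm{Eval}(\langle P,\pi\rangle,\alpha)$; $\mathrm{Eval}(\langle\mathsf{fix}(M),\pi\rangle,\alpha)=\mathrm{Eval}(\langle M,\mathsf{arg}(\mathsf{fix}(M))\cdot\pi\rangle,\alpha)$; $\mathrm{Eval}(\langle\mathsf{coin}(r),\pi\rangle,i\alpha)=\mathrm{Eval}(\langle\underline i,\pi\rangle,\alpha)\cdot\rho_i(r)$ with $\rho_0(r)=r,\rho_1(r)=1-r$; $\mathrm{Eval}(\langle\mathsf{succ}(M),\pi\rangle,\alpha)=\mathrm{Eval}(\langle M,\mathsf{succ}\cdot\pi\rangle,\alpha)$, $\mathrm{Eval}(\langle\underline n,\mathsf{succ}\cdot\pi\rangle,\alpha)=\mathrm{Eval}(\langle\underline{n+1},\pi\rangle,\alpha)$; similarly for $\mathsf{pred}$ with $\mathsf{pred}(\underline 0)\mapsto\underline 0$, $\mathsf{pred}(\underline{n+1})\mapsto\underline n$; $\mathrm{Eval}(\langle\underline 0,\varepsilon\rangle,\langle\rangle)=1$; undefined otherwise. $\mathrm{Dom}(s)$ is the set of $\alpha$ where $\mathrm{Eval}(s,\alpha)$ is defined. For labeled states, $\mathrm{Eval}_{\mathrm{lab}}(s,\alpha)$,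 a finite multiset of labels, is defined by the same rules (with no probability factors) except $\mathrm{Eval}_{\mathrm{lab}}(\langle N^l,\pi\rangle,\alpha)=\mathrm{Eval}_{\mathrm{lab}}(\langle N,\pi\rangle,\alpha)+[l]$, $\mathrm{Eval}_{\mathrm{lab}}(\langle\mathsf{coin}(r),\pi\rangle,i\alpha)=\mathrm{Eval}_{\mathrm{lab}}(\langle\underline i,\pi\rangle,\alpha)$, $\mathrm{Eval}_{\mathrm{lab}}(\langle\underline 0,\varepsilon\rangle,\langle\rangle)=$ empty multiset; it is defined exactly on $\mathrm{Dom}(\mathrm{strip}(s))$. **Probability space.** On the countable set $\{0,1\}^{<\omega}$ put the mass function $f(0\beta)=\mathrm{Eval}(s_0,\beta)$ for $\beta\in\mathrm{Dom}(s_0)$, $f(\langle 1\rangle)=1-\sum_{\beta\in\mathrm{Dom}(s_0)}\mathrm{Eval}(s_0,\beta)$, $f=0$ elsewhere. $\mathrm{Conv}=\{0\beta\mid\beta\in\mathrm{Dom}(s_0)\}$. The random variable $X_l:\{0,1\}^{<\omega}\to\mathbb N$ is $X_l(0\beta)=\mathrm{Eval}_{\mathrm{lab}}(s,\beta)(l)$ for $\beta\in\mathrm{Dom}(s_0)$ and $0$ otherwise; $\mathbb E[X_l\mid\mathrm{Conv}]=\mathbb E[X_l]/\mathbb P(\mathrm{Conv})$. **Probabilistic coherence spaces (PCS).** A PCS $X$ is a countable set $|X|$ and $P(X)\subseteq\mathbb R_{\ge0}^{|X|}$ with $P(X)^{\perp\perp}=P(X)$, where $Q^\perp=\{u'\mid\forall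 u\in Q,\ \sum_a u_au'_a\le1\}$, and $0<\sup_{x\in P(X)}x_a<\infty$ for all $a$. $\mathbf N$: web $\mathbb N$, $P(\mathbf N)$ = sub-probability distributions; $e_n$ the Dirac at $n$. $X\multimap Y$: web $|X|\times|Y|$, elements the matrices $t$ with $t\cdot x\in P(Y)$ for all $x\in P(X)$. $!X$: web = finite multisets over $|X|$, $P(!X)=\{x^!\mid x\in P(X)\}^{\perp\perp}$ with $x^!_\mu=\prod_a x_a^{\mu(a)}$. An element $t\in P(!X\multimap Y)$ is identified with the function $x\mapsto(\sum_\mu t_{\mu,b}x^\mu)_{b}$. Products $\&$: disjoint union of webs, componentwise. Semantics: $\llbracket\mathsf{nat}\rrbracket=\mathbf N$, $\llbracket\sigma\Rightarrow\tau\rrbracket=!\llbracket\sigma\rrbracket\multimap\llbracket\tau\rrbracket$; for $x_1:\sigma_1,\dots,x_k:\sigma_k\vdash M:\sigma$, $\llbracket M\rrbracket_\Gamma:\prod_iP(\llbracket\sigma_i\rrbracket)\to P(\llbracket\sigma\rrbracket)$ is: $\underline n\mapsto e_n$; $x_i\mapsto u_i$; $\mathsf{coin}(r)\mapsto re_0+(1-r)e_1$; $\mathsf{succ}(M)\mapsto\sum_n v_ne_{n+1}$ and $\mathsf{pred}(M)\mapsto v_0e_0+\sum_nv_{n+1}e_n$ where $v=\llbracket M\rrbracket(\vec u)$; $\mathsf{let}\,x=M\,\mathsf{in}\,N\mapsto\sum_n\llbracket M\rrbracket(\vec u)_n\llbracket N[\underline n/x]\rrbracket(\vec u)$; $\mathsf{if}(M,N,P)\mapsto\llbracket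 M\rrbracket(\vec u)_0\llbracket N\rrbracket(\vec u)+(\sum_n\llbracket M\rrbracket(\vec u)_{n+1})\llbracket P\rrbracket(\vec u)$; application is function application; $\lambda x^\sigma M$ is the element of $P(!\llbracket\sigma\rrbracket\multimap\llbracket\tau\rrbracket)$ whose function is $u\mapsto\llbracket M\rrbracket(\vec u,u)$; $\mathsf{fix}(M)\mapsto\sup_n(\llbracket M\rrbracket(\vec u))^n(0)$. **Spy translation.** Let $\vec x=(x_l)_{l\in L}$ be fresh distinct variables of type $\mathsf{nat}$. $\mathrm{Spy}_{\vec x}$ commutes with all constructs except $\mathrm{Spy}_{\vec x}(N^l)=\mathsf{if}(x_l,\mathrm{Spy}_{\vec x}(N),\Omega_\sigma)$ ($\sigma$ the type of $N$). So $\llbracket\mathrm{Spy}_{\vec x}(M)\rrbracket_{\vec x}:P(\mathbf N)^L\to P(\mathbf N)$, and $g$ is a power series with non-negative coefficients; $\frac{\partial g}{\partial r_l}(1,\dots,1)\in[0,+\infty]$ denotes its (left) partial derivative at $(1,\dots,1)$, i.e. the termwise-differentiated series evaluated there. *)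

theory Defs
  imports "HOL-Probability.Probability" "HOL-Library.Multiset"
begin

section \<open>Labeled pPCF\<close>

type_synonym vname = string

datatype ty = Nat | Fun ty ty

text \<open>Terms are not taken up to renaming of bound variables. A term is unlabeled when its set
  \<open>labels\<close> is empty; the requirement \<open>0 \<le> r \<le> 1\<close> on \<open>Coin r\<close> is part of the typing rules.\<close>

datatype (labels: 'l) tm =
    Lit nat
  | Succ "'l tm"
  | Pred "'l tm"
  | Var vname
  | Coin rat
  | LetIn vname "'l tm" "'l tm"
  | IfZ "'l tm" "'l tm" "'l tm"
  | App "'l tm" "'l tm"
  | Lam vname ty "'l tm"
  | Fix "'l tm"
  | Lab 'l "'l tm"

text \<open>All variables of a term, free or bound.\<close>

primrec vars :: "'l tm \<Rightarrow> vname set" where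
  "vars (Lit n) = {}"
| "vars (Succ M) = vars M"
| "vars (Pred M) = vars M"
| "vars (Var x) = {x}"
| "vars (Coin r) = {}"
| "vars (LetIn x M N) = insert x (vars M \<union> vars N)"
| "vars (IfZ M N P) = vars M \<union> vars N \<union> vars P"
| "vars (App M N) = vars M \<union> vars N"
| "vars (Lam x \<sigma> M) = insert x (vars M)"
| "vars (Fix M) = vars M"
| "vars (Lab l M) = vars M"

type_synonym ctx = "vname \<rightharpoonup> ty"

inductive typed :: "ctx \<Rightarrow> 'l tm \<Rightarrow> ty \<Rightarrow> bool" where
  "typed \<Gamma> (Lit n) Nat"
| "typed \<Gamma> M Nat \<Longrightarrow> typed \<Gamma> (Succ M) Nat"
| "typed \<Gamma> M Nat \<Longrightarrow> typed \<Gamma> (Pred M) Nat"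
| "\<Gamma> x = Some \<sigma> \<Longrightarrow> typed \<Gamma> (Var x) \<sigma>"
| "0 \<le> r \<Longrightarrow> r \<le> 1 \<Longrightarrow> typed \<Gamma> (Coin r) Nat"
| "typed \<Gamma> M Nat \<Longrightarrow> typed (\<Gamma>(x \<mapsto> Nat)) N \<sigma> \<Longrightarrow> typed \<Gamma> (LetIn x M N) \<sigma>"
| "typed \<Gamma> M Nat \<Longrightarrow> typed \<Gamma> N \<sigma> \<Longrightarrow> typed \<Gamma> P \<sigma> \<Longrightarrow> typed \<Gamma> (IfZ M N P) \<sigma>"
| "typed \<Gamma> M (Fun \<sigma> \<tau>) \<Longrightarrow> typed \<Gamma> N \<sigma> \<Longrightarrow> typed \<Gamma> (App M N) \<tau>"
| "typed (\<Gamma>(x \<mapsto> \<sigma>)) M \<tau> \<Longrightarrow> typed \<Gamma> (Lam x \<sigma> M) (Fun \<sigma> \<tau>)"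
| "typed \<Gamma> M (Fun \<sigma> \<sigma>) \<Longrightarrow> typed \<Gamma> (Fix M) \<sigma>"
| "typed \<Gamma> M \<sigma> \<Longrightarrow> typed \<Gamma> (Lab l M) \<sigma>"

inductive_cases typed_elims:
  "typed \<Gamma> (Lit n) \<tau>" "typed \<Gamma> (Succ M) \<tau>" "typed \<Gamma> (Pred M) \<tau>" "typed \<Gamma> (Var x) \<tau>"
  "typed \<Gamma> (Coin r) \<tau>" "typed \<Gamma> (LetIn x M N) \<tau>" "typed \<Gamma> (IfZ M N P) \<tau>"
  "typed \<Gamma> (App M N) \<tau>" "typed \<Gamma> (Lam x \<sigma> M) \<tau>" "typed \<Gamma> (Fix M) \<tau>" "typed \<Gamma> (Lab l M) \<tau>"

lemma typed_unique: "typed \<Gamma> M \<sigma> \<Longrightarrow> typed \<Gamma> M \<tau> \<Longrightarrow> \<sigma> = \<tau>"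
proof (induction arbitrary: \<tau> rule: typed.induct)
  case (8 \<Gamma> M \<sigma> \<tau> N)
  then show ?case by (metis typed_elims(8) ty.inject)
next
  case (9 \<Gamma> x \<sigma> M \<tau>)
  then show ?case by (metis typed_elims(9))
next
  case (10 \<Gamma> M \<sigma>)
  then show ?case by (metis typed_elims(10) ty.inject)
qed (metis typed_elims option.inject)+

definition type_of :: "ctx \<Rightarrow> 'l tm \<Rightarrow> ty" where
  "type_of \<Gamma> M = (THE \<tau>. typed \<Gamma> M \<tau>)"

primrec strip :: "'l tm \<Rightarrow> 'l tm" where
  "strip (Lit n) = Lit n"
| "strip (Succ M) = Succ (strip M)"
| "strip (Pred M) = Pred (strip M)"
| "strip (Var x) = Var x"
| "strip (Coin r) = Coin r"
| "strip (LetIn x M N) = LetIn x (strip M) (strip N)"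
| "strip (IfZ M N P) = IfZ (strip M) (strip N) (strip P)"
| "strip (App M N) = App (strip M) (strip N)"
| "strip (Lam x \<sigma> M) = Lam x \<sigma> (strip M)"
| "strip (Fix M) = Fix (strip M)"
| "strip (Lab l M) = strip M"

text \<open>\<open>subst x P M\<close> is \<open>M[P/x]\<close>. It is only used for closed \<open>P\<close>, so no variable can be captured.\<close>

primrec subst :: "vname \<Rightarrow> 'l tm \<Rightarrow> 'l tm \<Rightarrow> 'l tm" where
  "subst x P (Lit n) = Lit n"
| "subst x P (Succ M) = Succ (subst x P M)"
| "subst x P (Pred M) = Pred (subst x P M)"
| "subst x P (Var y) = (if y = x then P else Var y)"
| "subst x P (Coin r) = Coin r"
| "subst x P (LetIn y M N) = LetIn y (subst x P M) (if y = x then N else subst x P N)"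
| "subst x P (IfZ M N N') = IfZ (subst x P M) (subst x P N) (subst x P N')"
| "subst x P (App M N) = App (subst x P M) (subst x P N)"
| "subst x P (Lam y \<sigma> M) = Lam y \<sigma> (if y = x then M else subst x P M)"
| "subst x P (Fix M) = Fix (subst x P M)"
| "subst x P (Lab l M) = Lab l (subst x P M)"

definition Omega :: "ty \<Rightarrow> 'l tm" where
  "Omega \<sigma> = Fix (Lam ''x'' \<sigma> (Var ''x''))"

text \<open>\<open>x l\<close> is the variable \<open>x\<^sub>l\<close>. The context types the free variables of the labeled term,
  and only serves to determine the type of \<open>\<Omega>\<close>.\<close>

primrec Spy :: "('l \<Rightarrow> vname) \<Rightarrow> ctx \<Rightarrow> 'l tm \<Rightarrow> 'l tm" where
  "Spy x \<Gamma> (Lit n) = Lit n"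
| "Spy x \<Gamma> (Succ M) = Succ (Spy x \<Gamma> M)"
| "Spy x \<Gamma> (Pred M) = Pred (Spy x \<Gamma> M)"
| "Spy x \<Gamma> (Var y) = Var y"
| "Spy x \<Gamma> (Coin r) = Coin r"
| "Spy x \<Gamma> (LetIn y M N) = LetIn y (Spy x \<Gamma> M) (Spy x (\<Gamma>(y \<mapsto> Nat)) N)"
| "Spy x \<Gamma> (IfZ M N P) = IfZ (Spy x \<Gamma> M) (Spy x \<Gamma> N) (Spy x \<Gamma> P)"
| "Spy x \<Gamma> (App M N) = App (Spy x \<Gamma> M) (Spy x \<Gamma> N)"
| "Spy x \<Gamma> (Lam y \<sigma> M) = Lam y \<sigma> (Spy x (\<Gamma>(y \<mapsto> \<sigma>)) M)"
| "Spy x \<Gamma> (Fix M) = Fix (Spy x \<Gamma> M)"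
| "Spy x \<Gamma> (Lab l M) = IfZ (Var (x l)) (Spy x \<Gamma> M) (Omega (type_of \<Gamma> M))"

section \<open>The machine\<close>

datatype 'l frame =
    FArg "'l tm"
  | FSucc
  | FPred
  | FIf "'l tm" "'l tm"
  | FLet vname "'l tm"

primrec strip_frame :: "'l frame \<Rightarrow> 'l frame" where
  "strip_frame (FArg M) = FArg (strip M)"
| "strip_frame FSucc = FSucc"
| "strip_frame FPred = FPred"
| "strip_frame (FIf N P) = FIf (strip N) (strip P)"
| "strip_frame (FLet x N) = FLet x (strip N)"

type_synonym 'l state = "'l tm \<times> 'l frame list"

definition strip_state :: "'l state \<Rightarrow> 'l state" where
  "strip_state s = (strip (fst s), map strip_frame (snd s))"

text \<open>The bits 0 and 1 are represented by \<open>False\<close> and \<open>True\<close>. The graphs of the least partial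
  functions Eval and Eval_lab are the inductive predicates \<open>ev\<close> and \<open>ev_lab\<close>. No rule of \<open>ev\<close>
  applies to \<open>Lab l M\<close>: it evaluates unlabeled states.\<close>

inductive ev :: "'l state \<Rightarrow> bool list \<Rightarrow> real \<Rightarrow> bool" where
  "ev (M, FLet x N # \<pi>) \<alpha> p \<Longrightarrow> ev (LetIn x M N, \<pi>) \<alpha> p"
| "ev (subst x (Lit n) N, \<pi>) \<alpha> p \<Longrightarrow> ev (Lit n, FLet x N # \<pi>) \<alpha> p"
| "ev (M, FArg N # \<pi>) \<alpha> p \<Longrightarrow> ev (App M N, \<pi>) \<alpha> p"
| "ev (subst x N M, \<pi>) \<alpha> p \<Longrightarrow> ev (Lam x \<sigma> M, FArg N # \<pi>) \<alpha> p"
| "ev (M, FIf N P # \<pi>) \<alpha> p \<Longrightarrow> ev (IfZ M N P, \<pi>) \<alpha> p"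
| "ev (N, \<pi>) \<alpha> p \<Longrightarrow> ev (Lit 0, FIf N P # \<pi>) \<alpha> p"
| "ev (P, \<pi>) \<alpha> p \<Longrightarrow> ev (Lit (n + 1), FIf N P # \<pi>) \<alpha> p"
| "ev (M, FArg (Fix M) # \<pi>) \<alpha> p \<Longrightarrow> ev (Fix M, \<pi>) \<alpha> p"
| "ev (Lit 0, \<pi>) \<alpha> p \<Longrightarrow> ev (Coin r, \<pi>) (False # \<alpha>) (p * of_rat r)"
| "ev (Lit 1, \<pi>) \<alpha> p \<Longrightarrow> ev (Coin r, \<pi>) (True # \<alpha>) (p * (1 - of_rat r))"
| "ev (M, FSucc # \<pi>) \<alpha> p \<Longrightarrow> ev (Succ M, \<pi>) \<alpha> p"
| "ev (Lit (n + 1), \<pi>) \<alpha> p \<Longrightarrow> ev (Lit n, FSucc # \<pi>) \<alpha> p"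
| "ev (M, FPred # \<pi>) \<alpha> p \<Longrightarrow> ev (Pred M, \<pi>) \<alpha> p"
| "ev (Lit 0, \<pi>) \<alpha> p \<Longrightarrow> ev (Lit 0, FPred # \<pi>) \<alpha> p"
| "ev (Lit n, \<pi>) \<alpha> p \<Longrightarrow> ev (Lit (n + 1), FPred # \<pi>) \<alpha> p"
| "ev (Lit 0, []) [] 1"

inductive ev_lab :: "'l state \<Rightarrow> bool list \<Rightarrow> 'l multiset \<Rightarrow> bool" where
  "ev_lab (M, FLet x N # \<pi>) \<alpha> m \<Longrightarrow> ev_lab (LetIn x M N, \<pi>) \<alpha> m"
| "ev_lab (subst x (Lit n) N, \<pi>) \<alpha> m \<Longrightarrow> ev_lab (Lit n, FLet x N # \<pi>) \<alpha> m"
| "ev_lab (M, FArg N # \<pi>) \<alpha> m \<Longrightarrow> ev_lab (App M N, \<pi>) \<alpha> m"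
| "ev_lab (subst x N M, \<pi>) \<alpha> m \<Longrightarrow> ev_lab (Lam x \<sigma> M, FArg N # \<pi>) \<alpha> m"
| "ev_lab (M, FIf N P # \<pi>) \<alpha> m \<Longrightarrow> ev_lab (IfZ M N P, \<pi>) \<alpha> m"
| "ev_lab (N, \<pi>) \<alpha> m \<Longrightarrow> ev_lab (Lit 0, FIf N P # \<pi>) \<alpha> m"
| "ev_lab (P, \<pi>) \<alpha> m \<Longrightarrow> ev_lab (Lit (n + 1), FIf N P # \<pi>) \<alpha> m"
| "ev_lab (M, FArg (Fix M) # \<pi>) \<alpha> m \<Longrightarrow> ev_lab (Fix M, \<pi>) \<alpha> m"
| "ev_lab (Lit 0, \<pi>) \<alpha> m \<Longrightarrow> ev_lab (Coin r, \<pi>) (False # \<alpha>) m"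
| "ev_lab (Lit 1, \<pi>) \<alpha> m \<Longrightarrow> ev_lab (Coin r, \<pi>) (True # \<alpha>) m"
| "ev_lab (M, FSucc # \<pi>) \<alpha> m \<Longrightarrow> ev_lab (Succ M, \<pi>) \<alpha> m"
| "ev_lab (Lit (n + 1), \<pi>) \<alpha> m \<Longrightarrow> ev_lab (Lit n, FSucc # \<pi>) \<alpha> m"
| "ev_lab (M, FPred # \<pi>) \<alpha> m \<Longrightarrow> ev_lab (Pred M, \<pi>) \<alpha> m"
| "ev_lab (Lit 0, \<pi>) \<alpha> m \<Longrightarrow> ev_lab (Lit 0, FPred # \<pi>) \<alpha> m"
| "ev_lab (Lit n, \<pi>) \<alpha> m \<Longrightarrow> ev_lab (Lit (n + 1), FPred # \<pi>) \<alpha> m"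
| "ev_lab (Lit 0, []) [] {#}"
| "ev_lab (M, \<pi>) \<alpha> m \<Longrightarrow> ev_lab (Lab l M, \<pi>) \<alpha> (m + {#l#})"

inductive_cases ev_elims:
  "ev (LetIn x M N, \<pi>) \<alpha> q"
  "ev (Lit n, FLet x N # \<pi>) \<alpha> q"
  "ev (App M N, \<pi>) \<alpha> q"
  "ev (Lam x \<sigma> M, FArg N # \<pi>) \<alpha> q"
  "ev (IfZ M N P, \<pi>) \<alpha> q"
  "ev (Lit 0, FIf N P # \<pi>) \<alpha> q"
  "ev (Lit (n + 1), FIf N P # \<pi>) \<alpha> q"
  "ev (Fix M, \<pi>) \<alpha> q"
  "ev (Coin r, \<pi>) (False # \<alpha>) q"
  "ev (Coin r, \<pi>) (True # \<alpha>) q"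
  "ev (Succ M, \<pi>) \<alpha> q"
  "ev (Lit n, FSucc # \<pi>) \<alpha> q"
  "ev (Pred M, \<pi>) \<alpha> q"
  "ev (Lit 0, FPred # \<pi>) \<alpha> q"
  "ev (Lit (n + 1), FPred # \<pi>) \<alpha> q"
  "ev (Lit 0, []) \<alpha> q"

inductive_cases ev_lab_elims:
  "ev_lab (LetIn x M N, \<pi>) \<alpha> q"
  "ev_lab (Lit n, FLet x N # \<pi>) \<alpha> q"
  "ev_lab (App M N, \<pi>) \<alpha> q"
  "ev_lab (Lam x \<sigma> M, FArg N # \<pi>) \<alpha> q"
  "ev_lab (IfZ M N P, \<pi>) \<alpha> q"
  "ev_lab (Lit 0, FIf N P # \<pi>) \<alpha> q"
  "ev_lab (Lit (n + 1), FIf N P # \<pi>) \<alpha> q"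
  "ev_lab (Fix M, \<pi>) \<alpha> q"
  "ev_lab (Coin r, \<pi>) (False # \<alpha>) q"
  "ev_lab (Coin r, \<pi>) (True # \<alpha>) q"
  "ev_lab (Succ M, \<pi>) \<alpha> q"
  "ev_lab (Lit n, FSucc # \<pi>) \<alpha> q"
  "ev_lab (Pred M, \<pi>) \<alpha> q"
  "ev_lab (Lit 0, FPred # \<pi>) \<alpha> q"
  "ev_lab (Lit (n + 1), FPred # \<pi>) \<alpha> q"
  "ev_lab (Lit 0, []) \<alpha> q"
  "ev_lab (Lab l M, \<pi>) \<alpha> q"

lemma ev_unique: "ev s \<alpha> p \<Longrightarrow> ev s \<alpha> q \<Longrightarrow> p = q"
proof (induction arbitrary: q rule: ev.induct)
qed (erule ev_elims; metis One_nat_def Suc_eq_plus1)+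

lemma ev_lab_unique: "ev_lab s \<alpha> m \<Longrightarrow> ev_lab s \<alpha> m' \<Longrightarrow> m = m'"
proof (induction arbitrary: m' rule: ev_lab.induct)
qed (erule ev_lab_elims; metis One_nat_def Suc_eq_plus1 add_mset_add_single)+

definition Dom :: "'l state \<Rightarrow> bool list set" where
  "Dom s = {\<alpha>. \<exists>p. ev s \<alpha> p}"

definition Eval :: "'l state \<Rightarrow> bool list \<Rightarrow> real" where
  "Eval s \<alpha> = (THE p. ev s \<alpha> p)"

definition Eval_lab :: "'l state \<Rightarrow> bool list \<Rightarrow> 'l multiset" where
  "Eval_lab s \<alpha> = (THE m. ev_lab s \<alpha> m)"

section \<open>The probability space\<close>

definition mass :: "'l state \<Rightarrow> bool list \<Rightarrow> real" where
  "mass s\<^sub>0 \<omega> = (case \<omega> of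
      [] \<Rightarrow> 0
    | False # \<beta> \<Rightarrow> (if \<beta> \<in> Dom s\<^sub>0 then Eval s\<^sub>0 \<beta> else 0)
    | True # \<beta> \<Rightarrow> (if \<beta> = [] then 1 - (\<Sum>\<^sub>\<infinity>\<beta>\<in>Dom s\<^sub>0. Eval s\<^sub>0 \<beta>) else 0))"

definition run_pmf :: "'l state \<Rightarrow> bool list pmf" where
  "run_pmf s\<^sub>0 = embed_pmf (mass s\<^sub>0)"

definition Conv :: "'l state \<Rightarrow> bool list set" where
  "Conv s\<^sub>0 = {False # \<beta> | \<beta>. \<beta> \<in> Dom s\<^sub>0}"

definition label_count :: "'l state \<Rightarrow> 'l \<Rightarrow> bool list \<Rightarrow> nat" where
  "label_count s l \<omega> = (case \<omega> of
      False # \<beta> \<Rightarrow> (if \<beta> \<in> Dom (strip_state s) then count (Eval_lab s \<beta>) l else 0)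
    | _ \<Rightarrow> 0)"

text \<open>The conditional expectation of \<open>label_count s l\<close>, which vanishes outside \<open>Conv\<close>, given
  \<open>Conv\<close>. If \<open>Conv\<close> has probability 0, the quotient is \<open>0 / 0 = 0\<close> in \<open>ennreal\<close>.\<close>

definition cond_expectation_label_count :: "'l state \<Rightarrow> 'l \<Rightarrow> ennreal" where
  "cond_expectation_label_count s l =
     (\<integral>\<^sup>+\<omega>. of_nat (label_count s l \<omega>) \<partial>measure_pmf (run_pmf (strip_state s)))
       / emeasure (measure_pmf (run_pmf (strip_state s))) (Conv (strip_state s))"

section \<open>Probabilistic coherence spaces\<close>

text \<open>Elements of \<open>\<real>\<^sub>\<ge>\<^sub>0\<^bsup>W\<^esup>\<close> are represented by functions to \<open>ennreal\<close> which are finite on \<open>W\<close> and vanish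
  outside \<open>W\<close>.\<close>

definition vectors :: "'a set \<Rightarrow> ('a \<Rightarrow> ennreal) set" where
  "vectors W = {u. (\<forall>a\<in>W. u a < \<top>) \<and> (\<forall>a. a \<notin> W \<longrightarrow> u a = 0)}"

definition orth :: "'a set \<Rightarrow> ('a \<Rightarrow> ennreal) set \<Rightarrow> ('a \<Rightarrow> ennreal) set" where
  "orth W Q = {u' \<in> vectors W. \<forall>u\<in>Q. (\<Sum>\<^sub>\<infinity>a\<in>W. u a * u' a) \<le> 1}"

record 'a pcs =
  web :: "'a set"
  elems :: "('a \<Rightarrow> ennreal) set"

definition is_pcs :: "'a pcs \<Rightarrow> bool" where
  "is_pcs X \<longleftrightarrow> countable (web X) \<and> elems X \<subseteq> vectors (web X) \<and>
     orth (web X) (orth (web X) (elems X)) = elems X \<and>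
     (\<forall>a\<in>web X. 0 < (SUP x\<in>elems X. x a) \<and> (SUP x\<in>elems X. x a) < \<top>)"

definition nat_pcs :: "nat pcs" where
  "nat_pcs = \<lparr>web = UNIV, elems = {u \<in> vectors UNIV. (\<Sum>\<^sub>\<infinity>n. u n) \<le> 1}\<rparr>"

lemma infsum_ennreal_single: "(\<Sum>\<^sub>\<infinity>n. (if n = m then f n else (0::ennreal))) = f m"
proof -
  have "(\<Sum>\<^sub>\<infinity>n. (if n = m then f n else (0::ennreal))) = (\<Sum>\<^sub>\<infinity>n\<in>{m}. f n)"
    by (rule infsum_cong_neutral) auto
  then show ?thesis by simp
qed

lemma is_pcs_nat_pcs: "is_pcs nat_pcs"
proof -
  let ?P = "{u \<in> vectors (UNIV::nat set). (\<Sum>\<^sub>\<infinity>n. u n) \<le> 1}"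
  let ?e = "\<lambda>m n. if n = m then 1 else (0::ennreal)"
  have e: "?e m \<in> ?P" for m
    using infsum_ennreal_single[of m "\<lambda>_. 1"] by (auto simp: vectors_def)
  have le: "u n \<le> 1" if "u \<in> ?P" for u n
  proof -
    have "u n = (\<Sum>\<^sub>\<infinity>k\<in>{n}. u k)" by simp
    also have "\<dots> \<le> (\<Sum>\<^sub>\<infinity>k. u k)"
      by (rule infsum_mono_neutral) (auto intro: nonneg_summable_on_complete)
    also have "\<dots> \<le> 1" using that by simp
    finally show ?thesis .
  qed
  have orth1: "orth UNIV ?P = {u. \<forall>n. u n \<le> 1}" (is "?L = ?R")
  proof (intro equalityI subsetI)
    fix u' assume u': "u' \<in> ?L"
    have "u' m \<le> 1" for m
    proof -
      have "(\<Sum>\<^sub>\<infinity>n. ?e m n * u' n) \<le> 1" using u' e by (auto simp: orth_def)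
      moreover have "(\<Sum>\<^sub>\<infinity>n. ?e m n * u' n) = (\<Sum>\<^sub>\<infinity>n. (if n = m then u' n else 0))"
        by (rule infsum_cong) auto
      ultimately show ?thesis using infsum_ennreal_single[of m u'] by simp
    qed
    then show "u' \<in> ?R" by simp
  next
    fix u' assume u': "u' \<in> ?R"
    have "(\<Sum>\<^sub>\<infinity>n. u n * u' n) \<le> 1" if "u \<in> ?P" for u
    proof -
      have "(\<Sum>\<^sub>\<infinity>n. u n * u' n) \<le> (\<Sum>\<^sub>\<infinity>n. u n)"
        using u' by (intro infsum_mono nonneg_summable_on_complete)
          (auto intro: order_trans[OF mult_left_mono])
      also have "\<dots> \<le> 1" using that by simp
      finally show ?thesis .
    qed
    then show "u' \<in> ?L" using u'
      by (auto simp: orth_def vectors_def intro: le_less_trans[of _ 1])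
  qed
  have "orth UNIV {u. \<forall>n. u n \<le> 1} = ?P"
  proof (intro equalityI subsetI)
    fix u :: "nat \<Rightarrow> ennreal" assume "u \<in> orth UNIV {u. \<forall>n. u n \<le> (1::ennreal)}"
    then have "u \<in> vectors UNIV" and "\<forall>u'. (\<forall>n. u' n \<le> 1) \<longrightarrow> (\<Sum>\<^sub>\<infinity>n. u' n * u n) \<le> 1"
      by (auto simp: orth_def)
    then have "u \<in> vectors UNIV" and "(\<Sum>\<^sub>\<infinity>n. 1 * u n) \<le> 1"
      by (auto dest: spec[where x = "\<lambda>_. 1"])
    then show "u \<in> ?P" by simp
  next
    fix u assume u: "u \<in> ?P"
    have "(\<Sum>\<^sub>\<infinity>n. u' n * u n) \<le> 1" if u': "\<forall>n. u' n \<le> 1" for u'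
    proof -
      have "(\<Sum>\<^sub>\<infinity>n. u' n * u n) \<le> (\<Sum>\<^sub>\<infinity>n. u n)"
        using u' by (intro infsum_mono nonneg_summable_on_complete)
          (auto intro: order_trans[OF mult_right_mono])
      also have "\<dots> \<le> 1" using u by simp
      finally show ?thesis .
    qed
    then show "u \<in> orth UNIV {u. \<forall>n. u n \<le> (1::ennreal)}"
      using u by (auto simp: orth_def)
  qed
  moreover have "0 < (SUP x\<in>?P. x n) \<and> (SUP x\<in>?P. x n) < \<top>" for n
  proof
    have "(1::ennreal) \<le> (SUP x\<in>?P. x n)"
      by (rule SUP_upper2[OF e[of n]]) simp
    then show "0 < (SUP x\<in>?P. x n)" by (rule less_le_trans[rotated]) simp
    have "(SUP x\<in>?P. x n) \<le> 1" by (rule SUP_least) (rule le)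
    then show "(SUP x\<in>?P. x n) < \<top>" by (rule le_less_trans) simp
  qed
  ultimately show ?thesis
    unfolding is_pcs_def nat_pcs_def pcs.simps orth1 by auto
qed
definition mat_app :: "'a set \<Rightarrow> ('a \<times> 'b \<Rightarrow> ennreal) \<Rightarrow> ('a \<Rightarrow> ennreal) \<Rightarrow> 'b \<Rightarrow> ennreal" where
  "mat_app W t x b = (\<Sum>\<^sub>\<infinity>a\<in>W. t (a, b) * x a)"

definition limpl_pcs :: "'a pcs \<Rightarrow> 'b pcs \<Rightarrow> ('a \<times> 'b) pcs" where
  "limpl_pcs X Y = \<lparr>web = web X \<times> web Y,
     elems = {t \<in> vectors (web X \<times> web Y). \<forall>x\<in>elems X. mat_app (web X) t x \<in> elems Y}\<rparr>"

definition prom :: "('a \<Rightarrow> ennreal) \<Rightarrow> 'a multiset \<Rightarrow> ennreal" where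
  "prom x \<mu> = (\<Prod>a\<in>#\<mu>. x a)"

definition bang_pcs :: "'a pcs \<Rightarrow> 'a multiset pcs" where
  "bang_pcs X = (let W = {\<mu>. set_mset \<mu> \<subseteq> web X} in
     \<lparr>web = W, elems = orth W (orth W (prom ` elems X))\<rparr>)"

text \<open>The isomorphic copy of a PCS along a map \<open>f\<close> that is injective on its web.\<close>

definition relabel_pcs :: "('a \<Rightarrow> 'b) \<Rightarrow> 'a pcs \<Rightarrow> 'b pcs" where
  "relabel_pcs f X = \<lparr>web = f ` web X,
     elems = {u \<in> vectors (f ` web X). (\<lambda>a. if a \<in> web X then u (f a) else 0) \<in> elems X}\<rparr>"

section \<open>Denotational semantics\<close>

text \<open>The webs of all types are embedded in one type of points: \<open>PNat n\<close> is \<open>n \<in> |nat|\<close>, and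
  \<open>PFun \<mu> b\<close> is \<open>(\<mu>, b) \<in> |!\<sigma> \<multimap> \<tau>|\<close>.\<close>

datatype pt = PNat nat | PFun "pt multiset" pt

primrec den :: "ty \<Rightarrow> pt pcs" where
  "den Nat = relabel_pcs PNat nat_pcs"
| "den (Fun \<sigma> \<tau>) = relabel_pcs (\<lambda>(\<mu>, b). PFun \<mu> b) (limpl_pcs (bang_pcs (den \<sigma>)) (den \<tau>))"

type_synonym vec = "pt \<Rightarrow> ennreal"

text \<open>The function \<open>P(\<sigma>) \<rightarrow> P(\<tau>)\<close> identified with an element of \<open>P(!\<sigma> \<multimap> \<tau>)\<close>. As that element vanishes
  outside its web, the sum may range over all multisets.\<close>

definition fun_of :: "vec \<Rightarrow> vec \<Rightarrow> vec" where
  "fun_of t x = (\<lambda>b. \<Sum>\<^sub>\<infinity>\<mu>. t (PFun \<mu> b) * prom x \<mu>)"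

definition dirac :: "nat \<Rightarrow> vec" where
  "dirac n = (\<lambda>a. if a = PNat n then 1 else 0)"

text \<open>\<open>sem \<Gamma> M \<rho>\<close> is the interpretation of the unlabeled term \<open>M\<close> in context \<open>\<Gamma>\<close> at the
  arguments \<open>\<rho>\<close>; the (unused) clause for labels ignores them. Recursion is on the number of
  constructors of the term, numerals counting for one.\<close>

primrec tm_size :: "'l tm \<Rightarrow> nat" where
  "tm_size (Lit n) = 1"
| "tm_size (Succ M) = tm_size M + 1"
| "tm_size (Pred M) = tm_size M + 1"
| "tm_size (Var x) = 1"
| "tm_size (Coin r) = 1"
| "tm_size (LetIn x M N) = tm_size M + tm_size N + 1"
| "tm_size (IfZ M N P) = tm_size M + tm_size N + tm_size P + 1"
| "tm_size (App M N) = tm_size M + tm_size N + 1"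
| "tm_size (Lam x \<sigma> M) = tm_size M + 1"
| "tm_size (Fix M) = tm_size M + 1"
| "tm_size (Lab l M) = tm_size M + 1"

lemma tm_size_subst_Lit: "tm_size (subst x (Lit n) M) = tm_size M"
  by (induction M) auto

function sem :: "ctx \<Rightarrow> 'l tm \<Rightarrow> (vname \<Rightarrow> vec) \<Rightarrow> vec" where
  "sem \<Gamma> (Lit n) \<rho> = dirac n"
| "sem \<Gamma> (Succ M) \<rho> = (\<lambda>a. \<Sum>\<^sub>\<infinity>n. sem \<Gamma> M \<rho> (PNat n) * dirac (n + 1) a)"
| "sem \<Gamma> (Pred M) \<rho> = (\<lambda>a. sem \<Gamma> M \<rho> (PNat 0) * dirac 0 a
     + (\<Sum>\<^sub>\<infinity>n. sem \<Gamma> M \<rho> (PNat (n + 1)) * dirac n a))"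
| "sem \<Gamma> (Var x) \<rho> = \<rho> x"
| "sem \<Gamma> (Coin r) \<rho> = (\<lambda>a. ennreal (of_rat r) * dirac 0 a + ennreal (1 - of_rat r) * dirac 1 a)"
| "sem \<Gamma> (LetIn x M N) \<rho> =
     (\<lambda>a. \<Sum>\<^sub>\<infinity>n. sem \<Gamma> M \<rho> (PNat n) * sem \<Gamma> (subst x (Lit n) N) \<rho> a)"
| "sem \<Gamma> (IfZ M N P) \<rho> = (\<lambda>a. sem \<Gamma> M \<rho> (PNat 0) * sem \<Gamma> N \<rho> a
     + (\<Sum>\<^sub>\<infinity>n. sem \<Gamma> M \<rho> (PNat (n + 1))) * sem \<Gamma> P \<rho> a)"
| "sem \<Gamma> (App M N) \<rho> = fun_of (sem \<Gamma> M \<rho>) (sem \<Gamma> N \<rho>)"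
| "sem \<Gamma> (Lam x \<sigma> M) \<rho> =
     (THE t. t \<in> elems (den (Fun \<sigma> (type_of (\<Gamma>(x \<mapsto> \<sigma>)) M))) \<and>
        (\<forall>u\<in>elems (den \<sigma>). fun_of t u = sem (\<Gamma>(x \<mapsto> \<sigma>)) M (\<rho>(x := u))))"
| "sem \<Gamma> (Fix M) \<rho> = (\<lambda>a. SUP n. (fun_of (sem \<Gamma> M \<rho>) ^^ n) (\<lambda>_. 0) a)"
| "sem \<Gamma> (Lab l M) \<rho> = sem \<Gamma> M \<rho>"
  by pat_completeness auto

termination
  by (relation "Wellfounded.measure (\<lambda>(\<Gamma>, M, \<rho>). tm_size M)") (auto simp: tm_size_subst_Lit)

definition closed_sem :: "'l tm \<Rightarrow> vec" where
  "closed_sem M = sem Map.empty M (\<lambda>_ _. 0)"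

definition spy_ctx :: "('l \<Rightarrow> vname) \<Rightarrow> 'l set \<Rightarrow> ctx" where
  "spy_ctx x L = (\<lambda>y. if y \<in> x ` L then Some Nat else None)"

definition spy_env :: "('l \<Rightarrow> vname) \<Rightarrow> 'l set \<Rightarrow> ('l \<Rightarrow> real) \<Rightarrow> vname \<Rightarrow> vec" where
  "spy_env x L r = (\<lambda>y. if y \<in> x ` L then (\<lambda>a. ennreal (r (inv_into L x y)) * dirac 0 a) else (\<lambda>_. 0))"

definition spy_series :: "('l \<Rightarrow> vname) \<Rightarrow> 'l set \<Rightarrow> 'l tm \<Rightarrow> ('l \<Rightarrow> real) \<Rightarrow> real" where
  "spy_series x L M r =
     enn2real (sem (spy_ctx x L) (Spy x Map.empty M) (spy_env x L r) (PNat 0))"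

text \<open>Left partial derivative in the coordinate \<open>l\<close>, possibly infinite.\<close>

definition left_pderiv :: "(('l \<Rightarrow> real) \<Rightarrow> real) \<Rightarrow> 'l \<Rightarrow> ('l \<Rightarrow> real) \<Rightarrow> ereal" where
  "left_pderiv g l r = Lim (at_right 0) (\<lambda>h. ereal ((g r - g (r(l := r l - h))) / h))"

end

theory Submission
  imports Defs
begin

text \<open>Both sides are read off a semantics in which a label \<open>l\<close> multiplies by a weight \<open>r\<^sub>l \<le> 1\<close>: if a term
  of type \<open>nat\<close> is interpreted in this way, its value at 0 is the sum over all halting runs \<open>\<beta>\<close> of
  \<open>Eval \<beta> \<cdot> \<Prod>\<^sub>l r\<^sub>l ^ Eval_lab \<beta> l\<close>. One inequality follows from the invariance of the interpretation under
  machine transitions, the other from a logical relation between closed terms and vectors. As the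
  test of \<open>x\<^sub>l\<close> at \<open>r\<^sub>l e\<^sub>0\<close> is the multiplication by \<open>r\<^sub>l\<close>, the spy series is this sum; differentiating it
  termwise in \<open>r\<^sub>l\<close> at 1, by monotone convergence, gives the unnormalised expectation of the number of
  occurrences of \<open>l\<close>, and without labels the sum is the probability of convergence.

  That abstractions denote at all requires that the interpretation of a term in context is given by
  a power series in all coordinates of its arguments, whose coefficients are unique because the
  vectors of a PCS contain a small cube around 0 in every finite set of coordinates.\<close>

section \<open>Sums in the extended nonnegative reals\<close>

text \<open>A label scales by at most 1, so that a PCS is mapped into itself. The point (1, ..., 1)
  is therefore on the boundary of the available arguments: the derivative there may be infinite, and
  it is reached from the left by monotone convergence instead of by differentiation inside a disc of
  convergence. Summing in \<open>ennreal\<close> makes all sums exist and exchangeable; finiteness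
  matters only where something is cancelled, mainly in the uniqueness of coefficients and in the
  difference quotient.

  The main obstacle is that an abstraction is a definite description, which says nothing at
  arguments outside the PCS of its context. Hence a term agrees with a power series only on
  admissible environments, and each abstraction needs a matrix to be exhibited and shown unique. A
  second obstacle is the biorthogonal closure in !\<sigma>, which has no explicit description; a
  polar description by test vectors replaces it. Finally the machine computes under stacks: for one
  inequality they are interpreted as linear maps, for the other the logical relation quantifies over
  them.\<close>

lemma ennreal_summable_on: "f summable_on A" for f :: "'a \<Rightarrow> ennreal"
  by (rule nonneg_summable_on_complete) simp

lemma ennreal_infsum_upper: "finite F \<Longrightarrow> F \<subseteq> A \<Longrightarrow> sum f F \<le> (\<Sum>\<^sub>\<infinity>x\<in>A. f x :: ennreal)"
  by (subst nonneg_infsum_complete) (auto intro!: SUP_upper)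

text \<open>Brings Tonelli and monotone convergence to unordered sums. The delicate direction is
  from the integral to the sum: a simple function has finitely many values, so one with infinite
  support is bounded below there by its least positive value, and the sum is infinite as
  well.\<close>

lemma ennreal_infsum_eq_nn_integral:
  "(\<Sum>\<^sub>\<infinity>x. f x) = (\<integral>\<^sup>+x. f x \<partial>count_space UNIV)" for f :: "'a \<Rightarrow> ennreal"
proof (rule antisym)
  show "(\<Sum>\<^sub>\<infinity>x. f x) \<le> (\<integral>\<^sup>+x. f x \<partial>count_space UNIV)"
  proof (rule infsum_le_finite_sums)
    fix F :: "'a set" assume "finite F"
    then have "sum f F = (\<integral>\<^sup>+x. f x \<partial>count_space F)"
      by (simp add: nn_integral_count_space_finite)
    also have "\<dots> \<le> (\<integral>\<^sup>+x. f x \<partial>count_space UNIV)"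
      by (subst nn_integral_count_space_indicator[of F])
        (auto intro!: nn_integral_mono split: split_indicator)
    finally show "sum f F \<le> (\<integral>\<^sup>+x. f x \<partial>count_space UNIV)" .
  qed (rule ennreal_summable_on)
  show "(\<integral>\<^sup>+x. f x \<partial>count_space UNIV) \<le> (\<Sum>\<^sub>\<infinity>x. f x)"
    unfolding nn_integral_def
  proof (safe intro!: SUP_least)
    fix g :: "'a \<Rightarrow> ennreal"
    assume g: "simple_function (count_space UNIV) g" "g \<le> f"
    let ?S = "{x. 0 < g x}"
    show "integral\<^sup>S (count_space UNIV) g \<le> (\<Sum>\<^sub>\<infinity>x. f x)"
    proof (cases "finite ?S")
      case True
      have "integral\<^sup>S (count_space UNIV) g = (\<integral>\<^sup>+x. g x \<partial>count_space UNIV)"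
        using g(1) by (simp add: nn_integral_eq_simple_integral)
      also have "\<dots> = sum g ?S"
        using True by (subst nn_integral_count_space) auto
      also have "\<dots> \<le> sum f ?S"
        using g(2) by (auto intro!: sum_mono simp: le_fun_def)
      also have "\<dots> \<le> (\<Sum>\<^sub>\<infinity>x. f x)"
        using True by (rule ennreal_infsum_upper) simp
      finally show ?thesis .
    next
      case False
      have fin: "finite (g ` ?S)"
        using g(1) by (auto simp: simple_function_def intro: finite_subset[of _ "range g"])
      define v where "v = Min (g ` ?S)"
      have "?S \<noteq> {}" using False by (metis finite.emptyI)
      then have "v \<in> g ` ?S"
        unfolding v_def using fin by (intro Min_in) simp_all
      then have "0 < v" by auto
      moreover have "v \<le> f x" if "x \<in> ?S" for x
        using Min_le[OF fin, of "g x"] that g(2)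
        by (auto simp: v_def le_fun_def intro: order_trans)
      ultimately have "(\<Sum>\<^sub>\<infinity>x\<in>?S. f x) = \<infinity>"
        using False by (intro infsum_superconst_infinite_ennreal[where b = v]) auto
      moreover have "(\<Sum>\<^sub>\<infinity>x\<in>?S. f x) \<le> (\<Sum>\<^sub>\<infinity>x. f x)"
        by (rule infsum_mono_neutral) (auto intro: ennreal_summable_on)
      ultimately show ?thesis by (simp add: top_unique)
    qed
  qed
qed

lemma ennreal_infsum_mono: "(\<And>x. f x \<le> g x) \<Longrightarrow> (\<Sum>\<^sub>\<infinity>x. f x) \<le> (\<Sum>\<^sub>\<infinity>x. g x)"
  for f :: "'a \<Rightarrow> ennreal"
  by (intro infsum_mono ennreal_summable_on)

lemma ennreal_infsum_ge: "f x \<le> (\<Sum>\<^sub>\<infinity>x. f x)" for f :: "'a \<Rightarrow> ennreal"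
  using ennreal_infsum_upper[of "{x}" UNIV f] by simp

lemma ennreal_infsum_cmult_right: "(\<Sum>\<^sub>\<infinity>x. c * f x) = c * (\<Sum>\<^sub>\<infinity>x. f x)"
  for f :: "'a \<Rightarrow> ennreal"
  by (simp add: ennreal_infsum_eq_nn_integral nn_integral_cmult)

lemma ennreal_infsum_cmult_left: "(\<Sum>\<^sub>\<infinity>x. f x * c) = (\<Sum>\<^sub>\<infinity>x. f x) * c"
  for f :: "'a \<Rightarrow> ennreal"
  by (simp add: ennreal_infsum_eq_nn_integral nn_integral_multc)

lemma ennreal_infsum_add: "(\<Sum>\<^sub>\<infinity>x. f x + g x) = (\<Sum>\<^sub>\<infinity>x. f x) + (\<Sum>\<^sub>\<infinity>x. g x)"
  for f g :: "'a \<Rightarrow> ennreal"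
  by (simp add: ennreal_infsum_eq_nn_integral nn_integral_add)

lemma ennreal_infsum_prod: "(\<Sum>\<^sub>\<infinity>p. f p) = (\<Sum>\<^sub>\<infinity>x. \<Sum>\<^sub>\<infinity>y. f (x, y))"
  for f :: "'a \<times> 'b \<Rightarrow> ennreal"
  unfolding ennreal_infsum_eq_nn_integral by (rule nn_integral_fst_count_space[symmetric])

lemma ennreal_infsum_swap: "(\<Sum>\<^sub>\<infinity>x. \<Sum>\<^sub>\<infinity>y. f x y) = (\<Sum>\<^sub>\<infinity>y. \<Sum>\<^sub>\<infinity>x. f x y)"
  for f :: "'a \<Rightarrow> 'b \<Rightarrow> ennreal"
  using nn_integral_fst_count_space[of "\<lambda>(x, y). f x y"] nn_integral_snd_count_space[of "\<lambda>(x, y). f x y"]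
  by (simp add: ennreal_infsum_eq_nn_integral)

lemma ennreal_infsum_SUP: "(\<And>x. incseq (\<lambda>n. f n x)) \<Longrightarrow>
    (\<Sum>\<^sub>\<infinity>x. SUP n. f n x) = (SUP n. \<Sum>\<^sub>\<infinity>x. f n x)"
  for f :: "nat \<Rightarrow> 'a \<Rightarrow> ennreal"
  unfolding ennreal_infsum_eq_nn_integral
  by (rule nn_integral_monotone_convergence_SUP) (auto simp: incseq_def le_fun_def)

lemma ennreal_infsum_single: "(\<And>x. x \<noteq> a \<Longrightarrow> f x = 0) \<Longrightarrow> (\<Sum>\<^sub>\<infinity>x. f x) = f a"
  for f :: "'a \<Rightarrow> ennreal"
  using infsum_cong_neutral[of "{a}" UNIV f f] by simp

lemma ennreal_infsum_restrict: "(\<Sum>\<^sub>\<infinity>x\<in>A. f x) = (\<Sum>\<^sub>\<infinity>x. if x \<in> A then f x else 0)"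
  for f :: "'a \<Rightarrow> ennreal"
  by (rule infsum_cong_neutral) auto

lemma ennreal_infsum_reindex:
  fixes f :: "'a \<Rightarrow> ennreal"
  assumes "inj h" "\<And>y. y \<notin> range h \<Longrightarrow> f y = 0"
  shows "(\<Sum>\<^sub>\<infinity>y. f y) = (\<Sum>\<^sub>\<infinity>x. f (h x))"
proof -
  have "(\<Sum>\<^sub>\<infinity>y. f y) = (\<Sum>\<^sub>\<infinity>y\<in>range h. f y)"
    using assms(2) by (intro infsum_cong_neutral) auto
  then show ?thesis using infsum_reindex[OF assms(1), of f] by (simp add: o_def)
qed

lemma ennreal_infsum_nat: "(\<Sum>\<^sub>\<infinity>n. f n) = f 0 + (\<Sum>\<^sub>\<infinity>n. f (Suc n))" for f :: "nat \<Rightarrow> ennreal"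
  unfolding ennreal_infsum_eq_nn_integral nn_integral_count_space_nat
  using suminf_offset[of f 1] by (simp add: summableI add.commute)

lemma ennreal_infsum_nat_SUP: "(\<Sum>\<^sub>\<infinity>n. f n) = (SUP n. sum f {..<n})" for f :: "nat \<Rightarrow> ennreal"
  unfolding ennreal_infsum_eq_nn_integral nn_integral_count_space_nat
  by (rule suminf_eq_SUP)

lemma ennreal_SUP_mult:
  fixes f g :: "nat \<Rightarrow> ennreal"
  assumes "incseq f" "incseq g"
  shows "(SUP n. f n * g n) = (SUP n. f n) * (SUP n. g n)"
proof (rule antisym)
  show "(SUP n. f n * g n) \<le> (SUP n. f n) * (SUP n. g n)"
    by (auto intro!: SUP_least mult_mono SUP_upper)
  have "f i * g j \<le> (SUP n. f n * g n)" for i j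
    by (rule SUP_upper2[of "max i j"]) (use assms in \<open>auto simp: incseq_def intro!: mult_mono\<close>)
  then show "(SUP n. f n) * (SUP n. g n) \<le> (SUP n. f n * g n)"
    by (simp add: SUP_mult_right_ennreal SUP_mult_left_ennreal SUP_least)
qed

section \<open>Power series in infinitely many variables\<close>

lemma prom_empty [simp]: "prom u {#} = 1"
  by (simp add: prom_def)

lemma prom_add_mset [simp]: "prom u (add_mset a \<mu>) = u a * prom u \<mu>"
  by (simp add: prom_def)

lemma prom_union: "prom u (\<mu> + \<nu>) = prom u \<mu> * prom u \<nu>"
  by (simp add: prom_def)

lemma prom_cong: "(\<And>a. a \<in># \<mu> \<Longrightarrow> u a = v a) \<Longrightarrow> prom u \<mu> = prom v \<mu>"
  by (induction \<mu>) auto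

lemma prom_mono: "(\<And>a. u a \<le> v a) \<Longrightarrow> prom u \<mu> \<le> prom v \<mu>"
  by (induction \<mu>) (auto intro: mult_mono)

lemma prom_pos: "(\<And>a. a \<in># \<mu> \<Longrightarrow> 0 < u a) \<Longrightarrow> 0 < prom u \<mu>"
  by (induction \<mu>) (auto simp: ennreal_zero_less_mult_iff)

lemma prom_eq_0: "a \<in># \<mu> \<Longrightarrow> u a = 0 \<Longrightarrow> prom u \<mu> = 0"
  by (induction \<mu>) auto

lemma prom_finite: "(\<And>a. a \<in># \<mu> \<Longrightarrow> u a < \<top>) \<Longrightarrow> prom u \<mu> < \<top>"
  by (induction \<mu>) (auto simp: ennreal_mult_less_top)

lemma prom_replicate: "prom u (replicate_mset k a) = u a ^ k"
  by (induction k) auto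

text \<open>A formal power series whose monomials are the finite multisets of variables.
  Coefficients and arguments range over all of \<open>ennreal\<close>, so it has a value at every
  point and closure properties are rearrangements of sums. Which arguments are admissible is a
  separate matter, settled by \<open>ctx_analytic\<close>.\<close>

definition analytic :: "(('i \<Rightarrow> ennreal) \<Rightarrow> ennreal) \<Rightarrow> bool" where
  "analytic f \<longleftrightarrow> (\<exists>c. \<forall>\<rho>. f \<rho> = (\<Sum>\<^sub>\<infinity>m. c m * prom \<rho> m))"

text \<open>The monomials \<open>m j\<close> may repeat, as coefficients of equal monomials are
  added up. Each closure property can thus index its series by whatever the sum produces, without
  computing coefficients.\<close>

lemma analyticI:
  assumes "\<And>\<rho>. f \<rho> = (\<Sum>\<^sub>\<infinity>j. c j * prom \<rho> (m j))"
  shows "analytic f"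
  unfolding analytic_def
proof (intro exI allI)
  fix \<rho>
  have "(\<Sum>\<^sub>\<infinity>M. (\<Sum>\<^sub>\<infinity>j. if m j = M then c j else 0) * prom \<rho> M)
      = (\<Sum>\<^sub>\<infinity>M. \<Sum>\<^sub>\<infinity>j. (if m j = M then c j else 0) * prom \<rho> M)"
    by (simp add: ennreal_infsum_cmult_left)
  also have "\<dots> = (\<Sum>\<^sub>\<infinity>j. \<Sum>\<^sub>\<infinity>M. (if m j = M then c j else 0) * prom \<rho> M)"
    by (rule ennreal_infsum_swap)
  also have "\<dots> = (\<Sum>\<^sub>\<infinity>j. c j * prom \<rho> (m j))"
    by (rule infsum_cong, subst ennreal_infsum_single[where a = "m _"]) auto
  finally show "f \<rho> = (\<Sum>\<^sub>\<infinity>M. (\<Sum>\<^sub>\<infinity>j. if m j = M then c j else 0) * prom \<rho> M)"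
    using assms by simp
qed

lemma analytic_const: "analytic (\<lambda>_. c)"
  by (rule analyticI[where c = "\<lambda>_::unit. c" and m = "\<lambda>_. {#}"]) (simp add: UNIV_unit)

lemma analytic_proj: "analytic (\<lambda>\<rho>. \<rho> i)"
  by (rule analyticI[where c = "\<lambda>_::unit. 1" and m = "\<lambda>_. {#i#}"]) (simp add: UNIV_unit)

lemma analytic_infsum:
  assumes "\<And>j. analytic (f j)"
  shows "analytic (\<lambda>\<rho>. \<Sum>\<^sub>\<infinity>j. f j \<rho>)"
proof -
  obtain c where c: "\<And>j \<rho>. f j \<rho> = (\<Sum>\<^sub>\<infinity>m. c j m * prom \<rho> m)"
    using assms unfolding analytic_def by metis
  show ?thesis
    by (rule analyticI[where c = "\<lambda>(j, m). c j m" and m = snd])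
      (simp add: ennreal_infsum_prod c)
qed

lemma analytic_add: "analytic f \<Longrightarrow> analytic g \<Longrightarrow> analytic (\<lambda>\<rho>. f \<rho> + g \<rho>)"
  using analytic_infsum[of "\<lambda>b. if b then f else g"] by (auto simp: UNIV_bool add.commute)

lemma analytic_mult:
  assumes "analytic f" "analytic g"
  shows "analytic (\<lambda>\<rho>. f \<rho> * g \<rho>)"
proof -
  obtain c d where c: "\<And>\<rho>. f \<rho> = (\<Sum>\<^sub>\<infinity>m. c m * prom \<rho> m)"
    and d: "\<And>\<rho>. g \<rho> = (\<Sum>\<^sub>\<infinity>m. d m * prom \<rho> m)"
    using assms unfolding analytic_def by metis
  show ?thesis
  proof (rule analyticI[where c = "\<lambda>(m, n). c m * d n" and m = "\<lambda>(m, n). m + n"])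
    fix \<rho>
    show "f \<rho> * g \<rho> = (\<Sum>\<^sub>\<infinity>j. (case j of (m, n) \<Rightarrow> c m * d n) * prom \<rho> (case j of (m, n) \<Rightarrow> m + n))"
      unfolding c d ennreal_infsum_prod ennreal_infsum_cmult_left[symmetric]
      by (rule infsum_cong, subst ennreal_infsum_cmult_right[symmetric]) (simp add: prom_union ac_simps)
  qed
qed

lemma analytic_prom:
  assumes "\<And>a. analytic (\<lambda>\<rho>. g \<rho> a)"
  shows "analytic (\<lambda>\<rho>. prom (g \<rho>) \<mu>)"
  by (induction \<mu>) (auto intro: analytic_const analytic_mult assms)

lemma analytic_compose:
  assumes "analytic f" "\<And>i. analytic (\<lambda>\<rho>. g \<rho> i)"
  shows "analytic (\<lambda>\<rho>. f (g \<rho>))"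
proof -
  obtain c where c: "\<And>\<rho>. f \<rho> = (\<Sum>\<^sub>\<infinity>m. c m * prom \<rho> m)"
    using assms(1) unfolding analytic_def by metis
  show ?thesis
    unfolding c by (intro analytic_infsum analytic_mult analytic_const analytic_prom assms)
qed

lemma analytic_fun_of:
  assumes "\<And>p. analytic (\<lambda>\<rho>. t \<rho> p)" "\<And>a. analytic (\<lambda>\<rho>. u \<rho> a)"
  shows "analytic (\<lambda>\<rho>. fun_of (t \<rho>) (u \<rho>) b)"
  unfolding fun_of_def by (intro analytic_infsum analytic_mult analytic_prom assms)

text \<open>Pointwise comparison is too weak for suprema: the supremum of a pointwise increasing sequence
  of power series need not be one. The sequence has to increase coefficientwise.\<close>

definition analytic_le :: "(('i \<Rightarrow> ennreal) \<Rightarrow> ennreal) \<Rightarrow> (('i \<Rightarrow> ennreal) \<Rightarrow> ennreal) \<Rightarrow> bool" where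
  "analytic_le f g \<longleftrightarrow> (\<exists>h. analytic h \<and> (\<forall>\<rho>. g \<rho> = f \<rho> + h \<rho>))"

lemma analytic_le_refl: "analytic_le f f"
  unfolding analytic_le_def by (rule exI[where x = "\<lambda>_. 0"]) (simp add: analytic_const)

lemma analytic_le_zero: "analytic f \<Longrightarrow> analytic_le (\<lambda>_. 0) f"
  unfolding analytic_le_def by auto

lemma analytic_le_mult:
  assumes "analytic f" "analytic f'" "analytic_le f g" "analytic_le f' g'"
  shows "analytic_le (\<lambda>\<rho>. f \<rho> * f' \<rho>) (\<lambda>\<rho>. g \<rho> * g' \<rho>)"
proof -
  obtain h h' where h: "analytic h" "\<And>\<rho>. g \<rho> = f \<rho> + h \<rho>"
    and h': "analytic h'" "\<And>\<rho>. g' \<rho> = f' \<rho> + h' \<rho>"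
    using assms(3,4) unfolding analytic_le_def by metis
  have "analytic (\<lambda>\<rho>. f \<rho> * h' \<rho> + (h \<rho> * f' \<rho> + h \<rho> * h' \<rho>))"
    by (intro analytic_add analytic_mult assms h h')
  then show ?thesis
    unfolding analytic_le_def h(2) h'(2)
    by (intro exI conjI) (auto simp: algebra_simps)
qed

lemma analytic_le_prom:
  assumes "\<And>a. analytic (\<lambda>\<rho>. u \<rho> a)" "\<And>a. analytic_le (\<lambda>\<rho>. u \<rho> a) (\<lambda>\<rho>. v \<rho> a)"
  shows "analytic_le (\<lambda>\<rho>. prom (u \<rho>) \<mu>) (\<lambda>\<rho>. prom (v \<rho>) \<mu>)"
proof (induction \<mu>)
  case (add a \<mu>)
  show ?case
    using analytic_le_mult[OF assms(1) analytic_prom[OF assms(1)] assms(2) add] by simp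
qed (simp add: analytic_le_refl)

lemma analytic_le_infsum:
  assumes "\<And>j. analytic_le (f j) (g j)"
  shows "analytic_le (\<lambda>\<rho>. \<Sum>\<^sub>\<infinity>j. f j \<rho>) (\<lambda>\<rho>. \<Sum>\<^sub>\<infinity>j. g j \<rho>)"
proof -
  obtain h where h: "\<And>j. analytic (h j)" "\<And>j \<rho>. g j \<rho> = f j \<rho> + h j \<rho>"
    using assms unfolding analytic_le_def by metis
  show ?thesis
    unfolding analytic_le_def h(2)
    by (rule exI[where x = "\<lambda>\<rho>. \<Sum>\<^sub>\<infinity>j. h j \<rho>"]) (simp add: analytic_infsum h ennreal_infsum_add)
qed

lemma analytic_le_fun_of:
  assumes "\<And>p. analytic (\<lambda>\<rho>. t \<rho> p)" "\<And>a. analytic (\<lambda>\<rho>. u \<rho> a)"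
    "\<And>a. analytic_le (\<lambda>\<rho>. u \<rho> a) (\<lambda>\<rho>. v \<rho> a)"
  shows "analytic_le (\<lambda>\<rho>. fun_of (t \<rho>) (u \<rho>) b) (\<lambda>\<rho>. fun_of (t \<rho>) (v \<rho>) b)"
  unfolding fun_of_def
  by (intro analytic_le_infsum analytic_le_mult analytic_le_refl analytic_le_prom analytic_prom assms)

text \<open>Telescoping: the supremum is the infinite sum of the increments, each of which is a
  power series.\<close>

lemma analytic_SUP:
  assumes "\<And>\<rho>. f 0 \<rho> = 0" "\<And>n. analytic_le (f n) (f (Suc n))"
  shows "analytic (\<lambda>\<rho>. SUP n. f n \<rho>)"
proof -
  obtain h where h: "\<And>n. analytic (h n)" "\<And>n \<rho>. f (Suc n) \<rho> = f n \<rho> + h n \<rho>"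
    using assms(2) unfolding analytic_le_def by metis
  have "f n \<rho> = (\<Sum>k<n. h k \<rho>)" for n \<rho>
    by (induction n) (auto simp: assms(1) h(2))
  then have "(SUP n. f n \<rho>) = (\<Sum>\<^sub>\<infinity>n. h n \<rho>)" for \<rho>
    by (simp add: ennreal_infsum_nat_SUP)
  then show ?thesis by (simp add: analytic_infsum h(1))
qed

lemma analytic_iterate:
  assumes "\<And>p. analytic (\<lambda>\<rho>. t \<rho> p)"
  shows "analytic (\<lambda>\<rho>. (fun_of (t \<rho>) ^^ n) (\<lambda>_. 0) b)"
  by (induction n arbitrary: b) (auto intro: analytic_const analytic_fun_of assms)

text \<open>Applying a fixed matrix is monotone for the coefficientwise order, so the iterates from
  0 increase in that order.\<close>

lemma analytic_fixpoint:
  assumes t: "\<And>p. analytic (\<lambda>\<rho>. t \<rho> p)"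
  shows "analytic (\<lambda>\<rho>. SUP n. (fun_of (t \<rho>) ^^ n) (\<lambda>_. 0) b)"
proof (rule analytic_SUP)
  show "analytic_le (\<lambda>\<rho>. (fun_of (t \<rho>) ^^ n) (\<lambda>_. 0) b) (\<lambda>\<rho>. (fun_of (t \<rho>) ^^ Suc n) (\<lambda>_. 0) b)" for n
  proof (induction n arbitrary: b)
    case 0
    show ?case using analytic_iterate[OF t, of 1] by (simp add: analytic_le_zero)
  next
    case (Suc n)
    show ?case
      using analytic_le_fun_of[OF t analytic_iterate[OF t, of n] Suc] by simp
  qed
qed simp

lemma prom_split:
  "prom (\<lambda>(y, a). if y = x then u a else \<rho> (y, a)) m =
     prom \<rho> {#p \<in># m. fst p \<noteq> x#} * prom u (image_mset snd {#p \<in># m. fst p = x#})"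
  by (induction m) (auto simp: ac_simps split: prod.splits)

text \<open>Currying of power series: with the coordinates of \<open>x\<close> separated from all
  others, the coefficients in the former are series in the latter. They become the matrix entries of
  an abstraction over \<open>x\<close>.\<close>

lemma analytic_coefficients:
  assumes "analytic f"
  obtains c where "\<And>\<mu>. analytic (c \<mu>)"
    "\<And>\<rho> u. f (\<lambda>(y, a). if y = x then u a else \<rho> (y, a)) = (\<Sum>\<^sub>\<infinity>\<mu>. c \<mu> \<rho> * prom u \<mu>)"
proof -
  obtain d where d: "\<And>\<rho>. f \<rho> = (\<Sum>\<^sub>\<infinity>m. d m * prom \<rho> m)"
    using assms unfolding analytic_def by metis
  let ?p = "\<lambda>m. image_mset snd {#p \<in># m. fst p = x#}"
  let ?r = "\<lambda>m. {#p \<in># m. fst p \<noteq> x#}"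
  \<comment> \<open>All monomials whose part in the coordinates of \<open>x\<close> is
    \<open>\<mu>\<close> contribute to the coefficient of \<open>\<mu>\<close>.\<close>
  define c where "c \<mu> \<rho> = (\<Sum>\<^sub>\<infinity>m. if ?p m = \<mu> then d m * prom \<rho> (?r m) else 0)" for \<mu> \<rho>
  have "analytic (c \<mu>)" for \<mu>
  proof -
    have "analytic (\<lambda>\<rho>. if ?p m = \<mu> then d m * prom \<rho> (?r m) else 0)" for m
      by (cases "?p m = \<mu>") (simp_all add: analytic_const analytic_mult[OF analytic_const analytic_prom[OF analytic_proj]])
    then show ?thesis unfolding c_def by (rule analytic_infsum)
  qed
  moreover have "f (\<lambda>(y, a). if y = x then u a else \<rho> (y, a)) = (\<Sum>\<^sub>\<infinity>\<mu>. c \<mu> \<rho> * prom u \<mu>)" for \<rho> u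
  proof -
    have "(\<Sum>\<^sub>\<infinity>\<mu>. c \<mu> \<rho> * prom u \<mu>) =
        (\<Sum>\<^sub>\<infinity>\<mu>. \<Sum>\<^sub>\<infinity>m. (if ?p m = \<mu> then d m * prom \<rho> (?r m) else 0) * prom u \<mu>)"
      by (simp add: c_def ennreal_infsum_cmult_left)
    also have "\<dots> = (\<Sum>\<^sub>\<infinity>m. \<Sum>\<^sub>\<infinity>\<mu>. (if ?p m = \<mu> then d m * prom \<rho> (?r m) else 0) * prom u \<mu>)"
      by (rule ennreal_infsum_swap)
    also have "\<dots> = (\<Sum>\<^sub>\<infinity>m. d m * (prom \<rho> (?r m) * prom u (?p m)))"
      by (rule infsum_cong, subst ennreal_infsum_single[where a = "?p _"]) (auto simp: ac_simps)
    finally show ?thesis by (simp add: d prom_split)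
  qed
  ultimately show thesis by (rule that)
qed

section \<open>Uniqueness of the coefficients on a small box\<close>

lemma ennreal_infsum_offset: "(\<Sum>\<^sub>\<infinity>n. f n) = sum f {..<k} + (\<Sum>\<^sub>\<infinity>n. f (n + k))" for f :: "nat \<Rightarrow> ennreal"
  unfolding ennreal_infsum_eq_nn_integral nn_integral_count_space_nat
  using suminf_offset[of f k] by (simp add: summableI)

lemma ennreal_zero_less_power: "0 < x \<Longrightarrow> 0 < x ^ n" for x :: ennreal
  by (metis not_gr_zero power_not_zero)

lemma ennreal_mult_less_topD: "x * y < \<top> \<Longrightarrow> 0 < y \<Longrightarrow> x < \<top>" for x y :: ennreal
  by (auto simp: ennreal_mult_less_top)

text \<open>The terms below \<open>k\<close> agree and are finite, so they cancel; dividing by z^k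
  leaves p_k \<le> q_k + z C for all small positive z, where C bounds the rest of the second series.
  Now let z tend to 0.\<close>

lemma power_series_coeff_le:
  fixes p q :: "nat \<Rightarrow> ennreal"
  assumes e: "0 < e" "e < \<top>"
    and eq: "\<And>z. z \<le> e \<Longrightarrow> (\<Sum>\<^sub>\<infinity>k. p k * z ^ k) = (\<Sum>\<^sub>\<infinity>k. q k * z ^ k)"
    and fin: "(\<Sum>\<^sub>\<infinity>k. p k * e ^ k) < \<top>"
    and less: "\<And>j. j < k \<Longrightarrow> p j = q j"
  shows "p k \<le> q k"
proof -
  \<comment> \<open>Finite, since \<open>C * e ^ Suc k\<close> is a part of the convergent second
    series at \<open>e\<close>; it also bounds the same tail at every smaller argument.\<close>
  define C where "C = (\<Sum>\<^sub>\<infinity>j. q (j + Suc k) * e ^ j)"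
  have ek: "0 < e ^ n" for n using e by (simp add: ennreal_zero_less_power)
  have "C * e ^ Suc k = (\<Sum>\<^sub>\<infinity>j. q (j + Suc k) * e ^ (j + Suc k))"
    unfolding C_def ennreal_infsum_cmult_left[symmetric] by (simp add: power_add ac_simps)
  also have "\<dots> \<le> (\<Sum>\<^sub>\<infinity>k. q k * e ^ k)"
    by (subst ennreal_infsum_offset[where k = "Suc k" and f = "\<lambda>k. q k * e ^ k"]) simp
  also have "\<dots> < \<top>" using eq[of e] fin by simp
  finally have C: "C < \<top>"
    using ek[of "Suc k"] by (rule ennreal_mult_less_topD)
  have bound: "p k \<le> q k + z * C" if z: "0 < z" "z \<le> e" for z
  proof -
    let ?s = "\<Sum>j<k. p j * z ^ j"
    have zt: "z < \<top>" using z e by auto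
    have zk: "0 < z ^ k" "z ^ k < \<top>"
      using z zt by (auto simp: ennreal_zero_less_power power_less_top_ennreal)
    have "?s \<le> (\<Sum>\<^sub>\<infinity>k. p k * z ^ k)" by (rule ennreal_infsum_upper) auto
    also have "\<dots> \<le> (\<Sum>\<^sub>\<infinity>k. p k * e ^ k)"
      using z by (intro ennreal_infsum_mono mult_left_mono power_mono) auto
    finally have "?s < \<top>" using fin by (rule le_less_trans)
    then have s: "?s \<noteq> \<top>" by (rule less_imp_neq)
    have shift: "(\<Sum>\<^sub>\<infinity>n. r n * z ^ n) = (\<Sum>j<k. r j * z ^ j) + z ^ k * (\<Sum>\<^sub>\<infinity>j. r (j + k) * z ^ j)" for r
      unfolding ennreal_infsum_cmult_right[symmetric]
      by (subst ennreal_infsum_offset[where k = k]) (simp add: power_add ac_simps)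
    have "z ^ k * (\<Sum>\<^sub>\<infinity>j. p (j + k) * z ^ j) = z ^ k * (\<Sum>\<^sub>\<infinity>j. q (j + k) * z ^ j)"
      using eq[OF z(2)] less s shift[of p] shift[of q] by (simp add: ennreal_add_left_cancel)
    then have "(\<Sum>\<^sub>\<infinity>j. p (j + k) * z ^ j) = (\<Sum>\<^sub>\<infinity>j. q (j + k) * z ^ j)"
      using zk z zt by (auto simp: ennreal_mult_cancel_left)
    then have "p k \<le> (\<Sum>\<^sub>\<infinity>j. q (j + k) * z ^ j)"
      using ennreal_infsum_ge[of "\<lambda>j. p (j + k) * z ^ j" 0] by simp
    also have "\<dots> = q k + z * (\<Sum>\<^sub>\<infinity>j. q (j + Suc k) * z ^ j)"
      by (subst ennreal_infsum_nat, subst ennreal_infsum_cmult_right[symmetric]) (simp add: ac_simps)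
    also have "\<dots> \<le> q k + z * C"
      unfolding C_def using z
      by (intro add_left_mono mult_left_mono ennreal_infsum_mono power_mono) auto
    finally show ?thesis .
  qed
  show ?thesis
  proof (rule ennreal_le_epsilon)
    fix d :: real assume d: "0 < d"
    have C1: "C + 1 \<noteq> \<top>" "C + 1 \<noteq> 0" using C by auto
    \<comment> \<open>Chosen so that \<open>?z * C\<close> is at most \<open>d\<close>; the summand
      1 keeps the divisor away from 0.\<close>
    let ?z = "min e (ennreal d / (C + 1))"
    have "0 < ?z" using e d C by (simp add: ennreal_zero_less_divide)
    then have "p k \<le> q k + ?z * C" by (rule bound) simp
    also have "?z * C \<le> (ennreal d / (C + 1)) * (C + 1)" by (rule mult_mono) auto
    also have "\<dots> = ennreal d"
      using C1 ennreal_divide_self[of "C + 1"] by (simp only: ennreal_divide_times) (simp add: top.not_eq_extremum)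
    finally show "p k \<le> q k + ennreal d" by (simp add: add_left_mono)
  qed
qed

lemma power_series_coeff_unique:
  fixes p q :: "nat \<Rightarrow> ennreal"
  assumes e: "0 < e" "e < \<top>"
    and eq: "\<And>z. z \<le> e \<Longrightarrow> (\<Sum>\<^sub>\<infinity>k. p k * z ^ k) = (\<Sum>\<^sub>\<infinity>k. q k * z ^ k)"
    and fin: "(\<Sum>\<^sub>\<infinity>k. p k * e ^ k) < \<top>"
  shows "p k = q k"
proof (induction k rule: less_induct)
  case (less k)
  show ?case
  proof (rule antisym)
    show "p k \<le> q k" by (rule power_series_coeff_le[OF e eq fin less])
    show "q k \<le> p k"
      by (rule power_series_coeff_le[OF e eq[symmetric]]) (use fin eq[of e] less in auto)
  qed
qed

text \<open>Induction on the coordinates: with the others fixed, the series is one in the coordinate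
  \<open>a\<close> alone, and its coefficients are series in the remaining coordinates to which the
  induction hypothesis applies. The finite value at the corner \<open>e\<close> bounds the values in
  the whole box, which is what the one-variable case needs.\<close>

lemma coefficients_unique:
  fixes c d :: "'a multiset \<Rightarrow> ennreal"
  assumes "finite A" "\<And>a. a \<in> A \<Longrightarrow> 0 < e a \<and> e a < \<top>"
    and "\<And>u. (\<And>a. u a \<le> (if a \<in> A then e a else 0)) \<Longrightarrow>
      (\<Sum>\<^sub>\<infinity>m. c m * prom u m) = (\<Sum>\<^sub>\<infinity>m. d m * prom u m)"
    and "(\<Sum>\<^sub>\<infinity>m. c m * prom (\<lambda>a. if a \<in> A then e a else 0) m) < \<top>"
    and "set_mset m \<subseteq> A"
  shows "c m = d m"
  using assms
proof (induction A arbitrary: c d m rule: finite_induct)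
  case empty
  have "(\<Sum>\<^sub>\<infinity>m. c m * prom (\<lambda>_. 0) m) = c {#}" for c :: "'a multiset \<Rightarrow> ennreal"
    by (subst ennreal_infsum_single[where a = "{#}"]) (auto simp: multiset_nonemptyE prom_eq_0)
  then show ?case using empty(2)[of "\<lambda>_. 0"] empty(4) by simp
next
  case (insert a A)
  \<comment> \<open>The coefficients that go with the k-th power of the coordinate \<open>a\<close>,
    indexed by the multisets without \<open>a\<close>.\<close>
  let ?k = "\<lambda>c k m. if a \<in># m then 0 else c (m + replicate_mset k a)"
  have split: "(\<Sum>\<^sub>\<infinity>m. c m * prom (u(a := z)) m) = (\<Sum>\<^sub>\<infinity>k. (\<Sum>\<^sub>\<infinity>m. ?k c k m * prom u m) * z ^ k)"
    for c :: "'a multiset \<Rightarrow> ennreal" and u z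
  proof -
    let ?G = "\<lambda>(k, m). c (m + replicate_mset k a) * (prom u m * z ^ k)"
    have "(\<Sum>\<^sub>\<infinity>m. c m * prom (u(a := z)) m) = (\<Sum>\<^sub>\<infinity>p\<in>UNIV \<times> {m. a \<notin># m}. ?G p)"
    proof -
      have bij: "bij_betw (\<lambda>(k, m). m + replicate_mset k a) (UNIV \<times> {m. a \<notin># m}) UNIV"
        by (rule bij_betw_byWitness[where f' = "\<lambda>M. (count M a, filter_mset (\<lambda>b. b \<noteq> a) M)"])
          (auto simp: multiset_eq_iff not_in_iff)
      have "prom (u(a := z)) (m + replicate_mset k a) = prom u m * z ^ k" if "a \<notin># m" for m k

      proof -
        have "prom (u(a := z)) m = prom u m" using that by (intro prom_cong) auto
        then show ?thesis by (simp add: prom_union prom_replicate)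
      qed
      then show ?thesis
        by (subst infsum_reindex_bij_betw[OF bij, symmetric]) (auto intro!: infsum_cong)
    qed
    also have "\<dots> = (\<Sum>\<^sub>\<infinity>k. \<Sum>\<^sub>\<infinity>m. ?k c k m * prom u m * z ^ k)"
      by (subst ennreal_infsum_restrict, subst ennreal_infsum_prod) (auto intro!: infsum_cong simp: ac_simps)
    finally show ?thesis by (simp add: ennreal_infsum_cmult_left)
  qed
  have ea: "0 < e a" "e a < \<top>" using insert.prems(1) by auto
  let ?e = "\<lambda>b. if b \<in> A then e b else 0"
  have top: "(\<lambda>b. if b \<in> insert a A then e b else 0) = ?e(a := e a)" by auto
  have fin: "(\<Sum>\<^sub>\<infinity>k. (\<Sum>\<^sub>\<infinity>m. ?k c k m * prom ?e m) * e a ^ k) < \<top>"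
    using insert.prems(3) unfolding top split .
  have kfin: "(\<Sum>\<^sub>\<infinity>m. ?k c k m * prom ?e m) < \<top>" for k
  proof -
    have "(\<Sum>\<^sub>\<infinity>m. ?k c k m * prom ?e m) * e a ^ k < \<top>"
      by (rule le_less_trans[OF ennreal_infsum_ge fin])
    moreover have "0 < e a ^ k" using ea by (simp add: ennreal_zero_less_power)
    ultimately show ?thesis by (rule ennreal_mult_less_topD)
  qed
  have eq: "(\<Sum>\<^sub>\<infinity>m. ?k c k m * prom u m) = (\<Sum>\<^sub>\<infinity>m. ?k d k m * prom u m)"
    if u: "\<And>b. u b \<le> ?e b" for u k
  proof (rule power_series_coeff_unique[OF ea])
    fix z assume "z \<le> e a"
    then have "(u(a := z)) b \<le> (if b \<in> insert a A then e b else 0)" for b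
      using u[of b] by (cases "b \<in> A") auto
    from insert.prems(2)[OF this]
    show "(\<Sum>\<^sub>\<infinity>k. (\<Sum>\<^sub>\<infinity>m. ?k c k m * prom u m) * z ^ k) =
        (\<Sum>\<^sub>\<infinity>k. (\<Sum>\<^sub>\<infinity>m. ?k d k m * prom u m) * z ^ k)"
      unfolding split .
  next
    have "(\<Sum>\<^sub>\<infinity>k. (\<Sum>\<^sub>\<infinity>m. ?k c k m * prom u m) * e a ^ k) \<le>
        (\<Sum>\<^sub>\<infinity>k. (\<Sum>\<^sub>\<infinity>m. ?k c k m * prom ?e m) * e a ^ k)"
      using u by (intro ennreal_infsum_mono mult_right_mono mult_left_mono prom_mono) auto
    then show "(\<Sum>\<^sub>\<infinity>k. (\<Sum>\<^sub>\<infinity>m. ?k c k m * prom u m) * e a ^ k) < \<top>"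
      using fin by (rule le_less_trans)
  qed
  let ?m = "filter_mset (\<lambda>b. b \<noteq> a) m"
  have "?k c (count m a) ?m = ?k d (count m a) ?m"
    by (rule insert.IH[OF _ eq kfin]) (use insert.prems in auto)
  moreover have "?m + replicate_mset (count m a) a = m"
    by (auto simp: multiset_eq_iff)
  ultimately show ?case by simp
qed

section \<open>Elements of the PCS of a type\<close>

declare den.simps [simp del]

lemma web_Nat [simp]: "web (den Nat) = range PNat"
  by (simp add: den.simps relabel_pcs_def nat_pcs_def)

lemma web_Fun: "web (den (Fun \<sigma> \<tau>)) = {PFun \<mu> b |\<mu> b. set_mset \<mu> \<subseteq> web (den \<sigma>) \<and> b \<in> web (den \<tau>)}"
  by (auto simp: den.simps relabel_pcs_def limpl_pcs_def bang_pcs_def Let_def image_iff)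

lemma PFun_in_web [simp]:
  "PFun \<mu> b \<in> web (den (Fun \<sigma> \<tau>)) \<longleftrightarrow> set_mset \<mu> \<subseteq> web (den \<sigma>) \<and> b \<in> web (den \<tau>)"
  "PNat n \<notin> web (den (Fun \<sigma> \<tau>))"
  by (auto simp: web_Fun)

text \<open>The elements of \<open>!\<sigma> \<multimap> \<tau>\<close> are tested by the tensors \<open>u\<^sup>! \<otimes> \<phi>\<close>: this avoids the biorthogonal
  closure in the definition of \<open>!\<sigma>\<close>.\<close>

primrec tests :: "ty \<Rightarrow> vec set" where
  "tests Nat = {\<lambda>_. 1}"
| "tests (Fun \<sigma> \<tau>) = {(\<lambda>p. case p of PNat n \<Rightarrow> 0 | PFun \<mu> b \<Rightarrow> prom u \<mu> * \<phi> b) |u \<phi>.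
     u \<in> elems (den \<sigma>) \<and> \<phi> \<in> tests \<tau>}"

text \<open>Shaped for the induction on types. The elements are the polar of the tests, and the two
  positivity clauses yield 0 < sup < \<infinity> at every point of the web: a test that is positive
  at a point bounds all elements there, and conversely. At an arrow type the clauses depend on one
  another, since a matrix that is positive at a given point has to be scaled by such bounds.\<close>

definition tested :: "ty \<Rightarrow> bool" where
  "tested \<sigma> \<longleftrightarrow>
     (\<forall>u. u \<in> elems (den \<sigma>) \<longleftrightarrow> u \<in> vectors (web (den \<sigma>)) \<and> (\<forall>\<phi>\<in>tests \<sigma>. (\<Sum>\<^sub>\<infinity>p. u p * \<phi> p) \<le> 1)) \<and>
     (\<forall>a\<in>web (den \<sigma>). \<exists>u\<in>elems (den \<sigma>). 0 < u a) \<and>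
     (\<forall>a\<in>web (den \<sigma>). \<exists>\<phi>\<in>tests \<sigma>. 0 < \<phi> a)"

lemma tested_elems_iff:
  "tested \<sigma> \<Longrightarrow> u \<in> elems (den \<sigma>) \<longleftrightarrow>
     u \<in> vectors (web (den \<sigma>)) \<and> (\<forall>\<phi>\<in>tests \<sigma>. (\<Sum>\<^sub>\<infinity>p. u p * \<phi> p) \<le> 1)"
  by (simp add: tested_def)

lemma ennreal_inverse_less_top: "x \<noteq> 0 \<Longrightarrow> inverse x < \<top>" for x :: ennreal
  by (metis ennreal_inverse_eq_top_iff top.not_eq_extremum)

lemma ennreal_inverse_mult_self: "0 < x \<Longrightarrow> x < \<top> \<Longrightarrow> inverse x * x = 1" for x :: ennreal
  by (metis divide_ennreal_def ennreal_divide_self less_irrefl mult.commute)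

lemma vectors_outside: "u \<in> vectors W \<Longrightarrow> a \<notin> W \<Longrightarrow> u a = 0"
  by (simp add: vectors_def)

lemma vectors_finite: "u \<in> vectors W \<Longrightarrow> u a < \<top>"
  by (cases "a \<in> W") (auto simp: vectors_def)

text \<open>The average of two elements is again an element, and it is positive wherever one of them
  is.\<close>

lemma tested_finite_support:
  assumes "tested \<sigma>" "finite A" "A \<subseteq> web (den \<sigma>)"
  shows "\<exists>u\<in>elems (den \<sigma>). \<forall>a\<in>A. 0 < u a"
  using assms(2,3)
proof (induction A rule: finite_induct)
  case empty
  have "(\<lambda>_. 0) \<in> elems (den \<sigma>)"
    using assms(1) by (simp add: tested_elems_iff vectors_def)
  then show ?case by auto
next
  case (insert a A)
  then obtain u where u: "u \<in> elems (den \<sigma>)" "\<forall>a\<in>A. 0 < u a" by auto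
  obtain v where v: "v \<in> elems (den \<sigma>)" "0 < v a"
    using insert.prems assms(1) by (auto simp: tested_def)
  let ?w = "\<lambda>a. inverse 2 * (u a + v a)"
  have half: "inverse 2 * (1 + 1) = (1::ennreal)" "inverse 2 < (\<top>::ennreal)"
    using ennreal_divide_self[of 2] by (auto simp: divide_ennreal_def mult.commute ennreal_inverse_less_top)
  have "?w \<in> elems (den \<sigma>)"
  proof -
    have "?w \<in> vectors (web (den \<sigma>))"
      using u v assms(1) half(2) by (auto simp: tested_elems_iff vectors_def ennreal_mult_less_top)
    moreover have "(\<Sum>\<^sub>\<infinity>p. ?w p * \<phi> p) \<le> 1" if "\<phi> \<in> tests \<sigma>" for \<phi>
    proof -
      have "(\<Sum>\<^sub>\<infinity>p. ?w p * \<phi> p) = inverse 2 * ((\<Sum>\<^sub>\<infinity>p. u p * \<phi> p) + (\<Sum>\<^sub>\<infinity>p. v p * \<phi> p))"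
        by (simp only: ennreal_infsum_add[symmetric] ennreal_infsum_cmult_right[symmetric])
          (simp add: algebra_simps)
      also have "\<dots> \<le> inverse 2 * (1 + 1)"
        using u v assms(1) that by (intro mult_left_mono add_mono) (auto simp: tested_elems_iff)
      finally show ?thesis unfolding half(1) .
    qed
    ultimately show ?thesis using assms(1) by (simp add: tested_elems_iff)
  qed
  moreover have "\<forall>b\<in>insert a A. 0 < ?w b"
    using u(2) v(2) by (auto simp: ennreal_zero_less_mult_iff ennreal_inverse_positive add_pos_nonneg add_nonneg_pos)
  ultimately show ?case by - (rule bexI[of _ ?w])
qed

lemma tests_finite:
  assumes "tested \<sigma>" "a \<in> web (den \<sigma>)"
  obtains K where "0 < K" "K < \<top>" "\<And>\<phi>. \<phi> \<in> tests \<sigma> \<Longrightarrow> \<phi> a \<le> K"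
proof -
  obtain u where u: "u \<in> elems (den \<sigma>)" "0 < u a"
    using assms by (auto simp: tested_def)
  have fin: "u a < \<top>" using u assms(1) by (auto simp: tested_elems_iff vectors_finite)
  have "\<phi> a \<le> inverse (u a)" if "\<phi> \<in> tests \<sigma>" for \<phi>
  proof -
    have "u a * \<phi> a \<le> (\<Sum>\<^sub>\<infinity>p. u p * \<phi> p)"
      by (rule ennreal_infsum_ge[where f = "\<lambda>p. u p * \<phi> p"])
    also have "\<dots> \<le> 1" using u that assms(1) by (simp add: tested_elems_iff)
    finally have "inverse (u a) * (u a * \<phi> a) \<le> inverse (u a) * 1"
      by (rule mult_left_mono) simp
    moreover have "inverse (u a) * (u a * \<phi> a) = \<phi> a"
      using u(2) fin by (simp add: mult.assoc[symmetric] ennreal_inverse_mult_self)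
    ultimately show ?thesis by simp
  qed
  moreover have "0 < inverse (u a)" "inverse (u a) < \<top>"
    using u(2) fin by (auto simp: ennreal_inverse_positive intro!: ennreal_inverse_less_top)
  ultimately show thesis using that by blast
qed

lemma elems_finite:
  assumes "tested \<sigma>" "a \<in> web (den \<sigma>)"
  obtains K where "0 < K" "K < \<top>" "\<And>u. u \<in> elems (den \<sigma>) \<Longrightarrow> u a \<le> K"
proof -
  obtain \<phi> where \<phi>: "\<phi> \<in> tests \<sigma>" "0 < \<phi> a"
    using assms by (auto simp: tested_def)
  obtain K where "K < \<top>" "\<And>\<phi>. \<phi> \<in> tests \<sigma> \<Longrightarrow> \<phi> a \<le> K"
    using tests_finite[OF assms] by metis
  with \<phi> have fin: "\<phi> a < \<top>" by (metis le_less_trans)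
  have "u a \<le> inverse (\<phi> a)" if "u \<in> elems (den \<sigma>)" for u
  proof -
    have "u a * \<phi> a \<le> (\<Sum>\<^sub>\<infinity>p. u p * \<phi> p)"
      by (rule ennreal_infsum_ge[where f = "\<lambda>p. u p * \<phi> p"])
    also have "\<dots> \<le> 1" using \<phi> that assms(1) by (simp add: tested_elems_iff)
    finally have "(u a * \<phi> a) * inverse (\<phi> a) \<le> 1 * inverse (\<phi> a)"
      by (rule mult_right_mono) simp
    moreover have "(u a * \<phi> a) * inverse (\<phi> a) = u a"
      using \<phi>(2) fin by (simp add: mult.assoc mult.commute[of "\<phi> a"] ennreal_inverse_mult_self)
    ultimately show ?thesis by simp
  qed
  moreover have "0 < inverse (\<phi> a)" "inverse (\<phi> a) < \<top>"
    using \<phi>(2) fin by (auto simp: ennreal_inverse_positive intro!: ennreal_inverse_less_top)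
  ultimately show thesis using that by blast
qed

section \<open>Elements at the base type and at arrow types\<close>

lemma elems_Nat_iff:
  "u \<in> elems (den Nat) \<longleftrightarrow> u \<in> vectors (range PNat) \<and> (\<Sum>\<^sub>\<infinity>n. u (PNat n)) \<le> 1"
  by (auto simp: den.simps relabel_pcs_def nat_pcs_def vectors_def)

lemma infsum_pt_Nat:
  fixes f :: "pt \<Rightarrow> ennreal"
  assumes "\<And>p. p \<notin> range PNat \<Longrightarrow> f p = 0"
  shows "(\<Sum>\<^sub>\<infinity>p. f p) = (\<Sum>\<^sub>\<infinity>n. f (PNat n))"
  by (rule ennreal_infsum_reindex) (auto simp: inj_on_def assms)

lemma infsum_pt_Fun:
  fixes f :: "pt \<Rightarrow> ennreal"
  assumes "\<And>n. f (PNat n) = 0"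
  shows "(\<Sum>\<^sub>\<infinity>p. f p) = (\<Sum>\<^sub>\<infinity>b. \<Sum>\<^sub>\<infinity>\<mu>. f (PFun \<mu> b))"
proof -
  have "f p = 0" if "p \<notin> range (\<lambda>(\<mu>, b). PFun \<mu> b)" for p
    using that assms by (cases p) auto
  then have "(\<Sum>\<^sub>\<infinity>p. f p) = (\<Sum>\<^sub>\<infinity>q. f (case q of (\<mu>, b) \<Rightarrow> PFun \<mu> b))"
    by (intro ennreal_infsum_reindex) (auto simp: inj_on_def)
  also have "\<dots> = (\<Sum>\<^sub>\<infinity>\<mu>. \<Sum>\<^sub>\<infinity>b. f (PFun \<mu> b))"
    by (simp add: ennreal_infsum_prod)
  finally show ?thesis by (simp add: ennreal_infsum_swap[of "\<lambda>\<mu> b. f (PFun \<mu> b)"])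
qed

text \<open>Extends \<open>fun_of\<close> from the vectors u^! to all elements of !\<sigma>, over
  which the definition of \<open>limpl_pcs\<close> quantifies.\<close>

definition bang_app :: "vec \<Rightarrow> (pt multiset \<Rightarrow> ennreal) \<Rightarrow> vec" where
  "bang_app t z = (\<lambda>b. \<Sum>\<^sub>\<infinity>\<mu>. t (PFun \<mu> b) * z \<mu>)"

lemma fun_of_eq_bang_app: "fun_of t u = bang_app t (prom u)"
  by (simp add: fun_of_def bang_app_def)

lemma bang_app_pairing:
  "(\<Sum>\<^sub>\<infinity>b. bang_app t z b * \<phi> b) = (\<Sum>\<^sub>\<infinity>\<mu>. (\<Sum>\<^sub>\<infinity>b. t (PFun \<mu> b) * \<phi> b) * z \<mu>)"
proof -
  have "(\<Sum>\<^sub>\<infinity>b. bang_app t z b * \<phi> b) = (\<Sum>\<^sub>\<infinity>b. \<Sum>\<^sub>\<infinity>\<mu>. t (PFun \<mu> b) * z \<mu> * \<phi> b)"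
    by (simp add: bang_app_def ennreal_infsum_cmult_left)
  also have "\<dots> = (\<Sum>\<^sub>\<infinity>\<mu>. \<Sum>\<^sub>\<infinity>b. t (PFun \<mu> b) * z \<mu> * \<phi> b)"
    by (rule ennreal_infsum_swap)
  also have "\<dots> = (\<Sum>\<^sub>\<infinity>\<mu>. \<Sum>\<^sub>\<infinity>b. t (PFun \<mu> b) * \<phi> b * z \<mu>)"
    by (simp add: ac_simps)
  finally show ?thesis by (simp add: ennreal_infsum_cmult_left)
qed

lemma elems_Fun_unfold:
  "t \<in> elems (den (Fun \<sigma> \<tau>)) \<longleftrightarrow> t \<in> vectors (web (den (Fun \<sigma> \<tau>))) \<and>
     (\<forall>z\<in>elems (bang_pcs (den \<sigma>)). bang_app t z \<in> elems (den \<tau>))"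
proof (cases "t \<in> vectors (web (den (Fun \<sigma> \<tau>)))")
  case True
  let ?W = "{\<mu>. set_mset \<mu> \<subseteq> web (den \<sigma>)}"
  let ?t = "\<lambda>a. if a \<in> ?W \<times> web (den \<tau>) then t (case a of (\<mu>, b) \<Rightarrow> PFun \<mu> b) else 0"
  have "mat_app ?W ?t z = bang_app t z" for z
  proof
    fix b
    show "mat_app ?W ?t z b = bang_app t z b"
      unfolding mat_app_def bang_app_def
      using vectors_outside[OF True] by (intro infsum_cong_neutral) auto
  qed
  moreover have "?t \<in> vectors (?W \<times> web (den \<tau>))"
    using vectors_finite[OF True] by (auto simp: vectors_def)
  moreover have "(\<lambda>(\<mu>, b). PFun \<mu> b) ` (?W \<times> web (den \<tau>)) = web (den (Fun \<sigma> \<tau>))"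
    by (auto simp: web_Fun)
  ultimately show ?thesis
    using True by (simp add: den.simps(2) relabel_pcs_def limpl_pcs_def bang_pcs_def Let_def)
next
  case False
  then show ?thesis
    by (auto simp: den.simps(2) relabel_pcs_def)
qed

lemma prom_in_bang:
  assumes "u \<in> vectors (web X)" "u \<in> elems X"
  shows "prom u \<in> elems (bang_pcs X)"
proof -
  let ?W = "{\<mu>. set_mset \<mu> \<subseteq> web X}"
  have "prom u \<in> vectors ?W"
    using assms(1) by (auto simp: vectors_def intro: prom_finite prom_eq_0)
  moreover have "(\<Sum>\<^sub>\<infinity>\<mu>\<in>?W. w \<mu> * prom u \<mu>) \<le> 1" if "w \<in> orth ?W (prom ` elems X)" for w
    using that assms(2) by (auto simp: orth_def mult.commute)
  ultimately show ?thesis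
    by (simp add: bang_pcs_def Let_def orth_def[of _ "orth _ _"])
qed

text \<open>Pairing the image of z with \<phi> is the same as pairing z with the transpose w of t
  applied to \<phi>. By \<open>le\<close>, w is orthogonal to all u^!, so its pairing with any z in
  their biorthogonal is at most 1. Hence bounds on the vectors u^! suffice.\<close>

lemma bang_app_in_elems:
  assumes \<sigma>: "tested \<sigma>" and \<tau>: "tested \<tau>"
    and t: "t \<in> vectors (web (den (Fun \<sigma> \<tau>)))"
    and le: "\<And>u \<phi>. u \<in> elems (den \<sigma>) \<Longrightarrow> \<phi> \<in> tests \<tau> \<Longrightarrow> (\<Sum>\<^sub>\<infinity>b. fun_of t u b * \<phi> b) \<le> 1"
    and z: "z \<in> elems (bang_pcs (den \<sigma>))"
  shows "bang_app t z \<in> elems (den \<tau>)"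
proof -
  let ?W = "{\<mu>. set_mset \<mu> \<subseteq> web (den \<sigma>)}"
  have outside: "t (PFun \<mu> b) = 0" if "\<mu> \<notin> ?W \<or> b \<notin> web (den \<tau>)" for \<mu> b
    using vectors_outside[OF t, of "PFun \<mu> b"] that by simp
  have test: "(\<Sum>\<^sub>\<infinity>b. bang_app t z b * \<phi> b) \<le> 1" if \<phi>: "\<phi> \<in> tests \<tau>" for \<phi>
  proof -
    define w where "w \<mu> = (\<Sum>\<^sub>\<infinity>b. t (PFun \<mu> b) * \<phi> b)" for \<mu>
    have w0: "w \<mu> = 0" if "\<mu> \<notin> ?W" for \<mu>
      using outside that by (simp add: w_def)
    have sum: "(\<Sum>\<^sub>\<infinity>\<mu>\<in>?W. z' \<mu> * w \<mu>) = (\<Sum>\<^sub>\<infinity>b. bang_app t z' b * \<phi> b)" for z'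
    proof -
      have "(\<Sum>\<^sub>\<infinity>\<mu>\<in>?W. z' \<mu> * w \<mu>) = (\<Sum>\<^sub>\<infinity>\<mu>. z' \<mu> * w \<mu>)"
        using w0 by (intro infsum_cong_neutral) auto
      also have "\<dots> = (\<Sum>\<^sub>\<infinity>\<mu>. w \<mu> * z' \<mu>)" by (simp only: mult.commute)
      finally show ?thesis by (simp only: bang_app_pairing w_def)
    qed
    \<comment> \<open>Some element u is positive on the support of \<mu>; then w at \<mu> times the
      positive number u^\<mu> is at most 1.\<close>
    have "w \<mu> < \<top>" if \<mu>: "\<mu> \<in> ?W" for \<mu>
    proof -
      obtain u where u: "u \<in> elems (den \<sigma>)" "\<forall>a\<in>set_mset \<mu>. 0 < u a"
        using tested_finite_support[OF \<sigma>, of "set_mset \<mu>"] \<mu> by auto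
      have "w \<mu> * prom u \<mu> \<le> (\<Sum>\<^sub>\<infinity>\<mu>. w \<mu> * prom u \<mu>)"
        by (rule ennreal_infsum_ge[where f = "\<lambda>\<mu>. w \<mu> * prom u \<mu>"])
      also have "\<dots> = (\<Sum>\<^sub>\<infinity>b. fun_of t u b * \<phi> b)"
        by (simp add: fun_of_eq_bang_app bang_app_pairing w_def)
      also have "\<dots> \<le> 1" using le u(1) \<phi> .
      finally have "w \<mu> * prom u \<mu> < \<top>" by (rule le_less_trans) simp
      moreover have "0 < prom u \<mu>" using u(2) by (intro prom_pos) auto
      ultimately show ?thesis by (rule ennreal_mult_less_topD)
    qed
    then have "w \<in> orth ?W (prom ` elems (den \<sigma>))"
      using w0 le \<phi> by (auto simp: orth_def vectors_def sum fun_of_eq_bang_app)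
    then have "(\<Sum>\<^sub>\<infinity>\<mu>\<in>?W. w \<mu> * z \<mu>) \<le> 1"
      using z by (auto simp: bang_pcs_def Let_def orth_def[of _ "orth _ _"])
    then show ?thesis using sum[of z] by (simp add: mult.commute)
  qed
  have "bang_app t z b < \<top>" if b: "b \<in> web (den \<tau>)" for b
  proof -
    obtain \<phi> where \<phi>: "\<phi> \<in> tests \<tau>" "0 < \<phi> b"
      using b \<tau> by (auto simp: tested_def)
    have "bang_app t z b * \<phi> b \<le> (\<Sum>\<^sub>\<infinity>b. bang_app t z b * \<phi> b)"
      by (rule ennreal_infsum_ge[where f = "\<lambda>b. bang_app t z b * \<phi> b"])
    also have "\<dots> \<le> 1" using test \<phi>(1) .
    finally have "bang_app t z b * \<phi> b < \<top>" by (rule le_less_trans) simp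
    then show ?thesis using \<phi>(2) by (rule ennreal_mult_less_topD)
  qed
  moreover have "bang_app t z b = 0" if "b \<notin> web (den \<tau>)" for b
    using outside that by (simp add: bang_app_def)
  ultimately show ?thesis
    using test \<tau> by (auto simp: tested_elems_iff vectors_def)
qed

lemma elems_Fun_iff_tests:
  assumes "tested \<sigma>" "tested \<tau>"
  shows "t \<in> elems (den (Fun \<sigma> \<tau>)) \<longleftrightarrow> t \<in> vectors (web (den (Fun \<sigma> \<tau>))) \<and>
    (\<forall>u\<in>elems (den \<sigma>). \<forall>\<phi>\<in>tests \<tau>. (\<Sum>\<^sub>\<infinity>b. fun_of t u b * \<phi> b) \<le> 1)"
proof safe
  assume t: "t \<in> elems (den (Fun \<sigma> \<tau>))"
  then show "t \<in> vectors (web (den (Fun \<sigma> \<tau>)))" by (simp add: elems_Fun_unfold)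
  fix u \<phi> assume u: "u \<in> elems (den \<sigma>)" and \<phi>: "\<phi> \<in> tests \<tau>"
  then have "prom u \<in> elems (bang_pcs (den \<sigma>))"
    using assms(1) by (simp add: prom_in_bang tested_elems_iff)
  then have "fun_of t u \<in> elems (den \<tau>)"
    using t by (simp add: elems_Fun_unfold fun_of_eq_bang_app)
  then show "(\<Sum>\<^sub>\<infinity>b. fun_of t u b * \<phi> b) \<le> 1"
    using assms(2) \<phi> by (simp add: tested_elems_iff)
next
  assume "t \<in> vectors (web (den (Fun \<sigma> \<tau>)))"
    "\<forall>u\<in>elems (den \<sigma>). \<forall>\<phi>\<in>tests \<tau>. (\<Sum>\<^sub>\<infinity>b. fun_of t u b * \<phi> b) \<le> 1"
  then show "t \<in> elems (den (Fun \<sigma> \<tau>))"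
    using bang_app_in_elems[OF assms] by (simp add: elems_Fun_unfold)
qed

lemma Fun_test_pairing:
  "(\<Sum>\<^sub>\<infinity>p. t p * (case p of PNat n \<Rightarrow> 0 | PFun \<mu> b \<Rightarrow> prom u \<mu> * \<phi> b)) = (\<Sum>\<^sub>\<infinity>b. fun_of t u b * \<phi> b)"
  unfolding fun_of_def ennreal_infsum_cmult_left[symmetric]
  by (subst infsum_pt_Fun) (simp_all add: ac_simps)

lemma tested: "tested \<sigma>"
proof (induction \<sigma>)
  case Nat
  have "(\<Sum>\<^sub>\<infinity>p. u p * 1) = (\<Sum>\<^sub>\<infinity>n. u (PNat n))" if "u \<in> vectors (range PNat)" for u
    using infsum_pt_Nat[of u] vectors_outside[OF that] by simp
  then have "\<forall>u. u \<in> elems (den Nat) \<longleftrightarrow>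
      u \<in> vectors (web (den Nat)) \<and> (\<forall>\<phi>\<in>tests Nat. (\<Sum>\<^sub>\<infinity>p. u p * \<phi> p) \<le> 1)"
    by (auto simp: elems_Nat_iff)
  moreover have "\<exists>u\<in>elems (den Nat). 0 < u a" if a: "a \<in> web (den Nat)" for a
  proof -
    obtain n where n: "a = PNat n" using a by auto
    have "(\<Sum>\<^sub>\<infinity>k. dirac n (PNat k)) = 1"
      by (subst ennreal_infsum_single[where a = n]) (auto simp: dirac_def)
    then have "dirac n \<in> elems (den Nat)"
      by (auto simp: elems_Nat_iff vectors_def dirac_def)
    then show ?thesis using n by (intro bexI[of _ "dirac n"]) (auto simp: dirac_def)
  qed
  ultimately show ?case by (auto simp: tested_def)
next
  case (Fun \<sigma> \<tau>)
  have iff: "u \<in> elems (den (Fun \<sigma> \<tau>)) \<longleftrightarrow> u \<in> vectors (web (den (Fun \<sigma> \<tau>))) \<and>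
      (\<forall>\<phi>\<in>tests (Fun \<sigma> \<tau>). (\<Sum>\<^sub>\<infinity>p. u p * \<phi> p) \<le> 1)" for u
    unfolding elems_Fun_iff_tests[OF Fun] tests.simps Fun_test_pairing[symmetric] by blast
  moreover have "\<exists>\<phi>\<in>tests (Fun \<sigma> \<tau>). 0 < \<phi> a" if a: "a \<in> web (den (Fun \<sigma> \<tau>))" for a
  proof -
    obtain \<mu> b where \<mu>: "a = PFun \<mu> b" "set_mset \<mu> \<subseteq> web (den \<sigma>)" "b \<in> web (den \<tau>)"
      using a by (auto simp: web_Fun)
    obtain u where u: "u \<in> elems (den \<sigma>)" "\<forall>a\<in>set_mset \<mu>. 0 < u a"
      using tested_finite_support[OF Fun(1), of "set_mset \<mu>"] \<mu> by auto
    obtain \<phi> where \<phi>: "\<phi> \<in> tests \<tau>" "0 < \<phi> b" using Fun(2) \<mu>(3) by (auto simp: tested_def)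
    have "0 < prom u \<mu> * \<phi> b"
      using prom_pos[of \<mu> u] u(2) \<phi>(2) by (simp add: ennreal_zero_less_mult_iff)
    then show ?thesis using u(1) \<phi>(1) \<mu>(1) by fastforce
  qed
  moreover have "\<exists>u\<in>elems (den (Fun \<sigma> \<tau>)). 0 < u a" if a: "a \<in> web (den (Fun \<sigma> \<tau>))" for a
  proof -
    obtain \<mu> b where \<mu>: "a = PFun \<mu> b" "set_mset \<mu> \<subseteq> web (den \<sigma>)" "b \<in> web (den \<tau>)"
      using a by (auto simp: web_Fun)
    have "\<exists>K>0. K < \<top> \<and> (\<forall>u\<in>elems (den \<sigma>). u a \<le> K)" if "a \<in># \<mu>" for a
      using elems_finite[OF Fun(1), of a] that \<mu>(2) by (metis subsetD)
    then obtain K where K: "\<And>a. a \<in># \<mu> \<Longrightarrow> 0 < K a \<and> K a < \<top> \<and> (\<forall>u\<in>elems (den \<sigma>). u a \<le> K a)"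
      by metis
    obtain K' where K': "0 < K'" "K' < \<top>" "\<And>\<phi>. \<phi> \<in> tests \<tau> \<Longrightarrow> \<phi> b \<le> K'"
      using tests_finite[OF Fun(2) \<mu>(3)] by metis
    \<comment> \<open>An upper bound of all tests at the point \<open>a\<close>, so that the point
      mass of height 1 / \<open>?C\<close> at \<open>a\<close> passes every test.\<close>
    let ?C = "prom K \<mu> * K'"
    have C: "0 < ?C" "?C < \<top>"
      using K K' prom_pos[of \<mu> K] prom_finite[of \<mu> K]
      by (auto simp: ennreal_zero_less_mult_iff ennreal_mult_less_top)
    have le: "prom u \<mu> \<le> prom K \<mu>" if "u \<in> elems (den \<sigma>)" for u
    proof -
      \<comment> \<open>\<open>K\<close> bounds the elements only on \<open>\<mu>\<close>; cutting
        \<open>u\<close> down to \<open>\<mu>\<close> makes the comparison hold at every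
        point.\<close>
      have "prom u \<mu> = prom (\<lambda>a. if a \<in># \<mu> then u a else 0) \<mu>" by (rule prom_cong) simp
      also have "\<dots> \<le> prom K \<mu>" using K that by (intro prom_mono) auto
      finally show ?thesis .
    qed
    let ?t = "\<lambda>p. if p = a then inverse ?C else 0"
    have "?t \<in> vectors (web (den (Fun \<sigma> \<tau>)))"
    proof -
      have "inverse ?C < \<top>" by (metis C(1) ennreal_inverse_less_top less_irrefl)
      then show ?thesis using a by (auto simp: vectors_def)
    qed
    moreover have "(\<Sum>\<^sub>\<infinity>p. ?t p * \<psi> p) \<le> 1" if \<psi>: "\<psi> \<in> tests (Fun \<sigma> \<tau>)" for \<psi>
    proof -
      have "\<psi> a \<le> ?C" using \<psi> \<mu>(1) le K' by (auto intro!: mult_mono)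
      then have "inverse ?C * \<psi> a \<le> inverse ?C * ?C" by (rule mult_left_mono) simp
      also have "\<dots> = 1" using C by (rule ennreal_inverse_mult_self)
      finally show ?thesis by (subst ennreal_infsum_single[where a = a]) auto
    qed
    ultimately have "?t \<in> elems (den (Fun \<sigma> \<tau>))" by (simp add: iff)
    moreover have "0 < inverse ?C" using C by (simp add: ennreal_inverse_positive)
    ultimately show ?thesis by (intro bexI[of _ ?t]) auto
  qed
  ultimately show ?case by (auto simp: tested_def)
qed

section \<open>Closure properties of the elements\<close>

lemmas elems_iff = tested_elems_iff[OF tested]

lemma elems_vectors: "u \<in> elems (den \<sigma>) \<Longrightarrow> u \<in> vectors (web (den \<sigma>))"
  by (simp add: elems_iff)

lemma elems_less_top: "u \<in> elems (den \<sigma>) \<Longrightarrow> u a < \<top>"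
  using vectors_finite elems_vectors by metis

lemma elems_outside: "u \<in> elems (den \<sigma>) \<Longrightarrow> a \<notin> web (den \<sigma>) \<Longrightarrow> u a = 0"
  using vectors_outside elems_vectors by metis

lemma fun_of_elems: "t \<in> elems (den (Fun \<sigma> \<tau>)) \<Longrightarrow> u \<in> elems (den \<sigma>) \<Longrightarrow> fun_of t u \<in> elems (den \<tau>)"
  using prom_in_bang[OF elems_vectors] by (auto simp: elems_Fun_unfold fun_of_eq_bang_app)

lemma elems_FunI:
  assumes "t \<in> vectors (web (den (Fun \<sigma> \<tau>)))"
    "\<And>u. u \<in> elems (den \<sigma>) \<Longrightarrow> fun_of t u \<in> elems (den \<tau>)"
  shows "t \<in> elems (den (Fun \<sigma> \<tau>))"
  using assms by (auto simp: elems_Fun_iff_tests[OF tested tested] elems_iff[of _ \<tau>])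

text \<open>Finiteness comes for free: at each point of the web some test is positive, and the bound
  on its pairing makes the entry finite.\<close>

lemma elemsI:
  assumes "\<And>a. a \<notin> web (den \<sigma>) \<Longrightarrow> u a = 0"
    and le: "\<And>\<phi>. \<phi> \<in> tests \<sigma> \<Longrightarrow> (\<Sum>\<^sub>\<infinity>p. u p * \<phi> p) \<le> 1"
  shows "u \<in> elems (den \<sigma>)"
proof -
  have "u a < \<top>" if a: "a \<in> web (den \<sigma>)" for a
  proof -
    obtain \<phi> where \<phi>: "\<phi> \<in> tests \<sigma>" "0 < \<phi> a"
      using a tested[of \<sigma>] by (auto simp: tested_def)
    have "u a * \<phi> a \<le> (\<Sum>\<^sub>\<infinity>p. u p * \<phi> p)"
      by (rule ennreal_infsum_ge[where f = "\<lambda>p. u p * \<phi> p"])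
    also have "\<dots> \<le> 1" using \<phi> by (simp add: le)
    finally have "u a * \<phi> a < \<top>" by (rule le_less_trans) simp
    then show ?thesis using \<phi>(2) by (rule ennreal_mult_less_topD)
  qed
  then show ?thesis using assms by (simp add: elems_iff vectors_def)
qed

lemma elems_mono: "u \<in> elems (den \<sigma>) \<Longrightarrow> (\<And>a. v a \<le> u a) \<Longrightarrow> v \<in> elems (den \<sigma>)"
proof (rule elemsI)
  fix a assume "u \<in> elems (den \<sigma>)" "\<And>a. v a \<le> u a" "a \<notin> web (den \<sigma>)"
  then show "v a = 0" by (metis elems_outside le_zero_eq)
next
  fix \<phi> assume u: "u \<in> elems (den \<sigma>)" "\<And>a. v a \<le> u a" and "\<phi> \<in> tests \<sigma>"
  then have "(\<Sum>\<^sub>\<infinity>p. u p * \<phi> p) \<le> 1" by (simp add: elems_iff)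
  moreover have "(\<Sum>\<^sub>\<infinity>p. v p * \<phi> p) \<le> (\<Sum>\<^sub>\<infinity>p. u p * \<phi> p)"
    using u(2) by (intro ennreal_infsum_mono mult_right_mono) auto
  ultimately show "(\<Sum>\<^sub>\<infinity>p. v p * \<phi> p) \<le> 1" by (rule order_trans[rotated])
qed

lemma elems_zero: "(\<lambda>_. 0) \<in> elems (den \<sigma>)"
  by (rule elemsI) auto

lemma elems_SUP:
  fixes u :: "nat \<Rightarrow> vec"
  assumes "\<And>n. u n \<in> elems (den \<sigma>)" "incseq u"
  shows "(\<lambda>a. SUP n. u n a) \<in> elems (den \<sigma>)"
proof (rule elemsI)
  fix a assume "a \<notin> web (den \<sigma>)"
  then show "(SUP n. u n a) = 0" by (simp add: elems_outside[OF assms(1)])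
next
  fix \<phi> assume \<phi>: "\<phi> \<in> tests \<sigma>"
  have "(\<Sum>\<^sub>\<infinity>p. (SUP n. u n p) * \<phi> p) = (SUP n. \<Sum>\<^sub>\<infinity>p. u n p * \<phi> p)"
    using assms(2) unfolding SUP_mult_right_ennreal
    by (intro ennreal_infsum_SUP) (auto simp: incseq_def le_fun_def intro: mult_right_mono)
  also have "\<dots> \<le> 1" using assms(1) \<phi> by (intro SUP_least) (simp add: elems_iff)
  finally show "(\<Sum>\<^sub>\<infinity>p. (SUP n. u n p) * \<phi> p) \<le> 1" .
qed

lemma dirac_elems: "dirac n \<in> elems (den Nat)"
proof -
  have "(\<Sum>\<^sub>\<infinity>k. dirac n (PNat k)) = 1"
    by (subst ennreal_infsum_single[where a = n]) (auto simp: dirac_def)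
  then show ?thesis by (auto simp: elems_Nat_iff vectors_def dirac_def)
qed

text \<open>Two matrices of possibly different types \<open>\<sigma> \<Rightarrow> \<tau>\<close> and \<open>\<sigma> \<Rightarrow> \<tau>'\<close> are allowed, so that an abstraction
  can be interpreted without reference to the type of its body.\<close>

lemma fun_of_inject:
  assumes t: "t \<in> elems (den (Fun \<sigma> \<tau>))" and t': "t' \<in> elems (den (Fun \<sigma> \<tau>'))"
    and eq: "\<And>u. u \<in> elems (den \<sigma>) \<Longrightarrow> fun_of t u = fun_of t' u"
  shows "t = t'"
proof
  fix p
  show "t p = t' p"
  proof (cases p)
    case (PNat n)
    then show ?thesis using t t' by (simp add: elems_outside)
  next
    case (PFun \<mu> b)
    show ?thesis
    proof (cases "set_mset \<mu> \<subseteq> web (den \<sigma>)")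
      case False
      then have "t p = 0" "t' p = 0"
        using PFun by (auto intro!: elems_outside[OF t] elems_outside[OF t'])
      then show ?thesis by simp
    next
      case True
      obtain e where e: "e \<in> elems (den \<sigma>)" "\<forall>a\<in>set_mset \<mu>. 0 < e a"
        using tested_finite_support[OF tested[of \<sigma>], of "set_mset \<mu>"] True by auto
      have "t (PFun \<mu> b) = t' (PFun \<mu> b)"
      proof (rule coefficients_unique[where A = "set_mset \<mu>" and e = e])
        show "0 < e a \<and> e a < \<top>" if "a \<in># \<mu>" for a
          using e that by (simp add: elems_less_top)
        show "(\<Sum>\<^sub>\<infinity>m. t (PFun m b) * prom u m) = (\<Sum>\<^sub>\<infinity>m. t' (PFun m b) * prom u m)"
          if "\<And>a. u a \<le> (if a \<in># \<mu> then e a else 0)" for u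
        proof -
          have "u a \<le> e a" for a using that[of a] by (auto split: if_splits)
          then have "u \<in> elems (den \<sigma>)" using e(1) by (rule elems_mono[rotated])
          from fun_cong[OF eq[OF this], of b] show ?thesis by (simp add: fun_of_def)
        qed
        have "(\<lambda>a. if a \<in># \<mu> then e a else 0) \<in> elems (den \<sigma>)"
          by (rule elems_mono[OF e(1)]) auto
        from elems_less_top[OF fun_of_elems[OF t this], of b]
        show "(\<Sum>\<^sub>\<infinity>m. t (PFun m b) * prom (\<lambda>a. if a \<in># \<mu> then e a else 0) m) < \<top>"
          by (simp add: fun_of_def)
      qed auto
      then show ?thesis using PFun by simp
    qed
  qed
qed

section \<open>The weighted semantics\<close>

text \<open>All constructs that are linear in an argument of type \<open>nat\<close>, and also \<open>coin\<close> and the labels, are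
  interpreted by \<open>mix\<close>, so that one lemma about \<open>mix\<close> per topic covers them all.\<close>

definition mix :: "(nat \<Rightarrow> ennreal) \<Rightarrow> (nat \<Rightarrow> vec) \<Rightarrow> vec" where
  "mix p v = (\<lambda>a. \<Sum>\<^sub>\<infinity>n. p n * v n a)"

definition lam :: "ty \<Rightarrow> (vec \<Rightarrow> vec) \<Rightarrow> vec" where
  "lam \<sigma> f = (THE t. (\<exists>\<tau>. t \<in> elems (den (Fun \<sigma> \<tau>))) \<and> (\<forall>u\<in>elems (den \<sigma>). fun_of t u = f u))"

text \<open>\<open>LetIn\<close> extends the environment by a Dirac vector where \<open>sem\<close>
  substitutes a numeral, which makes the recursion structural. In the predecessor, truncated
  subtraction sends 0 to 0. A label is a mixture of mass \<open>r l\<close> concentrated at 0, just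
  like the test of a variable with value \<open>r l * dirac 0\<close> in the spy
  translation.\<close>

primrec wsem :: "('l \<Rightarrow> ennreal) \<Rightarrow> 'l tm \<Rightarrow> (vname \<Rightarrow> vec) \<Rightarrow> vec" where
  "wsem r (Lit n) = (\<lambda>\<rho>. dirac n)"
| "wsem r (Succ M) = (\<lambda>\<rho>. mix (\<lambda>n. wsem r M \<rho> (PNat n)) (\<lambda>n. dirac (n + 1)))"
| "wsem r (Pred M) = (\<lambda>\<rho>. mix (\<lambda>n. wsem r M \<rho> (PNat n)) (\<lambda>n. dirac (n - 1)))"
| "wsem r (Var x) = (\<lambda>\<rho>. \<rho> x)"
| "wsem r (Coin q) = (\<lambda>\<rho>. mix (\<lambda>n. if n = 0 then ennreal (of_rat q)
     else if n = 1 then ennreal (1 - of_rat q) else 0) dirac)"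
| "wsem r (LetIn x M N) = (\<lambda>\<rho>. mix (\<lambda>n. wsem r M \<rho> (PNat n)) (\<lambda>n. wsem r N (\<rho>(x := dirac n))))"
| "wsem r (IfZ M N P) = (\<lambda>\<rho>. mix (\<lambda>n. wsem r M \<rho> (PNat n)) (\<lambda>n. if n = 0 then wsem r N \<rho> else wsem r P \<rho>))"
| "wsem r (App M N) = (\<lambda>\<rho>. fun_of (wsem r M \<rho>) (wsem r N \<rho>))"
| "wsem r (Lam x \<sigma> M) = (\<lambda>\<rho>. lam \<sigma> (\<lambda>u. wsem r M (\<rho>(x := u))))"
| "wsem r (Fix M) = (\<lambda>\<rho> a. SUP n. (fun_of (wsem r M \<rho>) ^^ n) (\<lambda>_. 0) a)"
| "wsem r (Lab l M) = (\<lambda>\<rho>. mix (\<lambda>n. if n = 0 then r l else 0) (\<lambda>_. wsem r M \<rho>))"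

section \<open>Mixtures, application and fixpoints\<close>

lemma mix_elems:
  assumes "(\<Sum>\<^sub>\<infinity>n. p n) \<le> 1" "\<And>n. v n \<in> elems (den \<sigma>)"
  shows "mix p v \<in> elems (den \<sigma>)"
proof (rule elemsI)
  fix a assume "a \<notin> web (den \<sigma>)"
  then show "mix p v a = 0" by (simp add: mix_def elems_outside[OF assms(2)])
next
  fix \<phi> assume \<phi>: "\<phi> \<in> tests \<sigma>"
  have "(\<Sum>\<^sub>\<infinity>a. mix p v a * \<phi> a) = (\<Sum>\<^sub>\<infinity>a. \<Sum>\<^sub>\<infinity>n. p n * (v n a * \<phi> a))"
    by (simp add: mix_def ennreal_infsum_cmult_left[symmetric] mult.assoc)
  also have "\<dots> = (\<Sum>\<^sub>\<infinity>n. p n * (\<Sum>\<^sub>\<infinity>a. v n a * \<phi> a))"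
    by (subst ennreal_infsum_swap) (simp add: ennreal_infsum_cmult_right)
  also have "\<dots> \<le> (\<Sum>\<^sub>\<infinity>n. p n * 1)"
    using assms(2) \<phi> by (intro ennreal_infsum_mono mult_left_mono) (auto simp: elems_iff)
  also have "\<dots> \<le> 1" using assms(1) by simp
  finally show "(\<Sum>\<^sub>\<infinity>a. mix p v a * \<phi> a) \<le> 1" .
qed

lemma elems_Nat_sum: "u \<in> elems (den Nat) \<Longrightarrow> (\<Sum>\<^sub>\<infinity>n. u (PNat n)) \<le> 1"
  by (simp add: elems_Nat_iff)

lemma fun_of_mono: "(\<And>a. u a \<le> v a) \<Longrightarrow> fun_of t u b \<le> fun_of t v b"
  unfolding fun_of_def by (intro ennreal_infsum_mono mult_left_mono prom_mono) auto

lemma fun_of_mix: "fun_of (mix p v) u = mix p (\<lambda>n. fun_of (v n) u)"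
proof
  fix b
  have "fun_of (mix p v) u b = (\<Sum>\<^sub>\<infinity>\<mu>. \<Sum>\<^sub>\<infinity>n. p n * (v n (PFun \<mu> b) * prom u \<mu>))"
    by (simp add: mix_def fun_of_def ennreal_infsum_cmult_left[symmetric] mult.assoc)
  then show "fun_of (mix p v) u b = mix p (\<lambda>n. fun_of (v n) u) b"
    by (subst (asm) ennreal_infsum_swap) (simp add: ennreal_infsum_cmult_right mix_def fun_of_def)
qed

lemma prom_SUP:
  fixes u :: "nat \<Rightarrow> 'a \<Rightarrow> ennreal"
  assumes "\<And>a. incseq (\<lambda>n. u n a)"
  shows "prom (\<lambda>a. SUP n. u n a) \<mu> = (SUP n. prom (u n) \<mu>)"
proof (induction \<mu>)
  case (add a \<mu>)
  have "incseq (\<lambda>n. prom (u n) \<mu>)"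
    using assms by (auto simp: incseq_def intro!: prom_mono)
  then show ?case by (simp add: add ennreal_SUP_mult assms)
qed simp

lemma fun_of_SUP:
  fixes u :: "nat \<Rightarrow> vec"
  assumes "\<And>a. incseq (\<lambda>n. u n a)"
  shows "fun_of t (\<lambda>a. SUP n. u n a) b = (SUP n. fun_of t (u n) b)"
  unfolding fun_of_def prom_SUP[OF assms] SUP_mult_left_ennreal
  by (rule ennreal_infsum_SUP)
    (use assms in \<open>auto simp: incseq_def intro!: mult_left_mono prom_mono\<close>)

lemma iterate_mono: "(fun_of t ^^ n) (\<lambda>_. 0) a \<le> (fun_of t ^^ Suc n) (\<lambda>_. 0) a"
proof (induction n arbitrary: a)
  case (Suc n)
  then show ?case by (auto intro: fun_of_mono)
qed simp

lemma iterate_incseq: "incseq (\<lambda>n. (fun_of t ^^ n) (\<lambda>_. 0) a)"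
  by (rule incseq_SucI) (rule iterate_mono)

lemma iterate_elems:
  assumes "t \<in> elems (den (Fun \<sigma> \<sigma>))"
  shows "(fun_of t ^^ n) (\<lambda>_. 0) \<in> elems (den \<sigma>)"
  by (induction n) (auto intro: elems_zero fun_of_elems assms)

lemma fixpoint_elems:
  assumes "t \<in> elems (den (Fun \<sigma> \<sigma>))"
  shows "(\<lambda>a. SUP n. (fun_of t ^^ n) (\<lambda>_. 0) a) \<in> elems (den \<sigma>)"
  by (rule elems_SUP)
    (use iterate_elems[OF assms] iterate_incseq[of t] in \<open>auto simp: incseq_def le_fun_def\<close>)

text \<open>Application commutes with suprema of increasing sequences, so the supremum of the
  iterates from 0 is a fixpoint.\<close>

lemma wsem_Fix_unfold: "fun_of (wsem r M \<rho>) (wsem r (Fix M) \<rho>) = wsem r (Fix M) \<rho>"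
proof
  fix b
  let ?F = "fun_of (wsem r M \<rho>)"
  have "?F (wsem r (Fix M) \<rho>) b = (SUP n. (?F ^^ Suc n) (\<lambda>_. 0) b)"
    by (simp add: fun_of_SUP[OF iterate_incseq])
  also have "\<dots> = (SUP n. (?F ^^ n) (\<lambda>_. 0) b)"
    by (rule SUP_eq) (use iterate_mono in blast)+
  finally show "?F (wsem r (Fix M) \<rho>) b = wsem r (Fix M) \<rho> b" by simp
qed

section \<open>Terms in context as power series\<close>

definition env_ok :: "ctx \<Rightarrow> (vname \<Rightarrow> vec) \<Rightarrow> bool" where
  "env_ok \<Gamma> \<rho> \<longleftrightarrow> (\<forall>x \<sigma>. \<Gamma> x = Some \<sigma> \<longrightarrow> \<rho> x \<in> elems (den \<sigma>))"

lemma env_ok_upd: "env_ok \<Gamma> \<rho> \<Longrightarrow> u \<in> elems (den \<sigma>) \<Longrightarrow> env_ok (\<Gamma>(x \<mapsto> \<sigma>)) (\<rho>(x := u))"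
  by (auto simp: env_ok_def)

text \<open>Agreement with a series is demanded only on environments of the context, because
  elsewhere an abstraction is an unspecified vector. \<open>curry\<close> merges variable and point
  into one index of the series.\<close>

definition ctx_analytic :: "ctx \<Rightarrow> ((vname \<Rightarrow> vec) \<Rightarrow> ennreal) \<Rightarrow> bool" where
  "ctx_analytic \<Gamma> f \<longleftrightarrow> (\<exists>g. analytic (\<lambda>e. g (curry e)) \<and> (\<forall>\<rho>. env_ok \<Gamma> \<rho> \<longrightarrow> f \<rho> = g \<rho>))"

lemma ctx_analyticI: "analytic (\<lambda>e. g (curry e)) \<Longrightarrow> (\<And>\<rho>. env_ok \<Gamma> \<rho> \<Longrightarrow> f \<rho> = g \<rho>) \<Longrightarrow> ctx_analytic \<Gamma> f"
  by (auto simp: ctx_analytic_def)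

lemma ctx_analytic_const: "ctx_analytic \<Gamma> (\<lambda>_. c)"
  by (rule ctx_analyticI[where g = "\<lambda>_. c"]) (auto intro: analytic_const)

lemma ctx_analytic_var: "ctx_analytic \<Gamma> (\<lambda>\<rho>. \<rho> x a)"
  by (rule ctx_analyticI[where g = "\<lambda>\<rho>. \<rho> x a"]) (auto intro: analytic_proj)

lemma ctx_analytic_mult:
  assumes "ctx_analytic \<Gamma> f" "ctx_analytic \<Gamma> f'"
  shows "ctx_analytic \<Gamma> (\<lambda>\<rho>. f \<rho> * f' \<rho>)"
proof -
  obtain g g' where g: "analytic (\<lambda>e. g (curry e))" "\<And>\<rho>. env_ok \<Gamma> \<rho> \<Longrightarrow> f \<rho> = g \<rho>"
    "analytic (\<lambda>e. g' (curry e))" "\<And>\<rho>. env_ok \<Gamma> \<rho> \<Longrightarrow> f' \<rho> = g' \<rho>"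
    using assms by (auto simp: ctx_analytic_def)
  show ?thesis
    by (rule ctx_analyticI[where g = "\<lambda>\<rho>. g \<rho> * g' \<rho>"]) (auto intro: analytic_mult g simp: g(2,4))
qed

text \<open>Application and fixpoints involve infinitely many entries of a vector, so the series are
  chosen for all of them at once.\<close>

lemma ctx_analytic_choice:
  assumes "\<And>j. ctx_analytic \<Gamma> (f j)"
  shows "\<exists>g. (\<forall>j. analytic (\<lambda>e. g j (curry e))) \<and> (\<forall>j \<rho>. env_ok \<Gamma> \<rho> \<longrightarrow> f j \<rho> = g j \<rho>)"
proof -
  have "\<forall>j. \<exists>g. analytic (\<lambda>e. g (curry e)) \<and> (\<forall>\<rho>. env_ok \<Gamma> \<rho> \<longrightarrow> f j \<rho> = g \<rho>)"
    using assms by (simp add: ctx_analytic_def)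
  then obtain g where "\<forall>j. analytic (\<lambda>e. g j (curry e)) \<and> (\<forall>\<rho>. env_ok \<Gamma> \<rho> \<longrightarrow> f j \<rho> = g j \<rho>)"
    by (rule choice[THEN exE])
  then show ?thesis by (intro exI[of _ g]) simp
qed

lemma ctx_analytic_infsum:
  assumes "\<And>j. ctx_analytic \<Gamma> (f j)"
  shows "ctx_analytic \<Gamma> (\<lambda>\<rho>. \<Sum>\<^sub>\<infinity>j. f j \<rho>)"
proof -
  obtain g where g: "\<And>j. analytic (\<lambda>e. g j (curry e))" "\<And>j \<rho>. env_ok \<Gamma> \<rho> \<Longrightarrow> f j \<rho> = g j \<rho>"
    using ctx_analytic_choice[of \<Gamma> f, OF assms] by blast
  show ?thesis
    by (rule ctx_analyticI[where g = "\<lambda>\<rho>. \<Sum>\<^sub>\<infinity>j. g j \<rho>"]) (auto intro: analytic_infsum g simp: g(2))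
qed

text \<open>Both halves are needed at an abstraction: the series of the body supplies the matrix
  entries, and membership makes them finite and puts the matrix into the PCS.\<close>

definition power_series :: "ctx \<Rightarrow> ty \<Rightarrow> ((vname \<Rightarrow> vec) \<Rightarrow> vec) \<Rightarrow> bool" where
  "power_series \<Gamma> \<sigma> f \<longleftrightarrow> (\<forall>\<rho>. env_ok \<Gamma> \<rho> \<longrightarrow> f \<rho> \<in> elems (den \<sigma>)) \<and> (\<forall>b. ctx_analytic \<Gamma> (\<lambda>\<rho>. f \<rho> b))"

lemma power_series_mix:
  assumes "\<And>\<rho>. env_ok \<Gamma> \<rho> \<Longrightarrow> (\<Sum>\<^sub>\<infinity>n. p \<rho> n) \<le> 1" "\<And>n. ctx_analytic \<Gamma> (\<lambda>\<rho>. p \<rho> n)"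
    "\<And>n. power_series \<Gamma> \<sigma> (\<lambda>\<rho>. v \<rho> n)"
  shows "power_series \<Gamma> \<sigma> (\<lambda>\<rho>. mix (p \<rho>) (v \<rho>))"
  using assms unfolding power_series_def
  by (auto intro!: mix_elems) (auto simp: mix_def intro!: ctx_analytic_infsum ctx_analytic_mult)

lemma power_series_mix_Nat:
  assumes "power_series \<Gamma> Nat f" "\<And>n. power_series \<Gamma> \<sigma> (\<lambda>\<rho>. v \<rho> n)"
  shows "power_series \<Gamma> \<sigma> (\<lambda>\<rho>. mix (\<lambda>n. f \<rho> (PNat n)) (v \<rho>))"
  using assms by (intro power_series_mix) (auto simp: power_series_def elems_Nat_sum)

lemma power_series_dirac: "power_series \<Gamma> Nat (\<lambda>\<rho>. dirac n)"
  by (auto simp: power_series_def dirac_elems ctx_analytic_const)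

lemma power_series_let:
  assumes "power_series (\<Gamma>(x \<mapsto> \<sigma>)) \<tau> f" "u \<in> elems (den \<sigma>)"
  shows "power_series \<Gamma> \<tau> (\<lambda>\<rho>. f (\<rho>(x := u)))"
proof -
  have "ctx_analytic \<Gamma> (\<lambda>\<rho>. f (\<rho>(x := u)) b)" for b
  proof -
    obtain g where g: "analytic (\<lambda>e. g (curry e))"
        "\<And>\<rho>. env_ok (\<Gamma>(x \<mapsto> \<sigma>)) \<rho> \<Longrightarrow> f \<rho> b = g \<rho>"
      using assms(1) unfolding power_series_def ctx_analytic_def by metis
    have "analytic (\<lambda>e. g (curry (\<lambda>(y, a). if y = x then u a else e (y, a))))"
    proof (rule analytic_compose[OF g(1)])
      show "analytic (\<lambda>e. case i of (y, a) \<Rightarrow> if y = x then u a else e (y, a))" for i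
        by (cases i; cases "fst i = x") (auto simp: analytic_const analytic_proj)
    qed
    moreover have "curry (\<lambda>(y, a). if y = x then u a else e (y, a)) = (curry e)(x := u)" for e
      by (auto simp: fun_eq_iff)
    ultimately show ?thesis
      using g(2) env_ok_upd[OF _ assms(2)] by (intro ctx_analyticI[where g = "\<lambda>\<rho>. g (\<rho>(x := u))"]) auto
  qed
  then show ?thesis
    using assms env_ok_upd by (auto simp: power_series_def)
qed

lemma power_series_App:
  assumes "power_series \<Gamma> (Fun \<sigma> \<tau>) f" "power_series \<Gamma> \<sigma> g"
  shows "power_series \<Gamma> \<tau> (\<lambda>\<rho>. fun_of (f \<rho>) (g \<rho>))"
proof -
  have fg: "ctx_analytic \<Gamma> (\<lambda>\<rho>. f \<rho> b)" "ctx_analytic \<Gamma> (\<lambda>\<rho>. g \<rho> b)" for b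
    using assms by (auto simp: power_series_def)
  obtain f' where f': "\<And>j. analytic (\<lambda>e. f' j (curry e))" "\<And>j \<rho>. env_ok \<Gamma> \<rho> \<Longrightarrow> f \<rho> j = f' j \<rho>"
    using ctx_analytic_choice[of \<Gamma> "\<lambda>j \<rho>. f \<rho> j", OF fg(1)] by blast
  obtain g' where g': "\<And>j. analytic (\<lambda>e. g' j (curry e))" "\<And>j \<rho>. env_ok \<Gamma> \<rho> \<Longrightarrow> g \<rho> j = g' j \<rho>"
    using ctx_analytic_choice[of \<Gamma> "\<lambda>j \<rho>. g \<rho> j", OF fg(2)] by blast
  have "ctx_analytic \<Gamma> (\<lambda>\<rho>. fun_of (f \<rho>) (g \<rho>) b)" for b
  proof (rule ctx_analyticI[where g = "\<lambda>\<rho>. fun_of (\<lambda>j. f' j \<rho>) (\<lambda>j. g' j \<rho>) b"])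
    show "analytic (\<lambda>e. fun_of (\<lambda>j. f' j (curry e)) (\<lambda>j. g' j (curry e)) b)"
      by (intro analytic_fun_of f' g')
    fix \<rho> assume "env_ok \<Gamma> \<rho>"
    then have "f \<rho> = (\<lambda>j. f' j \<rho>)" "g \<rho> = (\<lambda>j. g' j \<rho>)"
      by (auto simp: f'(2) g'(2))
    then show "fun_of (f \<rho>) (g \<rho>) b = fun_of (\<lambda>j. f' j \<rho>) (\<lambda>j. g' j \<rho>) b" by simp
  qed
  then show ?thesis using assms by (auto simp: power_series_def intro: fun_of_elems)
qed

lemma power_series_Fix:
  assumes "power_series \<Gamma> (Fun \<sigma> \<sigma>) f"
  shows "power_series \<Gamma> \<sigma> (\<lambda>\<rho> a. SUP n. (fun_of (f \<rho>) ^^ n) (\<lambda>_. 0) a)"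
proof -
  have f: "ctx_analytic \<Gamma> (\<lambda>\<rho>. f \<rho> b)" for b
    using assms by (auto simp: power_series_def)
  obtain f' where f': "\<And>j. analytic (\<lambda>e. f' j (curry e))" "\<And>j \<rho>. env_ok \<Gamma> \<rho> \<Longrightarrow> f \<rho> j = f' j \<rho>"
    using ctx_analytic_choice[of \<Gamma> "\<lambda>j \<rho>. f \<rho> j", OF f] by blast
  have "ctx_analytic \<Gamma> (\<lambda>\<rho>. SUP n. (fun_of (f \<rho>) ^^ n) (\<lambda>_. 0) b)" for b
  proof (rule ctx_analyticI[where g = "\<lambda>\<rho>. SUP n. (fun_of (\<lambda>j. f' j \<rho>) ^^ n) (\<lambda>_. 0) b"])
    show "analytic (\<lambda>e. SUP n. (fun_of (\<lambda>j. f' j (curry e)) ^^ n) (\<lambda>_. 0) b)"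
      by (intro analytic_fixpoint f')
    fix \<rho> assume "env_ok \<Gamma> \<rho>"
    then have "f \<rho> = (\<lambda>j. f' j \<rho>)" by (auto simp: f'(2))
    then show "(SUP n. (fun_of (f \<rho>) ^^ n) (\<lambda>_. 0) b) = (SUP n. (fun_of (\<lambda>j. f' j \<rho>) ^^ n) (\<lambda>_. 0) b)"
      by simp
  qed
  then show ?thesis using assms by (auto simp: power_series_def intro: fixpoint_elems)
qed

lemma lam_eqI:
  assumes "t \<in> elems (den (Fun \<sigma> \<tau>))" "\<And>u. u \<in> elems (den \<sigma>) \<Longrightarrow> fun_of t u = f u"
  shows "lam \<sigma> f = t"
  unfolding lam_def
proof (rule the_equality)
  fix t' assume "(\<exists>\<tau>. t' \<in> elems (den (Fun \<sigma> \<tau>))) \<and> (\<forall>u\<in>elems (den \<sigma>). fun_of t' u = f u)"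
  then obtain \<tau>' where "t' \<in> elems (den (Fun \<sigma> \<tau>'))" "\<forall>u\<in>elems (den \<sigma>). fun_of t' u = f u"
    by blast
  then show "t' = t" using fun_of_inject[OF _ assms(1), of t' \<tau>'] assms(2) by simp
qed (use assms in blast)

text \<open>The matrix \<open>T \<rho>\<close> consists of the coefficients of the body in the
  coordinates of \<open>x\<close>. It represents the body on the PCS, so its entries are finite, as
  is seen by applying it to some u positive on \<mu>. By uniqueness of coefficients it is the vector
  that \<open>lam\<close> describes, and its entries are again series in \<rho>.\<close>

lemma power_series_lam:
  assumes f: "power_series (\<Gamma>(x \<mapsto> \<sigma>)) \<tau> f"
  shows "power_series \<Gamma> (Fun \<sigma> \<tau>) (\<lambda>\<rho>. lam \<sigma> (\<lambda>u. f (\<rho>(x := u))))"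
    and "\<And>\<rho> u. env_ok \<Gamma> \<rho> \<Longrightarrow> u \<in> elems (den \<sigma>) \<Longrightarrow>
      fun_of (lam \<sigma> (\<lambda>u. f (\<rho>(x := u)))) u = f (\<rho>(x := u))"
proof -
  have f': "ctx_analytic (\<Gamma>(x \<mapsto> \<sigma>)) (\<lambda>\<rho>. f \<rho> b)" for b
    using f by (auto simp: power_series_def)
  obtain g where g: "\<And>b. analytic (\<lambda>e. g b (curry e))"
      "\<And>b \<rho>. env_ok (\<Gamma>(x \<mapsto> \<sigma>)) \<rho> \<Longrightarrow> f \<rho> b = g b \<rho>"
    using ctx_analytic_choice[of "\<Gamma>(x \<mapsto> \<sigma>)" "\<lambda>b \<rho>. f \<rho> b", OF f'] by blast
  have "\<exists>c. (\<forall>\<mu>. analytic (c \<mu>)) \<and> (\<forall>\<rho> u. g b (\<rho>(x := u)) = (\<Sum>\<^sub>\<infinity>\<mu>. c \<mu> (case_prod \<rho>) * prom u \<mu>))" for b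
  proof (rule analytic_coefficients[OF g(1)[of b], of x])
    fix c assume c: "\<And>\<mu>. analytic (c \<mu>)"
      "\<And>e u. g b (curry (\<lambda>(y, a). if y = x then u a else e (y, a))) = (\<Sum>\<^sub>\<infinity>\<mu>. c \<mu> e * prom u \<mu>)"
    have "curry (\<lambda>(y, a). if y = x then u a else case_prod \<rho> (y, a)) = \<rho>(x := u)" for \<rho> :: "vname \<Rightarrow> vec" and u
      by (auto simp: fun_eq_iff)
    then have "g b (\<rho>(x := u)) = (\<Sum>\<^sub>\<infinity>\<mu>. c \<mu> (case_prod \<rho>) * prom u \<mu>)" for \<rho> u
      using c(2)[of u "case_prod \<rho>"] by simp
    with c(1) show ?thesis by blast
  qed
  then have "\<forall>b. \<exists>c. (\<forall>\<mu>. analytic (c \<mu>)) \<and>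
      (\<forall>\<rho> u. g b (\<rho>(x := u)) = (\<Sum>\<^sub>\<infinity>\<mu>. c \<mu> (case_prod \<rho>) * prom u \<mu>))"
    by (rule allI)
  then obtain c where "\<forall>b. (\<forall>\<mu>. analytic (c b \<mu>)) \<and>
      (\<forall>\<rho> u. g b (\<rho>(x := u)) = (\<Sum>\<^sub>\<infinity>\<mu>. c b \<mu> (case_prod \<rho>) * prom u \<mu>))"
    by (rule choice[THEN exE])
  then have c: "\<And>b \<mu>. analytic (c b \<mu>)"
    "\<And>b \<rho> u. g b (\<rho>(x := u)) = (\<Sum>\<^sub>\<infinity>\<mu>. c b \<mu> (case_prod \<rho>) * prom u \<mu>)"
    by auto
  \<comment> \<open>The series of the body need not respect the webs, so its coefficients are cut
    off outside. No value changes: u^\<mu> vanishes if \<mu> leaves the web of \<sigma>, and the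
    body vanishes outside the web of \<tau>.\<close>
  define T where "T \<rho> p = (case p of PNat n \<Rightarrow> 0 | PFun \<mu> b \<Rightarrow>
    if p \<in> web (den (Fun \<sigma> \<tau>)) then c b \<mu> (case_prod \<rho>) else 0)" for \<rho> :: "vname \<Rightarrow> vec" and p
  have app: "fun_of (T \<rho>) u = f (\<rho>(x := u))" if \<rho>: "env_ok \<Gamma> \<rho>" and u: "u \<in> elems (den \<sigma>)" for \<rho> u
  proof
    fix b
    have fe: "f (\<rho>(x := u)) \<in> elems (den \<tau>)"
      using f env_ok_upd[OF \<rho> u] by (auto simp: power_series_def)
    show "fun_of (T \<rho>) u b = f (\<rho>(x := u)) b"
    proof (cases "b \<in> web (den \<tau>)")
      case False
      then show ?thesis using elems_outside[OF fe] by (simp add: fun_of_def T_def)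
    next
      case True
      have "T \<rho> (PFun \<mu> b) * prom u \<mu> = c b \<mu> (case_prod \<rho>) * prom u \<mu>" for \<mu>
      proof (cases "set_mset \<mu> \<subseteq> web (den \<sigma>)")
        case False
        then obtain a where "a \<in># \<mu>" "a \<notin> web (den \<sigma>)" by auto
        then have "prom u \<mu> = 0" using elems_outside[OF u] by (intro prom_eq_0) auto
        then show ?thesis by simp
      qed (simp add: T_def True)
      then have "fun_of (T \<rho>) u b = g b (\<rho>(x := u))" by (simp add: fun_of_def c(2))
      then show ?thesis using g(2)[OF env_ok_upd[OF \<rho> u]] by simp
    qed
  qed
  have T: "T \<rho> \<in> elems (den (Fun \<sigma> \<tau>))" if \<rho>: "env_ok \<Gamma> \<rho>" for \<rho>
  proof (rule elems_FunI)
    have fe: "fun_of (T \<rho>) u \<in> elems (den \<tau>)" if "u \<in> elems (den \<sigma>)" for u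
      using f env_ok_upd[OF \<rho> that] by (auto simp: power_series_def app[OF \<rho> that])
    then show "\<And>u. u \<in> elems (den \<sigma>) \<Longrightarrow> fun_of (T \<rho>) u \<in> elems (den \<tau>)" .
    have "T \<rho> p < \<top>" if p: "p \<in> web (den (Fun \<sigma> \<tau>))" for p
    proof -
      obtain \<mu> b where \<mu>: "p = PFun \<mu> b" "set_mset \<mu> \<subseteq> web (den \<sigma>)"
        using p by (auto simp: web_Fun)
      obtain u where u: "u \<in> elems (den \<sigma>)" "\<forall>a\<in>set_mset \<mu>. 0 < u a"
        using tested_finite_support[OF tested[of \<sigma>], of "set_mset \<mu>"] \<mu>(2) by auto
      have "T \<rho> p * prom u \<mu> \<le> fun_of (T \<rho>) u b"
        unfolding fun_of_def \<mu>(1) by (rule ennreal_infsum_ge[where f = "\<lambda>\<mu>. T \<rho> (PFun \<mu> b) * prom u \<mu>"])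
      also have "\<dots> < \<top>" by (rule elems_less_top[OF fe[OF u(1)]])
      finally show ?thesis
        by (rule ennreal_mult_less_topD) (use u(2) in \<open>auto intro: prom_pos\<close>)
    qed
    moreover have "T \<rho> p = 0" if "p \<notin> web (den (Fun \<sigma> \<tau>))" for p
      using that by (cases p) (auto simp: T_def)
    ultimately show "T \<rho> \<in> vectors (web (den (Fun \<sigma> \<tau>)))"
      unfolding vectors_def by blast
  qed
  have lam: "lam \<sigma> (\<lambda>u. f (\<rho>(x := u))) = T \<rho>" if "env_ok \<Gamma> \<rho>" for \<rho>
    using T[OF that] app[OF that] by (rule lam_eqI)
  show "fun_of (lam \<sigma> (\<lambda>u. f (\<rho>(x := u)))) u = f (\<rho>(x := u))"
    if "env_ok \<Gamma> \<rho>" "u \<in> elems (den \<sigma>)" for \<rho> u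
    unfolding lam[OF that(1)] by (rule app[OF that])
  have "ctx_analytic \<Gamma> (\<lambda>\<rho>. lam \<sigma> (\<lambda>u. f (\<rho>(x := u))) p)" for p
  proof (rule ctx_analyticI[where g = "\<lambda>\<rho>. T \<rho> p"])
    show "analytic (\<lambda>e. T (curry e) p)"
    proof (cases "p \<in> web (den (Fun \<sigma> \<tau>))")
      case True
      then obtain \<mu> b where p: "p = PFun \<mu> b" by (auto simp: web_Fun)
      then have "(\<lambda>e. T (curry e) p) = c b \<mu>" using True by (simp add: T_def)
      then show ?thesis using c(1)[of b \<mu>] by simp
    next
      case False
      then have "T (curry e) p = 0" for e by (cases p) (auto simp: T_def)
      then show ?thesis using analytic_const[of 0] by simp
    qed
    show "lam \<sigma> (\<lambda>u. f (\<rho>(x := u))) p = T \<rho> p" if "env_ok \<Gamma> \<rho>" for \<rho>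
      unfolding lam[OF that] ..
  qed
  moreover have "lam \<sigma> (\<lambda>u. f (\<rho>(x := u))) \<in> elems (den (Fun \<sigma> \<tau>))" if "env_ok \<Gamma> \<rho>" for \<rho>
    unfolding lam[OF that] by (rule T[OF that])
  ultimately show "power_series \<Gamma> (Fun \<sigma> \<tau>) (\<lambda>\<rho>. lam \<sigma> (\<lambda>u. f (\<rho>(x := u))))"
    unfolding power_series_def by blast
qed

lemma of_rat_coin: "0 \<le> q \<Longrightarrow> q \<le> 1 \<Longrightarrow> 0 \<le> (of_rat q :: real) \<and> (of_rat q :: real) \<le> 1"
  by (simp add: of_rat_less_eq[where 'a = real, of _ 1, simplified])

lemma coin_sum:
  assumes "0 \<le> q" "q \<le> 1"
  shows "(\<Sum>\<^sub>\<infinity>n::nat. if n = 0 then ennreal (of_rat q) else if n = 1 then ennreal (1 - of_rat q) else 0) \<le> 1"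
  by (subst ennreal_infsum_nat, subst ennreal_infsum_nat)
    (use of_rat_coin[OF assms] in \<open>simp add: ennreal_plus[symmetric] del: ennreal_plus\<close>)

lemma power_series_wsem:
  assumes "typed \<Gamma> M \<sigma>" "\<And>l. r l \<le> 1"
  shows "power_series \<Gamma> \<sigma> (wsem r M)"
  using assms(1)
proof induction
  case (4 \<Gamma> x \<sigma>)
  then show ?case by (auto simp: power_series_def env_ok_def ctx_analytic_var)
next
  case (5 q \<Gamma>)
  then show ?case
    using coin_sum by (auto intro!: power_series_mix power_series_dirac ctx_analytic_const)
next
  case (6 \<Gamma> M x N \<sigma>)
  show ?case
    unfolding wsem.simps
    by (intro power_series_mix_Nat power_series_let[where f = "wsem r N", OF _ dirac_elems] 6(3,4))
next
  case (7 \<Gamma> M N \<sigma> P)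
  have "power_series \<Gamma> \<sigma> (\<lambda>\<rho>. if n = 0 then wsem r N \<rho> else wsem r P \<rho>)" for n :: nat
    using 7 by (cases "n = 0") auto
  then show ?case using 7 by (auto intro!: power_series_mix_Nat)
next
  case (8 \<Gamma> M \<sigma> \<tau> N)
  then show ?case by (auto intro: power_series_App)
next
  case (9 \<Gamma> x \<sigma> M \<tau>)
  show ?case unfolding wsem.simps by (rule power_series_lam(1)[OF 9(2)])
next
  case (10 \<Gamma> M \<sigma>)
  then show ?case by (auto intro: power_series_Fix)
next
  case (11 \<Gamma> M \<sigma> l)
  have "(\<Sum>\<^sub>\<infinity>n::nat. if n = 0 then r l else 0) \<le> 1"
    by (subst ennreal_infsum_nat) (simp add: assms(2))
  then show ?case using 11 by (auto intro!: power_series_mix ctx_analytic_const)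
qed (auto intro!: power_series_mix_Nat power_series_dirac)

lemma wsem_elems:
  assumes "typed \<Gamma> M \<sigma>" "\<And>l. r l \<le> 1" "env_ok \<Gamma> \<rho>"
  shows "wsem r M \<rho> \<in> elems (den \<sigma>)"
  using power_series_wsem[OF assms(1,2)] assms(3) by (simp add: power_series_def)

lemma wsem_beta:
  assumes "typed (\<Gamma>(x \<mapsto> \<sigma>)) M \<tau>" "\<And>l. r l \<le> 1" "env_ok \<Gamma> \<rho>" "u \<in> elems (den \<sigma>)"
  shows "fun_of (wsem r (Lam x \<sigma> M) \<rho>) u = wsem r M (\<rho>(x := u))"
  using power_series_lam(2)[OF power_series_wsem[OF assms(1,2)] assms(3,4)] by simp

section \<open>Typing and interpretation of substituted terms\<close>

lemma typed_weaken: "typed \<Gamma> M \<sigma> \<Longrightarrow> \<Gamma> \<subseteq>\<^sub>m \<Gamma>' \<Longrightarrow> typed \<Gamma>' M \<sigma>"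
proof (induction arbitrary: \<Gamma>' rule: typed.induct)
  case (4 \<Gamma> x \<sigma>)
  then show ?case by (intro typed.intros) (metis domI map_le_def)
next
  case (6 \<Gamma> M x N \<sigma>)
  show ?case by (rule typed.intros(6)[OF 6(3)[OF 6(5)] 6(4)[OF map_le_upd[OF 6(5)]]])
next
  case (9 \<Gamma> x \<sigma> M \<tau>)
  show ?case by (rule typed.intros(9)[OF 9(2)[OF map_le_upd[OF 9(3)]]])
qed (auto intro: typed.intros)

lemma typed_subst:
  assumes N: "typed Map.empty N \<sigma>"
  shows "typed (\<Gamma>(x \<mapsto> \<sigma>)) M \<tau> \<Longrightarrow> typed \<Gamma> (subst x N M) \<tau>"
proof (induction M arbitrary: \<Gamma> \<tau>)
  case (Var y)
  have "typed \<Gamma> N \<sigma>" by (rule typed_weaken[OF N]) simp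
  with Var show ?case by (auto elim!: typed_elims(4) intro: typed.intros split: if_splits)
next
  case (LetIn y M1 M2)
  have M: "typed (\<Gamma>(x \<mapsto> \<sigma>)) M1 Nat" "typed (\<Gamma>(x \<mapsto> \<sigma>, y \<mapsto> Nat)) M2 \<tau>"
    using LetIn.prems by (blast elim: typed_elims(6))+
  show ?case
  proof (cases "y = x")
    case True
    then have "typed (\<Gamma>(y \<mapsto> Nat)) M2 \<tau>" using M(2) by (simp only: fun_upd_upd)
    from typed.intros(6)[OF LetIn.IH(1)[OF M(1)] this] True show ?thesis by simp
  next
    case False
    then have "typed (\<Gamma>(y \<mapsto> Nat)) (subst x N M2) \<tau>"
      using M(2) by (intro LetIn.IH(2)) (simp only: fun_upd_twist[OF False])
    from typed.intros(6)[OF LetIn.IH(1)[OF M(1)] this] False show ?thesis by simp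
  qed
next
  case (App M1 M2)
  obtain \<sigma>' where "typed (\<Gamma>(x \<mapsto> \<sigma>)) M1 (Fun \<sigma>' \<tau>)" "typed (\<Gamma>(x \<mapsto> \<sigma>)) M2 \<sigma>'"
    using App.prems by (blast elim: typed_elims(8))
  from typed.intros(8)[OF App.IH(1)[OF this(1)] App.IH(2)[OF this(2)]] show ?case by simp
next
  case (Lam y \<sigma>' M)
  obtain \<tau>' where M: "\<tau> = Fun \<sigma>' \<tau>'" "typed (\<Gamma>(x \<mapsto> \<sigma>, y \<mapsto> \<sigma>')) M \<tau>'"
    using Lam.prems by (blast elim: typed_elims(9))
  show ?case
  proof (cases "y = x")
    case True
    then have "typed (\<Gamma>(y \<mapsto> \<sigma>')) M \<tau>'" using M(2) by (simp only: fun_upd_upd)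
    from typed.intros(9)[OF this] True M(1) show ?thesis by simp
  next
    case False
    then have "typed (\<Gamma>(y \<mapsto> \<sigma>')) (subst x N M) \<tau>'"
      using M(2) by (intro Lam.IH) (simp only: fun_upd_twist[OF False])
    from typed.intros(9)[OF this] False M(1) show ?thesis by simp
  qed
qed (auto elim!: typed_elims intro: typed.intros)

lemma wsem_cong:
  "typed \<Gamma> M \<sigma> \<Longrightarrow> (\<And>y. y \<in> dom \<Gamma> \<Longrightarrow> \<rho> y = \<rho>' y) \<Longrightarrow> wsem r M \<rho> = wsem r M \<rho>'"
proof (induction arbitrary: \<rho> \<rho>' rule: typed.induct)
  case (4 \<Gamma> x \<sigma>)
  then show ?case by auto
next
  case (6 \<Gamma> M x N \<sigma>)
  have "wsem r N (\<rho>(x := dirac n)) = wsem r N (\<rho>'(x := dirac n))" for n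
    by (rule 6(4)) (auto intro!: 6(5) domI)
  moreover have "wsem r M \<rho> = wsem r M \<rho>'" by (rule 6(3)) (rule 6(5))
  ultimately show ?case by simp
next
  case (9 \<Gamma> x \<sigma> M \<tau>)
  have "wsem r M (\<rho>(x := u)) = wsem r M (\<rho>'(x := u))" for u
    by (rule 9(2)) (auto intro!: 9(3) domI)
  then show ?case by simp
next
  case (2 \<Gamma> M)
  show ?case by (simp only: wsem.simps 2(2)[OF 2(3)])
next
  case (3 \<Gamma> M)
  show ?case by (simp only: wsem.simps 3(2)[OF 3(3)])
next
  case (7 \<Gamma> M N \<sigma> P)
  show ?case by (simp only: wsem.simps 7(4)[OF 7(7)] 7(5)[OF 7(7)] 7(6)[OF 7(7)])
next
  case (8 \<Gamma> M \<sigma> \<tau> N)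
  show ?case by (simp only: wsem.simps 8(3)[OF 8(5)] 8(4)[OF 8(5)])
next
  case (10 \<Gamma> M \<sigma>)
  show ?case by (simp only: wsem.simps 10(2)[OF 10(3)])
next
  case (11 \<Gamma> M \<sigma> l)
  show ?case by (simp only: wsem.simps 11(2)[OF 11(3)])
qed simp_all

lemma wsem_closed: "typed Map.empty N \<sigma> \<Longrightarrow> wsem r N \<rho> = wsem r N \<rho>'"
  by (rule wsem_cong) auto

text \<open>A closed term has the same value in all environments. Hence \<open>\<rho>'\<close> is
  arbitrary, and the value of \<open>N\<close> is unchanged under the binders of
  \<open>M\<close>.\<close>

lemma wsem_subst:
  assumes N: "typed Map.empty N \<sigma>"
  shows "wsem r (subst x N M) \<rho> = wsem r M (\<rho>(x := wsem r N \<rho>'))"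
proof (induction M arbitrary: \<rho>)
  case (Var y)
  show ?case using wsem_closed[OF N, of r \<rho> \<rho>'] by simp
next
  case (LetIn y M1 M2)
  have "wsem r (if y = x then M2 else subst x N M2) (\<rho>(y := u)) = wsem r M2 (\<rho>(x := wsem r N \<rho>', y := u))" for u
  proof (cases "y = x")
    case False
    then show ?thesis by (simp only: LetIn.IH(2) if_False fun_upd_twist[OF False])
  qed simp
  with LetIn.IH(1) show ?case by (simp only: wsem.simps subst.simps)
next
  case (Lam y \<sigma> M)
  have "wsem r (if y = x then M else subst x N M) (\<rho>(y := u)) = wsem r M (\<rho>(x := wsem r N \<rho>', y := u))" for u
  proof (cases "y = x")
    case False
    then show ?thesis by (simp only: Lam.IH if_False fun_upd_twist[OF False])
  qed simp
  then show ?case by (simp only: wsem.simps subst.simps)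
qed (simp_all cong: if_cong)

section \<open>The spy translation\<close>

lemma type_of_eq: "typed \<Gamma> M \<sigma> \<Longrightarrow> type_of \<Gamma> M = \<sigma>"
  unfolding type_of_def by (blast intro: the_equality typed_unique)

lemma typed_Omega: "typed \<Gamma> (Omega \<sigma>) \<sigma>"
  unfolding Omega_def by (auto intro!: typed.intros)

lemma subst_Omega: "subst x N (Omega \<sigma>) = Omega \<sigma>"
  by (simp add: Omega_def)

lemma vars_subst_Lit: "vars (subst x (Lit n) M) \<subseteq> vars M"
  by (induction M) auto

lemma labels_subst_Lit: "labels (subst x (Lit n) M) = labels M"
  by (induction M) auto

text \<open>The clause of \<open>sem\<close> for \<open>LetIn\<close> substitutes numerals into a
  translated body, whereas the induction hypothesis in \<open>sem_Spy\<close> is about the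
  translation of a substituted body. At a label the two sides contain \<open>Omega\<close> at types
  computed from different terms and contexts; typing makes these types equal.\<close>

lemma Spy_subst:
  assumes "typed (\<Gamma>(y \<mapsto> Nat)) M \<sigma>" "labels M \<subseteq> L" "y \<notin> x ` L"
  shows "Spy x \<Gamma> (subst y (Lit n) M) = subst y (Lit n) (Spy x (\<Gamma>(y \<mapsto> Nat)) M)"
  using assms
proof (induction M arbitrary: \<Gamma> \<sigma>)
  case (LetIn z M1 M2)
  have M: "typed (\<Gamma>(y \<mapsto> Nat)) M1 Nat" "typed (\<Gamma>(y \<mapsto> Nat, z \<mapsto> Nat)) M2 \<sigma>"
    using LetIn.prems by (blast elim: typed_elims(6))+
  have 1: "Spy x \<Gamma> (subst y (Lit n) M1) = subst y (Lit n) (Spy x (\<Gamma>(y \<mapsto> Nat)) M1)"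
    by (rule LetIn.IH(1)[OF M(1)]) (use LetIn.prems(2,3) in auto)
  show ?case
  proof (cases "z = y")
    case True
    show ?thesis
      using 1 unfolding True by (simp only: subst.simps Spy.simps simp_thms if_True fun_upd_upd)
  next
    case False
    have "typed (\<Gamma>(z \<mapsto> Nat, y \<mapsto> Nat)) M2 \<sigma>"
      using M(2) by (simp only: fun_upd_twist[OF False])
    then have "Spy x (\<Gamma>(z \<mapsto> Nat)) (subst y (Lit n) M2) = subst y (Lit n) (Spy x (\<Gamma>(z \<mapsto> Nat, y \<mapsto> Nat)) M2)"
      by (rule LetIn.IH(2)) (use LetIn.prems(2,3) in auto)
    then show ?thesis
      using 1 False by (simp only: subst.simps Spy.simps if_False fun_upd_twist[OF False])
  qed
next
  case (App M1 M2)
  obtain \<sigma>' where M: "typed (\<Gamma>(y \<mapsto> Nat)) M1 (Fun \<sigma>' \<sigma>)" "typed (\<Gamma>(y \<mapsto> Nat)) M2 \<sigma>'"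
    using App.prems by (blast elim: typed_elims(8))
  have L: "labels M1 \<subseteq> L" "labels M2 \<subseteq> L" using App.prems by auto
  show ?case
    by (simp only: subst.simps Spy.simps App.IH(1)[OF M(1) L(1) App.prems(3)]
        App.IH(2)[OF M(2) L(2) App.prems(3)])
next
  case (Lam z \<sigma>' M)
  obtain \<tau> where M: "typed (\<Gamma>(y \<mapsto> Nat, z \<mapsto> \<sigma>')) M \<tau>"
    using Lam.prems by (blast elim: typed_elims(9))
  show ?case
  proof (cases "z = y")
    case True
    show ?thesis
      unfolding True by (simp only: subst.simps Spy.simps simp_thms if_True fun_upd_upd)
  next
    case False
    have "typed (\<Gamma>(z \<mapsto> \<sigma>', y \<mapsto> Nat)) M \<tau>"
      using M by (simp only: fun_upd_twist[OF False])
    then have "Spy x (\<Gamma>(z \<mapsto> \<sigma>')) (subst y (Lit n) M) = subst y (Lit n) (Spy x (\<Gamma>(z \<mapsto> \<sigma>', y \<mapsto> Nat)) M)"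
      by (rule Lam.IH) (use Lam.prems(2,3) in auto)
    then show ?thesis
      using False by (simp only: subst.simps Spy.simps if_False fun_upd_twist[OF False])
  qed
next
  case (Lab l M)
  have M: "typed (\<Gamma>(y \<mapsto> Nat)) M \<sigma>" using Lab.prems by (blast elim: typed_elims(11))
  have "typed \<Gamma> (subst y (Lit n) M) \<sigma>" by (rule typed_subst[OF _ M]) (rule typed.intros)
  then have "type_of \<Gamma> (subst y (Lit n) M) = type_of (\<Gamma>(y \<mapsto> Nat)) M"
    using M by (simp add: type_of_eq)
  moreover have "x l \<noteq> y" using Lab.prems by auto
  moreover have "Spy x \<Gamma> (subst y (Lit n) M) = subst y (Lit n) (Spy x (\<Gamma>(y \<mapsto> Nat)) M)"
    by (rule Lab.IH[OF M]) (use Lab.prems(2,3) in auto)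
  ultimately show ?case by (simp only: subst.simps Spy.simps subst_Omega if_False)
next
  case (IfZ M1 M2 M3)
  have M: "typed (\<Gamma>(y \<mapsto> Nat)) M1 Nat" "typed (\<Gamma>(y \<mapsto> Nat)) M2 \<sigma>" "typed (\<Gamma>(y \<mapsto> Nat)) M3 \<sigma>"
    using IfZ.prems by (blast elim: typed_elims(7))+
  have L: "labels M1 \<subseteq> L" "labels M2 \<subseteq> L" "labels M3 \<subseteq> L" using IfZ.prems by auto
  show ?case
    by (simp only: subst.simps Spy.simps IfZ.IH(1)[OF M(1) L(1) IfZ.prems(3)]
        IfZ.IH(2)[OF M(2) L(2) IfZ.prems(3)] IfZ.IH(3)[OF M(3) L(3) IfZ.prems(3)])
next
  case (Fix M)
  have "typed (\<Gamma>(y \<mapsto> Nat)) M (Fun \<sigma> \<sigma>)" using Fix.prems by (blast elim: typed_elims(10))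
  from Fix.IH[OF this] Fix.prems(2,3) show ?case by simp
next
  case (Succ M)
  have "typed (\<Gamma>(y \<mapsto> Nat)) M Nat" using Succ.prems by (blast elim: typed_elims(2))
  from Succ.IH[OF this] Succ.prems(2,3) show ?case by simp
next
  case (Pred M)
  have "typed (\<Gamma>(y \<mapsto> Nat)) M Nat" using Pred.prems by (blast elim: typed_elims(3))
  from Pred.IH[OF this] Pred.prems(2,3) show ?case by simp
qed simp_all

text \<open>A relation instead of the concrete \<open>spy_ctx\<close>, so that it survives when both
  contexts are extended by a bound variable.\<close>

definition spy_ctx_ext :: "('l \<Rightarrow> vname) \<Rightarrow> 'l set \<Rightarrow> ctx \<Rightarrow> ctx \<Rightarrow> bool" where
  "spy_ctx_ext x L \<Gamma> \<Gamma>' \<longleftrightarrow> (\<forall>y. y \<notin> x ` L \<longrightarrow> \<Gamma>' y = \<Gamma> y) \<and> (\<forall>l\<in>L. \<Gamma>' (x l) = Some Nat)"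

definition spy_env_ext ::
    "('l \<Rightarrow> vname) \<Rightarrow> 'l set \<Rightarrow> ('l \<Rightarrow> ennreal) \<Rightarrow> (vname \<Rightarrow> vec) \<Rightarrow> (vname \<Rightarrow> vec) \<Rightarrow> bool" where
  "spy_env_ext x L r \<rho> \<rho>' \<longleftrightarrow>
     (\<forall>y. y \<notin> x ` L \<longrightarrow> \<rho>' y = \<rho> y) \<and> (\<forall>l\<in>L. \<rho>' (x l) = (\<lambda>a. r l * dirac 0 a))"

lemma spy_ctx_ext_upd: "spy_ctx_ext x L \<Gamma> \<Gamma>' \<Longrightarrow> y \<notin> x ` L \<Longrightarrow> spy_ctx_ext x L (\<Gamma>(y \<mapsto> \<sigma>)) (\<Gamma>'(y \<mapsto> \<sigma>))"
  by (auto simp: spy_ctx_ext_def)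

lemma spy_env_ext_upd: "spy_env_ext x L r \<rho> \<rho>' \<Longrightarrow> y \<notin> x ` L \<Longrightarrow> spy_env_ext x L r (\<rho>(y := u)) (\<rho>'(y := u))"
  by (auto simp: spy_env_ext_def)

lemma typed_Spy:
  "typed \<Gamma> M \<sigma> \<Longrightarrow> labels M \<subseteq> L \<Longrightarrow> x ` L \<inter> vars M = {} \<Longrightarrow> spy_ctx_ext x L \<Gamma> \<Gamma>' \<Longrightarrow>
    typed \<Gamma>' (Spy x \<Gamma> M) \<sigma>"
proof (induction arbitrary: \<Gamma>' rule: typed.induct)
  case (4 \<Gamma> y \<sigma>)
  then show ?case by (auto intro!: typed.intros simp: spy_ctx_ext_def)
next
  case (6 \<Gamma> M y N \<sigma>)
  have "typed (\<Gamma>'(y \<mapsto> Nat)) (Spy x (\<Gamma>(y \<mapsto> Nat)) N) \<sigma>"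
    using 6(5,6) by (intro 6(4) spy_ctx_ext_upd[OF 6(7)]) auto
  moreover have "typed \<Gamma>' (Spy x \<Gamma> M) Nat" using 6(5,6) by (intro 6(3)[OF _ _ 6(7)]) auto
  ultimately show ?case by (simp add: typed.intros(6))
next
  case (7 \<Gamma> M N \<sigma> P)
  have "typed \<Gamma>' (Spy x \<Gamma> M) Nat" by (rule 7(4)[OF _ _ 7(9)]) (use 7(7,8) in auto)
  moreover have "typed \<Gamma>' (Spy x \<Gamma> N) \<sigma>" by (rule 7(5)[OF _ _ 7(9)]) (use 7(7,8) in auto)
  moreover have "typed \<Gamma>' (Spy x \<Gamma> P) \<sigma>" by (rule 7(6)[OF _ _ 7(9)]) (use 7(7,8) in auto)
  ultimately show ?case by (simp add: typed.intros(7))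
next
  case (8 \<Gamma> M \<sigma> \<tau> N)
  have "typed \<Gamma>' (Spy x \<Gamma> M) (Fun \<sigma> \<tau>)" by (rule 8(3)[OF _ _ 8(7)]) (use 8(5,6) in auto)
  moreover have "typed \<Gamma>' (Spy x \<Gamma> N) \<sigma>" by (rule 8(4)[OF _ _ 8(7)]) (use 8(5,6) in auto)
  ultimately show ?case by (simp add: typed.intros(8))
next
  case (9 \<Gamma> y \<sigma> M \<tau>)
  have "typed (\<Gamma>'(y \<mapsto> \<sigma>)) (Spy x (\<Gamma>(y \<mapsto> \<sigma>)) M) \<tau>"
    using 9(3,4) by (intro 9(2) spy_ctx_ext_upd[OF 9(5)]) auto
  then show ?case by (simp add: typed.intros(9))
next
  case (11 \<Gamma> M \<sigma> l)
  have "typed \<Gamma>' (Spy x \<Gamma> M) \<sigma>" using 11 by auto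
  moreover have "typed \<Gamma>' (Var (x l)) Nat"
    using 11(3,5) by (auto intro!: typed.intros simp: spy_ctx_ext_def)
  ultimately show ?case
    unfolding Spy.simps type_of_eq[OF 11(1)] by (intro typed.intros(7) typed_Omega)
qed (auto intro: typed.intros)

text \<open>The induction is on the size because \<open>LetIn\<close> leads to bodies with a numeral
  substituted. At an abstraction the description in \<open>sem\<close> is satisfied by the value of
  \<open>wsem\<close>, and \<open>fun_of_inject\<close> makes it the only solution.\<close>

lemma sem_Spy:
  assumes "typed \<Gamma> M \<sigma>" "labels M \<subseteq> L" "x ` L \<inter> vars M = {}"
    "spy_ctx_ext x L \<Gamma> \<Gamma>'" "spy_env_ext x L r \<rho> \<rho>'" "env_ok \<Gamma> \<rho>"
    and r: "\<And>l. r l \<le> 1"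
  shows "sem \<Gamma>' (Spy x \<Gamma> M) \<rho>' = wsem r M \<rho>"
  using assms(1-6)
proof (induction "tm_size M" arbitrary: M \<Gamma> \<Gamma>' \<rho> \<rho>' \<sigma> rule: less_induct)
  case less
  note IH = less.hyps and prems = less.prems
  show ?case
  proof (cases M)
    case (Succ M1)
    have "sem \<Gamma>' (Spy x \<Gamma> M1) \<rho>' = wsem r M1 \<rho>"
      using prems Succ by (intro IH[OF _ _ _ _ prems(4-6)]) (auto elim: typed_elims)
    then show ?thesis by (simp add: Succ mix_def)
  next
    case (Pred M1)
    have "sem \<Gamma>' (Spy x \<Gamma> M1) \<rho>' = wsem r M1 \<rho>"
      using prems Pred by (intro IH[OF _ _ _ _ prems(4-6)]) (auto elim: typed_elims)
    then show ?thesis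
      unfolding Pred Spy.simps sem.simps wsem.simps mix_def by (subst ennreal_infsum_nat) simp
  next
    case (Var y)
    then show ?thesis using prems(3,5) by (auto simp: spy_env_ext_def)
  next
    case (Coin q)
    show ?thesis
      unfolding Coin Spy.simps sem.simps wsem.simps mix_def
      by (subst ennreal_infsum_nat, subst ennreal_infsum_nat) simp
  next
    case (LetIn y M1 M2)
    have M: "typed \<Gamma> M1 Nat" "typed (\<Gamma>(y \<mapsto> Nat)) M2 \<sigma>"
      using prems(1) unfolding LetIn by (blast elim: typed_elims(6))+
    have y: "y \<notin> x ` L" using prems(3) LetIn by auto
    have 1: "sem \<Gamma>' (Spy x \<Gamma> M1) \<rho>' = wsem r M1 \<rho>"
      using prems LetIn M by (intro IH[OF _ _ _ _ prems(4-6)]) auto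
    have "sem \<Gamma>' (subst y (Lit n) (Spy x (\<Gamma>(y \<mapsto> Nat)) M2)) \<rho>' = wsem r M2 (\<rho>(y := dirac n))" for n
    proof -
      have M2: "labels M2 \<subseteq> L" "x ` L \<inter> vars M2 = {}" using prems(2,3) LetIn by auto
      have "sem \<Gamma>' (Spy x \<Gamma> (subst y (Lit n) M2)) \<rho>' = wsem r (subst y (Lit n) M2) \<rho>"
      proof (rule IH[OF _ _ _ _ prems(4-6)])
        show "tm_size (subst y (Lit n) M2) < tm_size M" by (simp add: LetIn tm_size_subst_Lit)
        show "typed \<Gamma> (subst y (Lit n) M2) \<sigma>" by (rule typed_subst[OF _ M(2)]) (rule typed.intros)
        show "labels (subst y (Lit n) M2) \<subseteq> L" using M2 by (simp add: labels_subst_Lit)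
        show "x ` L \<inter> vars (subst y (Lit n) M2) = {}" using M2(2) vars_subst_Lit[of y n M2] by blast
      qed
      also have "\<dots> = wsem r M2 (\<rho>(y := dirac n))"
        by (subst wsem_subst[OF typed.intros(1)]) simp
      finally show ?thesis unfolding Spy_subst[OF M(2) M2(1) y] .
    qed
    then show ?thesis by (simp add: LetIn 1 mix_def)
  next
    case (IfZ M1 M2 M3)
    have M: "typed \<Gamma> M1 Nat" "typed \<Gamma> M2 \<sigma>" "typed \<Gamma> M3 \<sigma>"
      using prems(1) unfolding IfZ by (blast elim: typed_elims(7))+
    have "sem \<Gamma>' (Spy x \<Gamma> M1) \<rho>' = wsem r M1 \<rho>"
      by (rule IH[OF _ M(1) _ _ prems(4-6)]) (use prems(2,3) IfZ in auto)
    moreover have "sem \<Gamma>' (Spy x \<Gamma> M2) \<rho>' = wsem r M2 \<rho>"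
      by (rule IH[OF _ M(2) _ _ prems(4-6)]) (use prems(2,3) IfZ in auto)
    moreover have "sem \<Gamma>' (Spy x \<Gamma> M3) \<rho>' = wsem r M3 \<rho>"
      by (rule IH[OF _ M(3) _ _ prems(4-6)]) (use prems(2,3) IfZ in auto)
    ultimately show ?thesis
      unfolding IfZ Spy.simps sem.simps wsem.simps mix_def
      by (subst ennreal_infsum_nat) (simp add: ennreal_infsum_cmult_left)
  next
    case (App M1 M2)
    obtain \<tau> where M: "typed \<Gamma> M1 (Fun \<tau> \<sigma>)" "typed \<Gamma> M2 \<tau>"
      using prems(1) unfolding App by (blast elim: typed_elims(8))
    have "sem \<Gamma>' (Spy x \<Gamma> M1) \<rho>' = wsem r M1 \<rho>"
      by (rule IH[OF _ M(1) _ _ prems(4-6)]) (use prems(2,3) App in auto)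
    moreover have "sem \<Gamma>' (Spy x \<Gamma> M2) \<rho>' = wsem r M2 \<rho>"
      by (rule IH[OF _ M(2) _ _ prems(4-6)]) (use prems(2,3) App in auto)
    ultimately show ?thesis by (simp add: App)
  next
    case (Lam y \<tau> M1)
    obtain \<tau>' where \<sigma>: "\<sigma> = Fun \<tau> \<tau>'" and M: "typed (\<Gamma>(y \<mapsto> \<tau>)) M1 \<tau>'"
      using prems(1) unfolding Lam by (blast elim: typed_elims(9))
    have y: "y \<notin> x ` L" and M1: "labels M1 \<subseteq> L" "x ` L \<inter> vars M1 = {}"
      using prems(2,3) Lam by auto
    let ?S = "Spy x (\<Gamma>(y \<mapsto> \<tau>)) M1"
    have ty: "type_of (\<Gamma>'(y \<mapsto> \<tau>)) ?S = \<tau>'"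
      by (rule type_of_eq[OF typed_Spy[OF M M1 spy_ctx_ext_upd[OF prems(4) y]]])
    have eq: "sem (\<Gamma>'(y \<mapsto> \<tau>)) ?S (\<rho>'(y := u)) = wsem r M1 (\<rho>(y := u))" if "u \<in> elems (den \<tau>)" for u
      by (rule IH[OF _ M M1 spy_ctx_ext_upd[OF prems(4) y] spy_env_ext_upd[OF prems(5) y]
            env_ok_upd[OF prems(6) that]]) (simp add: Lam)
    have t: "wsem r M \<rho> \<in> elems (den (Fun \<tau> \<tau>'))"
      using wsem_elems[OF prems(1) r prems(6)] by (simp add: \<sigma>)
    have beta: "fun_of (wsem r M \<rho>) u = wsem r M1 (\<rho>(y := u))" if "u \<in> elems (den \<tau>)" for u
      using wsem_beta[OF M r prems(6) that] by (simp add: Lam)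
    have "sem \<Gamma>' (Spy x \<Gamma> M) \<rho>' = (THE t. t \<in> elems (den (Fun \<tau> \<tau>')) \<and>
        (\<forall>u\<in>elems (den \<tau>). fun_of t u = sem (\<Gamma>'(y \<mapsto> \<tau>)) ?S (\<rho>'(y := u))))"
      unfolding Lam Spy.simps sem.simps ty ..
    also have "\<dots> = wsem r M \<rho>"
    proof (rule the_equality)
      fix t' assume "t' \<in> elems (den (Fun \<tau> \<tau>')) \<and>
        (\<forall>u\<in>elems (den \<tau>). fun_of t' u = sem (\<Gamma>'(y \<mapsto> \<tau>)) ?S (\<rho>'(y := u)))"
      then show "t' = wsem r M \<rho>"
        using eq beta by (intro fun_of_inject[OF _ t]) auto
    qed (use t eq beta in auto)
    finally show ?thesis .
  next
    case (Fix M1)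
    have "typed \<Gamma> M1 (Fun \<sigma> \<sigma>)" using prems(1) unfolding Fix by (blast elim: typed_elims(10))
    then have "sem \<Gamma>' (Spy x \<Gamma> M1) \<rho>' = wsem r M1 \<rho>"
      using prems(2,3) Fix by (intro IH[OF _ _ _ _ prems(4-6)]) auto
    then show ?thesis by (simp add: Fix)
  next
    case (Lab l M1)
    have "typed \<Gamma> M1 \<sigma>" using prems(1) unfolding Lab by (blast elim: typed_elims(11))
    then have M1: "sem \<Gamma>' (Spy x \<Gamma> M1) \<rho>' = wsem r M1 \<rho>"
      using prems(2,3) Lab by (intro IH[OF _ _ _ _ prems(4-6)]) auto
    \<comment> \<open>The test finds mass \<open>r l\<close> at 0 and no mass at any successor, so
      the branch with \<open>Omega\<close> is multiplied by 0.\<close>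
    have "\<rho>' (x l) = (\<lambda>a. r l * dirac 0 a)"
      using prems(2,5) Lab by (auto simp: spy_env_ext_def)
    then show ?thesis
      unfolding Lab Spy.simps sem.simps wsem.simps mix_def M1
      by (subst ennreal_infsum_nat) (simp add: dirac_def)
  qed (simp add: less)
qed

section \<open>Runs of the machine\<close>

datatype 'l outcome = Halt | Stuck | Step "'l state" | Emit 'l "'l state" | Flip rat "'l state" "'l state"

definition transition :: "'l state \<Rightarrow> 'l outcome" where
  "transition s = (let \<pi> = snd s in case fst s of
      Lit n \<Rightarrow> (case \<pi> of
          [] \<Rightarrow> if n = 0 then Halt else Stuck
        | FArg N # \<pi> \<Rightarrow> Stuck
        | FSucc # \<pi> \<Rightarrow> Step (Lit (n + 1), \<pi>)
        | FPred # \<pi> \<Rightarrow> Step (Lit (n - 1), \<pi>)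
        | FIf N P # \<pi> \<Rightarrow> Step (if n = 0 then N else P, \<pi>)
        | FLet x N # \<pi> \<Rightarrow> Step (subst x (Lit n) N, \<pi>))
    | Succ M \<Rightarrow> Step (M, FSucc # \<pi>)
    | Pred M \<Rightarrow> Step (M, FPred # \<pi>)
    | Var x \<Rightarrow> Stuck
    | Coin q \<Rightarrow> Flip q (Lit 0, \<pi>) (Lit 1, \<pi>)
    | LetIn x M N \<Rightarrow> Step (M, FLet x N # \<pi>)
    | IfZ M N P \<Rightarrow> Step (M, FIf N P # \<pi>)
    | App M N \<Rightarrow> Step (M, FArg N # \<pi>)
    | Lam x \<sigma> M \<Rightarrow> (case \<pi> of FArg N # \<pi> \<Rightarrow> Step (subst x N M, \<pi>) | _ \<Rightarrow> Stuck)
    | Fix M \<Rightarrow> Step (M, FArg (Fix M) # \<pi>)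
    | Lab l M \<Rightarrow> Emit l (M, \<pi>))"

lemma transition_simps [simp]:
  "transition (Lit n, []) = (if n = 0 then Halt else Stuck)"
  "transition (Lit n, FArg N # \<pi>) = Stuck"
  "transition (Lit n, FSucc # \<pi>) = Step (Lit (n + 1), \<pi>)"
  "transition (Lit n, FPred # \<pi>) = Step (Lit (n - 1), \<pi>)"
  "transition (Lit n, FIf N P # \<pi>) = Step (if n = 0 then N else P, \<pi>)"
  "transition (Lit n, FLet x N # \<pi>) = Step (subst x (Lit n) N, \<pi>)"
  "transition (Succ M, \<pi>) = Step (M, FSucc # \<pi>)"
  "transition (Pred M, \<pi>) = Step (M, FPred # \<pi>)"
  "transition (Coin q, \<pi>) = Flip q (Lit 0, \<pi>) (Lit 1, \<pi>)"
  "transition (LetIn x M N, \<pi>) = Step (M, FLet x N # \<pi>)"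
  "transition (IfZ M N P, \<pi>) = Step (M, FIf N P # \<pi>)"
  "transition (App M N, \<pi>) = Step (M, FArg N # \<pi>)"
  "transition (Lam x \<sigma> M, FArg N # \<pi>) = Step (subst x N M, \<pi>)"
  "transition (Fix M, \<pi>) = Step (M, FArg (Fix M) # \<pi>)"
  "transition (Lab l M, \<pi>) = Emit l (M, \<pi>)"
  by (simp_all add: transition_def)

text \<open>Carries probability and labels together, so that one induction compares the weight of a
  bit string with both \<open>Eval\<close> of the stripped state and \<open>Eval_lab\<close>.
  Emitting a label uses no bit and no probability.\<close>

inductive run :: "'l state \<Rightarrow> bool list \<Rightarrow> real \<Rightarrow> 'l multiset \<Rightarrow> bool" where
  halt: "transition s = Halt \<Longrightarrow> run s [] 1 {#}"
| step: "transition s = Step s' \<Longrightarrow> run s' \<beta> p m \<Longrightarrow> run s \<beta> p m"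
| emit: "transition s = Emit l s' \<Longrightarrow> run s' \<beta> p m \<Longrightarrow> run s \<beta> p (m + {#l#})"
| heads: "transition s = Flip q s0 s1 \<Longrightarrow> run s0 \<beta> p m \<Longrightarrow> run s (False # \<beta>) (p * of_rat q) m"
| tails: "transition s = Flip q s0 s1 \<Longrightarrow> run s1 \<beta> p m \<Longrightarrow> run s (True # \<beta>) (p * (1 - of_rat q)) m"

section \<open>Runs compared with the two evaluation relations\<close>

lemma strip_subst: "strip (subst x N M) = subst x (strip N) (strip M)"
  by (induction M) auto

lemma transition_cases:
  obtains (Halt) "s = (Lit 0, [])" "transition s = Halt"
  | (Stuck) "transition s = Stuck"
  | (Succ_Lit) n \<pi> where "s = (Lit n, FSucc # \<pi>)" "transition s = Step (Lit (n + 1), \<pi>)"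
  | (Pred_Lit) n \<pi> where "s = (Lit n, FPred # \<pi>)" "transition s = Step (Lit (n - 1), \<pi>)"
  | (If_Lit) n N P \<pi> where "s = (Lit n, FIf N P # \<pi>)" "transition s = Step (if n = 0 then N else P, \<pi>)"
  | (Let_Lit) n x N \<pi> where "s = (Lit n, FLet x N # \<pi>)" "transition s = Step (subst x (Lit n) N, \<pi>)"
  | (Beta) x \<sigma> M N \<pi> where "s = (Lam x \<sigma> M, FArg N # \<pi>)" "transition s = Step (subst x N M, \<pi>)"
  | (Succ) M \<pi> where "s = (Succ M, \<pi>)" "transition s = Step (M, FSucc # \<pi>)"
  | (Pred) M \<pi> where "s = (Pred M, \<pi>)" "transition s = Step (M, FPred # \<pi>)"
  | (LetIn) x M N \<pi> where "s = (LetIn x M N, \<pi>)" "transition s = Step (M, FLet x N # \<pi>)"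
  | (IfZ) M N P \<pi> where "s = (IfZ M N P, \<pi>)" "transition s = Step (M, FIf N P # \<pi>)"
  | (App) M N \<pi> where "s = (App M N, \<pi>)" "transition s = Step (M, FArg N # \<pi>)"
  | (Fix) M \<pi> where "s = (Fix M, \<pi>)" "transition s = Step (M, FArg (Fix M) # \<pi>)"
  | (Lab) l M \<pi> where "s = (Lab l M, \<pi>)" "transition s = Emit l (M, \<pi>)"
  | (Coin) q \<pi> where "s = (Coin q, \<pi>)" "transition s = Flip q (Lit 0, \<pi>) (Lit 1, \<pi>)"
proof -
  obtain M \<pi> where s: "s = (M, \<pi>)" by (cases s)
  show thesis
  proof (cases M)
    case (Lit n)
    show thesis
    proof (cases \<pi>)
      case Nil
      then show thesis using s Lit that(1,2) by (cases "n = 0") auto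
    next
      case (Cons f \<pi>')
      then show thesis using s Lit that(2-6) by (cases f) auto
    qed
  next
    case (Lam x \<sigma> N)
    show thesis
    proof (cases "\<exists>P \<pi>'. \<pi> = FArg P # \<pi>'")
      case True
      then show thesis using s Lam that(7) by auto
    next
      case False
      then have "transition s = Stuck"
        by (auto simp: s Lam transition_def split: list.split frame.split)
      then show thesis by (rule that(2))
    qed
  next
    case (Var x)
    then have "transition s = Stuck" by (simp add: s transition_def)
    then show thesis by (rule that(2))
  qed (use s that(8-15) in auto)
qed

lemma run_ev_lab: "run s \<beta> p m \<Longrightarrow> ev_lab s \<beta> m"
proof (induction rule: run.induct)
  case (halt s)
  then show ?case by (cases s rule: transition_cases) (auto intro: ev_lab.intros)
next
  case (step s s' \<beta> p m)
  from step(1,3) show ?case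
  proof (cases s rule: transition_cases)
    case (Pred_Lit n \<pi>)
    then show ?thesis using step(1,3) by (cases n) (auto intro: ev_lab.intros ev_lab.intros(15)[simplified])
  next
    case (If_Lit n N P \<pi>)
    then show ?thesis using step(1,3) by (cases n) (auto intro: ev_lab.intros ev_lab.intros(7)[simplified])
  qed (auto intro: ev_lab.intros ev_lab.intros(12)[simplified])
next
  case (emit s l s' \<beta> p m)
  then show ?case by (cases s rule: transition_cases) (auto intro: ev_lab.intros(17)[simplified])
next
  case (heads s q s0 s1 \<beta> p m)
  then show ?case by (cases s rule: transition_cases) (auto intro: ev_lab.intros)
next
  case (tails s q s0 s1 \<beta> p m)
  then show ?case by (cases s rule: transition_cases) (auto intro: ev_lab.intros(10)[simplified])
qed

lemma run_ev: "run s \<beta> p m \<Longrightarrow> ev (strip_state s) \<beta> p"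
proof (induction rule: run.induct)
  case (halt s)
  then show ?case by (cases s rule: transition_cases) (auto simp: strip_state_def intro: ev.intros)
next
  case (step s s' \<beta> p m)
  from step(1,3) show ?case
  proof (cases s rule: transition_cases)
    case (Pred_Lit n \<pi>)
    then show ?thesis using step(1,3)
      by (cases n) (auto simp: strip_state_def intro: ev.intros ev.intros(15)[simplified])
  next
    case (If_Lit n N P \<pi>)
    then show ?thesis using step(1,3)
      by (cases n) (auto simp: strip_state_def intro: ev.intros ev.intros(7)[simplified])
  qed (auto simp: strip_state_def strip_subst intro: ev.intros ev.intros(12)[simplified])
next
  case (emit s l s' \<beta> p m)
  then show ?case by (cases s rule: transition_cases) (auto simp: strip_state_def)
next
  case (heads s q s0 s1 \<beta> p m)
  then show ?case by (cases s rule: transition_cases) (auto simp: strip_state_def intro: ev.intros)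
next
  case (tails s q s0 s1 \<beta> p m)
  then show ?case
    by (cases s rule: transition_cases) (auto simp: strip_state_def intro: ev.intros(10)[simplified])
qed

text \<open>An unlabeled state is the stripped form of states with any number of labels at the head
  of the term. The machine emits these first, leaving bits and probability alone, so only unlabeled
  heads have to be considered.\<close>

lemma run_unlabel:
  assumes "(T, \<pi>) = strip_state s"
    and "\<And>M \<pi>'. (\<And>l N. M \<noteq> Lab l N) \<Longrightarrow> strip M = T \<Longrightarrow> map strip_frame \<pi>' = \<pi> \<Longrightarrow>
      \<exists>m. run (M, \<pi>') \<beta> p m"
  shows "\<exists>m. run s \<beta> p m"
proof -
  obtain M \<pi>' where s: "s = (M, \<pi>')" by (cases s)
  then have "strip M = T" "map strip_frame \<pi>' = \<pi>" using assms(1) by (auto simp: strip_state_def)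
  then have "\<exists>m. run (M, \<pi>') \<beta> p m"
  proof (induction M)
    case (Lab l M)
    then obtain m where "run (M, \<pi>') \<beta> p m" by auto
    then have "run (Lab l M, \<pi>') \<beta> p (m + {#l#})" by (intro run.emit) simp_all
    then show ?case ..
  qed (rule assms(2); (assumption | simp only: tm.distinct not_False_eq_True))+
  then show ?thesis by (simp add: s)
qed

lemma ex_run_step: "transition s = Step s' \<Longrightarrow> \<exists>m. run s' \<beta> p m \<Longrightarrow> \<exists>m. run s \<beta> p m"
  by (blast intro: run.step)

lemma ex_run_flip:
  "transition s = Flip q s0 s1 \<Longrightarrow> \<exists>m. run s0 \<beta> p m \<Longrightarrow> \<exists>m. run s (False # \<beta>) (p * of_rat q) m"
  "transition s = Flip q s0 s1 \<Longrightarrow> \<exists>m. run s1 \<beta> p m \<Longrightarrow> \<exists>m. run s (True # \<beta>) (p * (1 - of_rat q)) m"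
  by (blast intro: run.heads run.tails)+

lemma strip_frame_eqs:
  "strip_frame f = FSucc \<longleftrightarrow> f = FSucc"
  "strip_frame f = FPred \<longleftrightarrow> f = FPred"
  "strip_frame f = FArg N \<longleftrightarrow> (\<exists>N'. f = FArg N' \<and> N = strip N')"
  "strip_frame f = FIf N P \<longleftrightarrow> (\<exists>N' P'. f = FIf N' P' \<and> N = strip N' \<and> P = strip P')"
  "strip_frame f = FLet x N \<longleftrightarrow> (\<exists>N'. f = FLet x N' \<and> N = strip N')"
  by (cases f; auto)+

lemma ev_run: "ev s \<beta> p \<Longrightarrow> s = strip_state s' \<Longrightarrow> \<exists>m. run s' \<beta> p m"
proof (induction arbitrary: s' rule: ev.induct)
  case (1 M x N \<pi> \<alpha> p)
  show ?case
  proof (rule run_unlabel[OF 1(3)])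
    fix M0 :: "'a tm" and \<pi>' :: "'a frame list"
    assume nl: "\<And>l N. M0 \<noteq> Lab l N" and M0: "strip M0 = LetIn x M N" and \<pi>: "map strip_frame \<pi>' = \<pi>"
    obtain M1 N1 where M1: "M0 = LetIn x M1 N1" "strip M1 = M" "strip N1 = N"
      using nl M0 by (cases M0) auto
    have "\<exists>m. run (M1, FLet x N1 # \<pi>') \<alpha> p m"
      by (rule 1(2)) (use M1 \<pi> in \<open>auto simp: strip_state_def strip_subst\<close>)
    then show "\<exists>m. run (M0, \<pi>') \<alpha> p m"
      by (rule ex_run_step[rotated]) (simp add: M1)
  qed
next
  case (2 x n N \<pi> \<alpha> p)
  show ?case
  proof (rule run_unlabel[OF 2(3)])
    fix M0 :: "'a tm" and \<pi>' :: "'a frame list"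
    assume nl: "\<And>l N. M0 \<noteq> Lab l N" and M0: "strip M0 = Lit n" and \<pi>: "map strip_frame \<pi>' = FLet x N # \<pi>"
    have M1: "M0 = Lit n" using nl M0 by (cases M0) auto
    obtain N1 \<pi>1 where \<pi>1: "\<pi>' = FLet x N1 # \<pi>1" "strip N1 = N" "map strip_frame \<pi>1 = \<pi>"
      using \<pi> by (auto simp: map_eq_Cons_conv strip_frame_eqs)
    have "\<exists>m. run (subst x (Lit n) N1, \<pi>1) \<alpha> p m"
      by (rule 2(2)) (use M1 \<pi>1 in \<open>auto simp: strip_state_def strip_subst\<close>)
    then show "\<exists>m. run (M0, \<pi>') \<alpha> p m"
      by (rule ex_run_step[rotated]) (simp add: M1 \<pi>1)
  qed
next
  case (3 M N \<pi> \<alpha> p)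
  show ?case
  proof (rule run_unlabel[OF 3(3)])
    fix M0 :: "'a tm" and \<pi>' :: "'a frame list"
    assume nl: "\<And>l N. M0 \<noteq> Lab l N" and M0: "strip M0 = App M N" and \<pi>: "map strip_frame \<pi>' = \<pi>"
    obtain M1 N1 where M1: "M0 = App M1 N1" "strip M1 = M" "strip N1 = N"
      using nl M0 by (cases M0) auto
    have "\<exists>m. run (M1, FArg N1 # \<pi>') \<alpha> p m"
      by (rule 3(2)) (use M1 \<pi> in \<open>auto simp: strip_state_def strip_subst\<close>)
    then show "\<exists>m. run (M0, \<pi>') \<alpha> p m"
      by (rule ex_run_step[rotated]) (simp add: M1)
  qed
next
  case (4 x N M \<pi> \<alpha> p \<sigma>)
  show ?case
  proof (rule run_unlabel[OF 4(3)])
    fix M0 :: "'a tm" and \<pi>' :: "'a frame list"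
    assume nl: "\<And>l N. M0 \<noteq> Lab l N" and M0: "strip M0 = Lam x \<sigma> M" and \<pi>: "map strip_frame \<pi>' = FArg N # \<pi>"
    obtain M1 where M1: "M0 = Lam x \<sigma> M1" "strip M1 = M"
      using nl M0 by (cases M0) auto
    obtain N1 \<pi>1 where \<pi>1: "\<pi>' = FArg N1 # \<pi>1" "strip N1 = N" "map strip_frame \<pi>1 = \<pi>"
      using \<pi> by (auto simp: map_eq_Cons_conv strip_frame_eqs)
    have "\<exists>m. run (subst x N1 M1, \<pi>1) \<alpha> p m"
      by (rule 4(2)) (use M1 \<pi>1 in \<open>auto simp: strip_state_def strip_subst\<close>)
    then show "\<exists>m. run (M0, \<pi>') \<alpha> p m"
      by (rule ex_run_step[rotated]) (simp add: M1 \<pi>1)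
  qed
next
  case (5 M N P \<pi> \<alpha> p)
  show ?case
  proof (rule run_unlabel[OF 5(3)])
    fix M0 :: "'a tm" and \<pi>' :: "'a frame list"
    assume nl: "\<And>l N. M0 \<noteq> Lab l N" and M0: "strip M0 = IfZ M N P" and \<pi>: "map strip_frame \<pi>' = \<pi>"
    obtain M1 N1 P1 where M1: "M0 = IfZ M1 N1 P1" "strip M1 = M" "strip N1 = N" "strip P1 = P"
      using nl M0 by (cases M0) auto
    have "\<exists>m. run (M1, FIf N1 P1 # \<pi>') \<alpha> p m"
      by (rule 5(2)) (use M1 \<pi> in \<open>auto simp: strip_state_def strip_subst\<close>)
    then show "\<exists>m. run (M0, \<pi>') \<alpha> p m"
      by (rule ex_run_step[rotated]) (simp add: M1)
  qed
next
  case (6 N \<pi> \<alpha> p P)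
  show ?case
  proof (rule run_unlabel[OF 6(3)])
    fix M0 :: "'a tm" and \<pi>' :: "'a frame list"
    assume nl: "\<And>l N. M0 \<noteq> Lab l N" and M0: "strip M0 = Lit 0" and \<pi>: "map strip_frame \<pi>' = FIf N P # \<pi>"
    have M1: "M0 = Lit 0" using nl M0 by (cases M0) auto
    obtain N1 P1 \<pi>1 where \<pi>1: "\<pi>' = FIf N1 P1 # \<pi>1" "strip N1 = N" "map strip_frame \<pi>1 = \<pi>"
      using \<pi> by (auto simp: map_eq_Cons_conv strip_frame_eqs)
    have "\<exists>m. run (N1, \<pi>1) \<alpha> p m"
      by (rule 6(2)) (use M1 \<pi>1 in \<open>auto simp: strip_state_def strip_subst\<close>)
    then show "\<exists>m. run (M0, \<pi>') \<alpha> p m"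
      by (rule ex_run_step[rotated]) (simp add: M1 \<pi>1)
  qed
next
  case (7 P \<pi> \<alpha> p n N)
  show ?case
  proof (rule run_unlabel[OF 7(3)])
    fix M0 :: "'a tm" and \<pi>' :: "'a frame list"
    assume nl: "\<And>l N. M0 \<noteq> Lab l N" and M0: "strip M0 = Lit (n + 1)" and \<pi>: "map strip_frame \<pi>' = FIf N P # \<pi>"
    have M1: "M0 = Lit (n + 1)" using nl M0 by (cases M0) auto
    obtain N1 P1 \<pi>1 where \<pi>1: "\<pi>' = FIf N1 P1 # \<pi>1" "strip P1 = P" "map strip_frame \<pi>1 = \<pi>"
      using \<pi> by (auto simp: map_eq_Cons_conv strip_frame_eqs)
    have "\<exists>m. run (P1, \<pi>1) \<alpha> p m"
      by (rule 7(2)) (use M1 \<pi>1 in \<open>auto simp: strip_state_def strip_subst\<close>)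
    then show "\<exists>m. run (M0, \<pi>') \<alpha> p m"
      by (rule ex_run_step[rotated]) (simp add: M1 \<pi>1)
  qed
next
  case (8 M \<pi> \<alpha> p)
  show ?case
  proof (rule run_unlabel[OF 8(3)])
    fix M0 :: "'a tm" and \<pi>' :: "'a frame list"
    assume nl: "\<And>l N. M0 \<noteq> Lab l N" and M0: "strip M0 = Fix M" and \<pi>: "map strip_frame \<pi>' = \<pi>"
    obtain M1 where M1: "M0 = Fix M1" "strip M1 = M"
      using nl M0 by (cases M0) auto
    have "\<exists>m. run (M1, FArg (Fix M1) # \<pi>') \<alpha> p m"
      by (rule 8(2)) (use M1 \<pi> in \<open>auto simp: strip_state_def strip_subst\<close>)
    then show "\<exists>m. run (M0, \<pi>') \<alpha> p m"
      by (rule ex_run_step[rotated]) (simp add: M1)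
  qed
next
  case (9 \<pi> \<alpha> p q)
  show ?case
  proof (rule run_unlabel[OF 9(3)])
    fix M0 :: "'a tm" and \<pi>' :: "'a frame list"
    assume nl: "\<And>l N. M0 \<noteq> Lab l N" and M0: "strip M0 = Coin q" and \<pi>: "map strip_frame \<pi>' = \<pi>"
    have M1: "M0 = Coin q" using nl M0 by (cases M0) auto
    have "\<exists>m. run (Lit 0, \<pi>') \<alpha> p m"
      by (rule 9(2)) (use \<pi> in \<open>simp add: strip_state_def\<close>)
    then show "\<exists>m. run (M0, \<pi>') (False # \<alpha>) (p * of_rat q) m"
      by (rule ex_run_flip(1)[rotated]) (simp add: M1)
  qed
next
  case (10 \<pi> \<alpha> p q)
  show ?case
  proof (rule run_unlabel[OF 10(3)])
    fix M0 :: "'a tm" and \<pi>' :: "'a frame list"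
    assume nl: "\<And>l N. M0 \<noteq> Lab l N" and M0: "strip M0 = Coin q" and \<pi>: "map strip_frame \<pi>' = \<pi>"
    have M1: "M0 = Coin q" using nl M0 by (cases M0) auto
    have "\<exists>m. run (Lit 1, \<pi>') \<alpha> p m"
      by (rule 10(2)) (use \<pi> in \<open>simp add: strip_state_def\<close>)
    then show "\<exists>m. run (M0, \<pi>') (True # \<alpha>) (p * (1 - of_rat q)) m"
      by (rule ex_run_flip(2)[rotated]) (simp add: M1)
  qed
next
  case (11 M \<pi> \<alpha> p)
  show ?case
  proof (rule run_unlabel[OF 11(3)])
    fix M0 :: "'a tm" and \<pi>' :: "'a frame list"
    assume nl: "\<And>l N. M0 \<noteq> Lab l N" and M0: "strip M0 = Succ M" and \<pi>: "map strip_frame \<pi>' = \<pi>"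
    obtain M1 where M1: "M0 = Succ M1" "strip M1 = M"
      using nl M0 by (cases M0) auto
    have "\<exists>m. run (M1, FSucc # \<pi>') \<alpha> p m"
      by (rule 11(2)) (use M1 \<pi> in \<open>auto simp: strip_state_def strip_subst\<close>)
    then show "\<exists>m. run (M0, \<pi>') \<alpha> p m"
      by (rule ex_run_step[rotated]) (simp add: M1)
  qed
next
  case (12 n \<pi> \<alpha> p)
  show ?case
  proof (rule run_unlabel[OF 12(3)])
    fix M0 :: "'a tm" and \<pi>' :: "'a frame list"
    assume nl: "\<And>l N. M0 \<noteq> Lab l N" and M0: "strip M0 = Lit n" and \<pi>: "map strip_frame \<pi>' = FSucc # \<pi>"
    have M1: "M0 = Lit n" using nl M0 by (cases M0) auto
    obtain \<pi>1 where \<pi>1: "\<pi>' = FSucc # \<pi>1" "map strip_frame \<pi>1 = \<pi>"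
      using \<pi> by (auto simp: map_eq_Cons_conv strip_frame_eqs)
    have "\<exists>m. run (Lit (n + 1), \<pi>1) \<alpha> p m"
      by (rule 12(2)) (use M1 \<pi>1 in \<open>auto simp: strip_state_def strip_subst\<close>)
    then show "\<exists>m. run (M0, \<pi>') \<alpha> p m"
      by (rule ex_run_step[rotated]) (simp add: M1 \<pi>1)
  qed
next
  case (13 M \<pi> \<alpha> p)
  show ?case
  proof (rule run_unlabel[OF 13(3)])
    fix M0 :: "'a tm" and \<pi>' :: "'a frame list"
    assume nl: "\<And>l N. M0 \<noteq> Lab l N" and M0: "strip M0 = Pred M" and \<pi>: "map strip_frame \<pi>' = \<pi>"
    obtain M1 where M1: "M0 = Pred M1" "strip M1 = M"
      using nl M0 by (cases M0) auto
    have "\<exists>m. run (M1, FPred # \<pi>') \<alpha> p m"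
      by (rule 13(2)) (use M1 \<pi> in \<open>auto simp: strip_state_def strip_subst\<close>)
    then show "\<exists>m. run (M0, \<pi>') \<alpha> p m"
      by (rule ex_run_step[rotated]) (simp add: M1)
  qed
next
  case (14 \<pi> \<alpha> p)
  show ?case
  proof (rule run_unlabel[OF 14(3)])
    fix M0 :: "'a tm" and \<pi>' :: "'a frame list"
    assume nl: "\<And>l N. M0 \<noteq> Lab l N" and M0: "strip M0 = Lit 0" and \<pi>: "map strip_frame \<pi>' = FPred # \<pi>"
    have M1: "M0 = Lit 0" using nl M0 by (cases M0) auto
    obtain \<pi>1 where \<pi>1: "\<pi>' = FPred # \<pi>1" "map strip_frame \<pi>1 = \<pi>"
      using \<pi> by (auto simp: map_eq_Cons_conv strip_frame_eqs)
    have "\<exists>m. run (Lit 0, \<pi>1) \<alpha> p m"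
      by (rule 14(2)) (use M1 \<pi>1 in \<open>auto simp: strip_state_def strip_subst\<close>)
    then show "\<exists>m. run (M0, \<pi>') \<alpha> p m"
      by (rule ex_run_step[rotated]) (simp add: M1 \<pi>1)
  qed
next
  case (15 n \<pi> \<alpha> p)
  show ?case
  proof (rule run_unlabel[OF 15(3)])
    fix M0 :: "'a tm" and \<pi>' :: "'a frame list"
    assume nl: "\<And>l N. M0 \<noteq> Lab l N" and M0: "strip M0 = Lit (n + 1)" and \<pi>: "map strip_frame \<pi>' = FPred # \<pi>"
    have M1: "M0 = Lit (n + 1)" using nl M0 by (cases M0) auto
    obtain \<pi>1 where \<pi>1: "\<pi>' = FPred # \<pi>1" "map strip_frame \<pi>1 = \<pi>"
      using \<pi> by (auto simp: map_eq_Cons_conv strip_frame_eqs)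
    have "\<exists>m. run (Lit n, \<pi>1) \<alpha> p m"
      by (rule 15(2)) (use M1 \<pi>1 in \<open>auto simp: strip_state_def strip_subst\<close>)
    then show "\<exists>m. run (M0, \<pi>') \<alpha> p m"
      by (rule ex_run_step[rotated]) (simp add: M1 \<pi>1)
  qed
next
  case 16
  show ?case
  proof (rule run_unlabel[OF 16])
    fix M0 :: "'a tm" and \<pi>' :: "'a frame list"
    assume nl: "\<And>l N. M0 \<noteq> Lab l N" and M0: "strip M0 = Lit 0" and \<pi>: "map strip_frame \<pi>' = []"
    have "M0 = Lit 0" using nl M0 by (cases M0) auto
    then have "run (M0, \<pi>') [] 1 {#}" using \<pi> by (intro run.halt) simp
    then show "\<exists>m. run (M0, \<pi>') [] 1 m" ..
  qed
qed

section \<open>Well-typed states and their preservation\<close>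

inductive typed_stack :: "'l frame list \<Rightarrow> ty \<Rightarrow> bool" where
  "typed_stack [] Nat"
| "typed Map.empty N \<sigma> \<Longrightarrow> typed_stack \<pi> \<tau> \<Longrightarrow> typed_stack (FArg N # \<pi>) (Fun \<sigma> \<tau>)"
| "typed_stack \<pi> Nat \<Longrightarrow> typed_stack (FSucc # \<pi>) Nat"
| "typed_stack \<pi> Nat \<Longrightarrow> typed_stack (FPred # \<pi>) Nat"
| "typed Map.empty N \<sigma> \<Longrightarrow> typed Map.empty P \<sigma> \<Longrightarrow> typed_stack \<pi> \<sigma> \<Longrightarrow> typed_stack (FIf N P # \<pi>) Nat"
| "typed [x \<mapsto> Nat] N \<sigma> \<Longrightarrow> typed_stack \<pi> \<sigma> \<Longrightarrow> typed_stack (FLet x N # \<pi>) Nat"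

inductive_cases typed_stack_elims:
  "typed_stack (FArg N # \<pi>) \<sigma>" "typed_stack (FSucc # \<pi>) \<sigma>" "typed_stack (FPred # \<pi>) \<sigma>"
  "typed_stack (FIf N P # \<pi>) \<sigma>" "typed_stack (FLet x N # \<pi>) \<sigma>"

definition typed_state :: "'l state \<Rightarrow> bool" where
  "typed_state s \<longleftrightarrow> (\<exists>\<sigma>. typed Map.empty (fst s) \<sigma> \<and> typed_stack (snd s) \<sigma>)"

lemma typed_stateI: "typed Map.empty M \<sigma> \<Longrightarrow> typed_stack \<pi> \<sigma> \<Longrightarrow> typed_state (M, \<pi>)"
  by (auto simp: typed_state_def)

lemma typed_stateE:
  assumes "typed_state (M, \<pi>)"
  obtains \<sigma> where "typed Map.empty M \<sigma>" "typed_stack \<pi> \<sigma>"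
  using assms by (auto simp: typed_state_def)

lemma typed_state_transition:
  assumes "typed_state s"
  shows "transition s = Step s' \<Longrightarrow> typed_state s'"
    and "transition s = Emit l s' \<Longrightarrow> typed_state s'"
    and "transition s = Flip q s0 s1 \<Longrightarrow> typed_state s0 \<and> typed_state s1 \<and> 0 \<le> q \<and> q \<le> 1"
proof -
  show "typed_state s'" if t: "transition s = Step s'"
    using assms t
  proof (cases s rule: transition_cases)
    case (Let_Lit n x N \<pi>)
    then show ?thesis using assms t
      by (auto elim!: typed_stateE typed_stack_elims intro!: typed_stateI typed_subst[OF typed.intros(1)])
  next
    case (Beta x \<sigma> M N \<pi>)
    then show ?thesis using assms t
      by (auto elim!: typed_stateE typed_stack_elims typed_elims(9) intro!: typed_stateI intro: typed_subst)
  next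
    case (App M N \<pi>)
    then show ?thesis using assms t
      by (auto elim!: typed_stateE typed_elims(8) intro!: typed_stateI intro: typed_stack.intros)
  next
    case (Fix M \<pi>)
    then show ?thesis using assms t
      by (auto elim!: typed_stateE typed_elims(10) intro!: typed_stateI intro: typed_stack.intros typed.intros)
  qed (auto elim!: typed_stateE typed_elims typed_stack_elims intro!: typed_stateI
      intro: typed.intros typed_stack.intros)
  show "typed_state s'" if t: "transition s = Emit l s'"
    using assms t by (cases s rule: transition_cases) (auto elim!: typed_stateE typed_elims intro!: typed_stateI)
  show "typed_state s0 \<and> typed_state s1 \<and> 0 \<le> q \<and> q \<le> 1" if t: "transition s = Flip q s0 s1"
    using assms t
    by (cases s rule: transition_cases) (auto elim!: typed_stateE typed_elims(5) intro!: typed_stateI typed.intros)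
qed

section \<open>Adequacy\<close>

lemma infsum_bool_list:
  fixes f :: "bool list \<Rightarrow> ennreal"
  shows "(\<Sum>\<^sub>\<infinity>\<beta>. f \<beta>) = f [] + ((\<Sum>\<^sub>\<infinity>\<beta>. f (False # \<beta>)) + (\<Sum>\<^sub>\<infinity>\<beta>. f (True # \<beta>)))"
proof -
  let ?g = "\<lambda>b \<beta>. case \<beta> of [] \<Rightarrow> 0 | c # \<gamma> \<Rightarrow> if c = b then f \<beta> else 0"
  have g: "(\<Sum>\<^sub>\<infinity>\<beta>. ?g b \<beta>) = (\<Sum>\<^sub>\<infinity>\<beta>. f (b # \<beta>))" for b
    by (subst ennreal_infsum_reindex[where h = "Cons b"]) (auto split: list.splits)
  have "(\<Sum>\<^sub>\<infinity>\<beta>. f \<beta>) = (\<Sum>\<^sub>\<infinity>\<beta>. (if \<beta> = [] then f \<beta> else 0) + (?g False \<beta> + ?g True \<beta>))"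
    by (rule infsum_cong) (auto split: list.split)
  also have "\<dots> = (\<Sum>\<^sub>\<infinity>\<beta>. if \<beta> = [] then f \<beta> else 0) + ((\<Sum>\<^sub>\<infinity>\<beta>. ?g False \<beta>) + (\<Sum>\<^sub>\<infinity>\<beta>. ?g True \<beta>))"
    by (simp only: ennreal_infsum_add)
  also have "(\<Sum>\<^sub>\<infinity>\<beta>. if \<beta> = [] then f \<beta> else 0) = f []"
    by (subst ennreal_infsum_single[where a = "[]"]) auto
  finally show ?thesis by (simp only: g)
qed

definition weight_step ::
    "('l \<Rightarrow> ennreal) \<Rightarrow> ('l state \<Rightarrow> bool list \<Rightarrow> ennreal) \<Rightarrow> 'l state \<Rightarrow> bool list \<Rightarrow> ennreal" where
  "weight_step r w s \<beta> = (case transition s of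
      Halt \<Rightarrow> if \<beta> = [] then 1 else 0
    | Stuck \<Rightarrow> 0
    | Step s' \<Rightarrow> w s' \<beta>
    | Emit l s' \<Rightarrow> r l * w s' \<beta>
    | Flip q s0 s1 \<Rightarrow> (case \<beta> of [] \<Rightarrow> 0 | b # \<beta>' \<Rightarrow>
        if b then ennreal (1 - of_rat q) * w s1 \<beta>' else ennreal (of_rat q) * w s0 \<beta>'))"

text \<open>\<open>weight r n s \<beta>\<close> and \<open>total r n s\<close> are cut off after \<open>n\<close> transitions.\<close>

primrec weight :: "('l \<Rightarrow> ennreal) \<Rightarrow> nat \<Rightarrow> 'l state \<Rightarrow> bool list \<Rightarrow> ennreal" where
  "weight r 0 = (\<lambda>s \<beta>. 0)"
| "weight r (Suc n) = weight_step r (weight r n)"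

primrec total :: "('l \<Rightarrow> ennreal) \<Rightarrow> nat \<Rightarrow> 'l state \<Rightarrow> ennreal" where
  "total r 0 = (\<lambda>s. 0)"
| "total r (Suc n) = (\<lambda>s. case transition s of
      Halt \<Rightarrow> 1
    | Stuck \<Rightarrow> 0
    | Step s' \<Rightarrow> total r n s'
    | Emit l s' \<Rightarrow> r l * total r n s'
    | Flip q s0 s1 \<Rightarrow> ennreal (of_rat q) * total r n s0 + ennreal (1 - of_rat q) * total r n s1)"

declare weight_step_def [simp]

lemma total_eq_weight: "total r n s = (\<Sum>\<^sub>\<infinity>\<beta>. weight r n s \<beta>)"
proof (induction n arbitrary: s)
  case (Suc n)
  show ?case
  proof (cases "transition s")
    case Halt
    then show ?thesis by (simp, subst ennreal_infsum_single[where a = "[]"]) auto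
  next
    case (Flip q s0 s1)
    then show ?thesis by (subst infsum_bool_list) (simp add: Suc ennreal_infsum_cmult_right)
  qed (simp_all add: Suc ennreal_infsum_cmult_right)
qed simp

lemma weight_step_mono:
  "(\<And>s \<beta>. w s \<beta> \<le> w' s \<beta>) \<Longrightarrow> weight_step r w s \<beta> \<le> weight_step r w' s \<beta>"
  by (auto simp: weight_step_def intro!: mult_left_mono split: outcome.split list.split)

lemma weight_mono: "weight r n s \<beta> \<le> weight r (Suc n) s \<beta>"
proof (induction n arbitrary: s \<beta>)
  case (Suc n)
  have "weight_step r (weight r n) s \<beta> \<le> weight_step r (weight r (Suc n)) s \<beta>"
    by (rule weight_step_mono) (rule Suc)
  then show ?case by (simp only: weight.simps)
qed simp

lemma weight_incseq: "incseq (\<lambda>n. weight r n s \<beta>)"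
  by (rule incseq_SucI) (rule weight_mono)

lemma total_incseq: "incseq (\<lambda>n. total r n s)"
  unfolding total_eq_weight by (rule incseq_SucI) (intro ennreal_infsum_mono weight_mono)

text \<open>The probability of halting at 0 if all labels weigh 1; in general a run with labels m
  counts with the additional factor r^m. It is defined for untyped states too, as the logical
  relation ranges over arbitrary stacks.\<close>

definition Pr :: "('l \<Rightarrow> ennreal) \<Rightarrow> 'l state \<Rightarrow> ennreal" where
  "Pr r s = (SUP n. total r n s)"

lemma Pr_unfold:
  "Pr r s = (case transition s of
      Halt \<Rightarrow> 1
    | Stuck \<Rightarrow> 0
    | Step s' \<Rightarrow> Pr r s'
    | Emit l s' \<Rightarrow> r l * Pr r s'
    | Flip q s0 s1 \<Rightarrow> ennreal (of_rat q) * Pr r s0 + ennreal (1 - of_rat q) * Pr r s1)"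
  (is "_ = ?rhs")
proof -
  \<comment> \<open>The cutoffs increase, so leaving out the cutoff 0 does not change the
    supremum.\<close>
  have "Pr r s = (SUP n. total r (Suc n) s)"
    unfolding Pr_def
    by (rule SUP_eq) (use total_incseq[of r s] in \<open>auto simp: incseq_Suc_iff simp del: total.simps\<close>)
  also have "\<dots> = ?rhs"
  proof (cases "transition s")
    case (Flip q s0 s1)
    have "incseq (\<lambda>n. c * total r n s)" for c s
      using total_incseq[of r s] by (auto simp: incseq_def intro: mult_left_mono)
    then show ?thesis
      using Flip by (simp add: Pr_def SUP_mult_left_ennreal ennreal_SUP_add)
  qed (simp_all add: Pr_def SUP_mult_left_ennreal)
  finally show ?thesis .
qed

lemma Pr_Step: "transition s = Step s' \<Longrightarrow> Pr r s = Pr r s'"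
  by (simp add: Pr_unfold[of r s])

lemma Pr_eq_weight: "Pr r s = (\<Sum>\<^sub>\<infinity>\<beta>. SUP n. weight r n s \<beta>)"
  by (simp add: Pr_def total_eq_weight ennreal_infsum_SUP[OF weight_incseq])

text \<open>\<open>0 \<le> p\<close> belongs to the induction since \<open>ennreal\<close> turns
  products into products only for nonnegative factors. It depends on the typing of the state, which
  confines the bias of every coin to [0, 1].\<close>

lemma run_weight_le:
  assumes "run s \<beta> p m" "typed_state s"
  shows "0 \<le> p \<and> (\<exists>n. ennreal p * prom r m \<le> weight r n s \<beta>)"
  using assms
proof (induction rule: run.induct)
  case (halt s)
  then show ?case by (auto intro!: exI[of _ "Suc 0"])
next
  case (step s s' \<beta> p m)
  have "typed_state s'" using typed_state_transition(1)[OF step.prems step.hyps(1)] .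
  from step.IH[OF this] obtain n where "0 \<le> p" "ennreal p * prom r m \<le> weight r n s' \<beta>" by blast
  then show ?case using step.hyps(1) by (auto intro!: exI[of _ "Suc n"])
next
  case (emit s l s' \<beta> p m)
  have "typed_state s'" using typed_state_transition(2)[OF emit.prems emit.hyps(1)] .
  from emit.IH[OF this] obtain n where n: "0 \<le> p" "ennreal p * prom r m \<le> weight r n s' \<beta>" by blast
  have "ennreal p * prom r (m + {#l#}) = r l * (ennreal p * prom r m)" by (simp add: ac_simps)
  also have "\<dots> \<le> weight r (Suc n) s \<beta>" using n(2) emit.hyps(1) by (simp add: mult_left_mono)
  finally show ?case using n(1) by blast
next
  case (heads s q s0 s1 \<beta> p m)
  have s: "typed_state s0" "0 \<le> q" "q \<le> 1"
    using typed_state_transition(3)[OF heads.prems heads.hyps(1)] by auto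
  note q = of_rat_coin[OF s(2,3)]
  from heads.IH[OF s(1)] obtain n where n: "0 \<le> p" "ennreal p * prom r m \<le> weight r n s0 \<beta>" by blast
  have "ennreal (p * of_rat q) * prom r m = ennreal (of_rat q) * (ennreal p * prom r m)"
    using n(1) q by (simp add: ennreal_mult ac_simps)
  also have "\<dots> \<le> weight r (Suc n) s (False # \<beta>)" using n(2) heads.hyps(1) by (simp add: mult_left_mono)
  finally show ?case using n(1) q by (metis mult_nonneg_nonneg)
next
  case (tails s q s0 s1 \<beta> p m)
  have s: "typed_state s1" "0 \<le> q" "q \<le> 1"
    using typed_state_transition(3)[OF tails.prems tails.hyps(1)] by auto
  then have q: "0 \<le> 1 - (of_rat q :: real)" using of_rat_coin[OF s(2,3)] by simp
  from tails.IH[OF s(1)] obtain n where n: "0 \<le> p" "ennreal p * prom r m \<le> weight r n s1 \<beta>" by blast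
  have "ennreal (p * (1 - of_rat q)) * prom r m = ennreal (1 - of_rat q) * (ennreal p * prom r m)"
    using n(1) q by (simp add: ennreal_mult ac_simps)
  also have "\<dots> \<le> weight r (Suc n) s (True # \<beta>)" using n(2) tails.hyps(1) by (simp add: mult_left_mono)
  finally show ?case using n(1) q by (metis mult_nonneg_nonneg)
qed

text \<open>The converse for nonzero weights. Weight 0 is ambiguous: there may be no run, the cutoff
  may be too small, or a coin or a label on the run may have weight 0.\<close>

lemma weight_run:
  assumes "weight r n s \<beta> \<noteq> 0" "typed_state s"
  shows "\<exists>p m. run s \<beta> p m \<and> weight r n s \<beta> = ennreal p * prom r m"
  using assms
proof (induction n arbitrary: s \<beta>)
  case (Suc n)
  show ?case
  proof (cases "transition s")
    case Halt
    then have "\<beta> = []" using Suc.prems(1) by (simp split: if_splits)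
    then show ?thesis using run.halt[OF Halt] Halt by force
  next
    case (Step s')
    then have "weight r n s' \<beta> \<noteq> 0" using Suc.prems(1) by simp
    from Suc.IH[OF this typed_state_transition(1)[OF Suc.prems(2) Step]]
    obtain p m where pm: "run s' \<beta> p m" "weight r n s' \<beta> = ennreal p * prom r m" by blast
    have "weight r (Suc n) s \<beta> = ennreal p * prom r m" by (simp add: Step pm(2))
    then show ?thesis using run.step[OF Step pm(1)] by blast
  next
    case (Emit l s')
    then have "weight r n s' \<beta> \<noteq> 0" using Suc.prems(1) by auto
    from Suc.IH[OF this typed_state_transition(2)[OF Suc.prems(2) Emit]]
    obtain p m where pm: "run s' \<beta> p m" "weight r n s' \<beta> = ennreal p * prom r m" by blast
    have "weight r (Suc n) s \<beta> = ennreal p * prom r (m + {#l#})"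
      by (simp add: Emit pm(2) ac_simps)
    then show ?thesis using run.emit[OF Emit pm(1)] by blast
  next
    case (Flip q s0 s1)
    note t = typed_state_transition(3)[OF Suc.prems(2) Flip]
    then have q: "0 \<le> (of_rat q :: real)" "0 \<le> 1 - (of_rat q :: real)"
      using of_rat_coin[of q] by auto
    obtain b \<beta>' where \<beta>: "\<beta> = b # \<beta>'"
      using Suc.prems(1) Flip by (cases \<beta>) auto
    show ?thesis
    proof (cases b)
      case True
      then have "weight r n s1 \<beta>' \<noteq> 0" using Suc.prems(1) Flip \<beta> by auto
      from Suc.IH[OF this] t obtain p m where
        pm: "run s1 \<beta>' p m" "weight r n s1 \<beta>' = ennreal p * prom r m" by blast
      have "0 \<le> p" using run_weight_le[OF pm(1)] t by blast
      then have "weight r (Suc n) s \<beta> = ennreal (p * (1 - of_rat q)) * prom r m"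
        using True q by (simp add: Flip pm(2) \<beta> ennreal_mult ac_simps)
      moreover have "\<beta> = True # \<beta>'" using True \<beta> by simp
      ultimately show ?thesis using run.tails[OF Flip pm(1)] by blast
    next
      case False
      then have "weight r n s0 \<beta>' \<noteq> 0" using Suc.prems(1) Flip \<beta> by auto
      from Suc.IH[OF this] t obtain p m where
        pm: "run s0 \<beta>' p m" "weight r n s0 \<beta>' = ennreal p * prom r m" by blast
      have "0 \<le> p" using run_weight_le[OF pm(1)] t by blast
      then have "weight r (Suc n) s \<beta> = ennreal (p * of_rat q) * prom r m"
        using False q by (simp add: Flip pm(2) \<beta> ennreal_mult ac_simps)
      moreover have "\<beta> = False # \<beta>'" using False \<beta> by simp
      ultimately show ?thesis using run.heads[OF Flip pm(1)] by blast
    qed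
  qed (use Suc.prems(1) in simp)
qed simp

lemma Eval_run: "run s \<beta> p m \<Longrightarrow> Eval (strip_state s) \<beta> = p \<and> Eval_lab s \<beta> = m"
  unfolding Eval_def Eval_lab_def
  by (blast intro: the_equality ev_unique ev_lab_unique run_ev run_ev_lab)

lemma Dom_run: "\<beta> \<in> Dom (strip_state s) \<longleftrightarrow> (\<exists>p m. run s \<beta> p m)"
  unfolding Dom_def using ev_run run_ev by blast

text \<open>A bit string belongs to at most one run, so its weight at each cutoff is either 0 or
  bounded by the weight of that run, and some cutoff attains it.\<close>

lemma Pr_eq_Eval:
  assumes "typed_state s"
  shows "Pr r s = (\<Sum>\<^sub>\<infinity>\<beta>\<in>Dom (strip_state s). ennreal (Eval (strip_state s) \<beta>) * prom r (Eval_lab s \<beta>))"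
  unfolding Pr_eq_weight ennreal_infsum_restrict[of _ "Dom _"]
proof (rule infsum_cong)
  fix \<beta>
  show "(SUP n. weight r n s \<beta>) = (if \<beta> \<in> Dom (strip_state s)
      then ennreal (Eval (strip_state s) \<beta>) * prom r (Eval_lab s \<beta>) else 0)"
  proof (cases "\<beta> \<in> Dom (strip_state s)")
    case False
    then have "weight r n s \<beta> = 0" for n using weight_run[OF _ assms] Dom_run by blast
    then show ?thesis using False by simp
  next
    case True
    then obtain p m where run: "run s \<beta> p m" by (auto simp: Dom_run)
    have "weight r n s \<beta> \<le> ennreal p * prom r m" for n
    proof (cases "weight r n s \<beta> = 0")
      case False
      from weight_run[OF this assms] obtain p' m' where
        "run s \<beta> p' m'" "weight r n s \<beta> = ennreal p' * prom r m'" by blast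
      then show ?thesis using Eval_run[OF run] Eval_run[of s \<beta> p' m'] by simp
    qed simp
    moreover obtain n where "ennreal p * prom r m \<le> weight r n s \<beta>"
      using run_weight_le[OF run assms] by blast
    ultimately have "(SUP n. weight r n s \<beta>) = ennreal p * prom r m"
      by (intro antisym SUP_least SUP_upper2) auto
    then show ?thesis using True Eval_run[OF run] by simp
  qed
qed

lemma Eval_nonneg: "typed_state s \<Longrightarrow> \<beta> \<in> Dom (strip_state s) \<Longrightarrow> 0 \<le> Eval (strip_state s) \<beta>"
  using run_weight_le Eval_run by (metis Dom_run)

section \<open>Interpretation of stacks and its invariance under transitions\<close>

abbreviation null_env :: "vname \<Rightarrow> vec" where
  "null_env \<equiv> \<lambda>_ _. 0"

lemma env_ok_empty: "env_ok Map.empty \<rho>"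
  by (simp add: env_ok_def)

primrec frame_sem :: "('l \<Rightarrow> ennreal) \<Rightarrow> 'l frame \<Rightarrow> vec \<Rightarrow> vec" where
  "frame_sem r (FArg N) = (\<lambda>u. fun_of u (wsem r N null_env))"
| "frame_sem r FSucc = (\<lambda>u. mix (\<lambda>n. u (PNat n)) (\<lambda>n. dirac (n + 1)))"
| "frame_sem r FPred = (\<lambda>u. mix (\<lambda>n. u (PNat n)) (\<lambda>n. dirac (n - 1)))"
| "frame_sem r (FIf N P) = (\<lambda>u. mix (\<lambda>n. u (PNat n))
     (\<lambda>n. if n = 0 then wsem r N null_env else wsem r P null_env))"
| "frame_sem r (FLet x N) = (\<lambda>u. mix (\<lambda>n. u (PNat n)) (\<lambda>n. wsem r N (null_env(x := dirac n))))"

primrec stack_sem :: "('l \<Rightarrow> ennreal) \<Rightarrow> 'l frame list \<Rightarrow> vec \<Rightarrow> ennreal" where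
  "stack_sem r [] = (\<lambda>u. u (PNat 0))"
| "stack_sem r (f # \<pi>) = (\<lambda>u. stack_sem r \<pi> (frame_sem r f u))"

definition state_sem :: "('l \<Rightarrow> ennreal) \<Rightarrow> 'l state \<Rightarrow> ennreal" where
  "state_sem r s = stack_sem r (snd s) (wsem r (fst s) null_env)"

lemma mix_mix: "mix (\<lambda>k. mix p v (PNat k)) w = mix p (\<lambda>n. mix (\<lambda>k. v n (PNat k)) w)"
proof
  fix a
  have "mix (\<lambda>k. mix p v (PNat k)) w a = (\<Sum>\<^sub>\<infinity>k. \<Sum>\<^sub>\<infinity>n. p n * (v n (PNat k) * w k a))"
    by (simp add: mix_def ennreal_infsum_cmult_left[symmetric] mult.assoc)
  then show "mix (\<lambda>k. mix p v (PNat k)) w a = mix p (\<lambda>n. mix (\<lambda>k. v n (PNat k)) w) a"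
    by (subst (asm) ennreal_infsum_swap) (simp add: mix_def ennreal_infsum_cmult_right)
qed

lemma mix_dirac_left: "mix (\<lambda>k. dirac n (PNat k)) v = v n"
proof
  fix a
  show "mix (\<lambda>k. dirac n (PNat k)) v a = v n a"
    unfolding mix_def by (subst ennreal_infsum_single[where a = n]) (auto simp: dirac_def)
qed

lemma frame_sem_mix: "frame_sem r f (mix p v) = mix p (\<lambda>n. frame_sem r f (v n))"
  by (cases f) (simp_all add: fun_of_mix mix_mix)

text \<open>A stack is linear in what fills its hole: application is linear in the function, and the
  other frames are mixtures. Therefore the factors of coins and labels can be pulled out of any
  stack.\<close>

lemma stack_sem_mix: "stack_sem r \<pi> (mix p v) = (\<Sum>\<^sub>\<infinity>n. p n * stack_sem r \<pi> (v n))"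
  by (induction \<pi> arbitrary: v) (simp_all add: frame_sem_mix, simp add: mix_def)

lemma state_sem_Step:
  assumes "typed_state s" "transition s = Step s'" "\<And>l. r l \<le> 1"
  shows "state_sem r s = state_sem r s'"
  using assms(2)
proof (cases s rule: transition_cases)
  case (Let_Lit n x N \<pi>)
  then show ?thesis
    using assms(2) wsem_subst[OF typed.intros(1)[of Map.empty n], of r x N null_env null_env]
    by (auto simp: state_sem_def mix_dirac_left)
next
  case (Beta x \<sigma> M N \<pi>)
  then obtain \<tau> where M: "typed [x \<mapsto> \<sigma>] M \<tau>" and N: "typed Map.empty N \<sigma>"
    using assms(1) by (auto elim!: typed_stateE typed_stack_elims typed_elims(9))
  have "fun_of (wsem r (Lam x \<sigma> M) null_env) (wsem r N null_env) = wsem r (subst x N M) null_env"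
    unfolding wsem_subst[OF N, of r x M null_env null_env]
    by (rule wsem_beta[OF M assms(3) env_ok_empty wsem_elems[OF N assms(3) env_ok_empty]])
  then show ?thesis using assms(2) Beta by (auto simp: state_sem_def simp del: wsem.simps)
next
  case (Fix M \<pi>)
  then show ?thesis
    using assms(2) by (auto simp: state_sem_def wsem_Fix_unfold simp del: wsem.simps)
qed (use assms(2) in \<open>auto simp: state_sem_def mix_dirac_left\<close>)

text \<open>The interpretation obeys the recursion that \<open>total\<close> iterates from 0, hence
  bounds every iterate.\<close>

lemma total_le_state_sem:
  assumes "typed_state s" and r: "\<And>l. r l \<le> 1"
  shows "total r n s \<le> state_sem r s"
  using assms(1)
proof (induction n arbitrary: s)
  case (Suc n)
  show ?case
  proof (cases "transition s")
    case Halt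
    then have "s = (Lit 0, [])" by (cases s rule: transition_cases) auto
    then show ?thesis by (simp add: state_sem_def dirac_def)
  next
    case (Step s')
    then show ?thesis
      using Suc.IH[OF typed_state_transition(1)[OF Suc.prems Step]] state_sem_Step[OF Suc.prems Step r]
      by simp
  next
    case (Emit l s')
    then obtain M \<pi> where s: "s = (Lab l M, \<pi>)" "s' = (M, \<pi>)" by (cases s rule: transition_cases) auto
    have "state_sem r s = r l * state_sem r s'"
      by (simp add: s state_sem_def stack_sem_mix) (subst ennreal_infsum_single[where a = 0], auto)
    then show ?thesis
      using Emit Suc.IH[OF typed_state_transition(2)[OF Suc.prems Emit]] by (simp add: mult_left_mono)
  next
    case (Flip q s0 s1)
    then obtain \<pi> where s: "s = (Coin q, \<pi>)" "s0 = (Lit 0, \<pi>)" "s1 = (Lit 1, \<pi>)"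
      by (cases s rule: transition_cases) auto
    have "state_sem r s = ennreal (of_rat q) * state_sem r s0 + ennreal (1 - of_rat q) * state_sem r s1"
      by (simp add: s state_sem_def stack_sem_mix)
        (subst ennreal_infsum_nat, subst ennreal_infsum_nat, simp)
    then show ?thesis
      using Flip Suc.IH typed_state_transition(3)[OF Suc.prems Flip]
      by (simp add: mult_left_mono add_mono)
  qed simp
qed simp

lemma soundness:
  assumes "typed Map.empty M Nat" "\<And>l. r l \<le> 1"
  shows "Pr r (M, []) \<le> wsem r M null_env (PNat 0)"
proof -
  have "typed_state (M, [])" by (rule typed_stateI[OF assms(1)]) (rule typed_stack.intros)
  from total_le_state_sem[OF this assms(2)] show ?thesis
    unfolding Pr_def by (intro SUP_least) (simp add: state_sem_def)
qed

text \<open>At type nat, u is adequate for M if under every stack M weighs at least as much as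
  drawing a numeral n with mass u_n and continuing with it. Since all stacks are considered, a
  subterm in evaluation position is handled by pushing the frame of its construct. Arguments are
  typed and taken from the PCS because \<open>wsem_beta\<close> holds only there.\<close>

primrec adequate :: "ty \<Rightarrow> ('l \<Rightarrow> ennreal) \<Rightarrow> 'l tm \<Rightarrow> vec \<Rightarrow> bool" where
  "adequate Nat = (\<lambda>r M u. \<forall>\<pi>. (\<Sum>\<^sub>\<infinity>n. u (PNat n) * Pr r (Lit n, \<pi>)) \<le> Pr r (M, \<pi>))"
| "adequate (Fun \<sigma> \<tau>) = (\<lambda>r M t. \<forall>N u. typed Map.empty N \<sigma> \<longrightarrow> u \<in> elems (den \<sigma>) \<longrightarrow>
     adequate \<sigma> r N u \<longrightarrow> adequate \<tau> r (App M N) (fun_of t u))"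

text \<open>Covers every construct that draws a number n and continues as \<open>N n\<close>. At an
  arrow type the argument is pushed on the stack, and the first hypothesis at
  \<open>FArg P # \<pi>\<close> is the one needed for the applied terms.\<close>

lemma adequate_mix:
  assumes "\<And>\<pi>. (\<Sum>\<^sub>\<infinity>n. p n * Pr r (N n, \<pi>)) \<le> Pr r (M, \<pi>)" "\<And>n. adequate \<sigma> r (N n) (v n)"
  shows "adequate \<sigma> r M (mix p v)"
  using assms
proof (induction \<sigma> arbitrary: M N v)
  case Nat
  have "(\<Sum>\<^sub>\<infinity>k. mix p v (PNat k) * Pr r (Lit k, \<pi>)) \<le> Pr r (M, \<pi>)" for \<pi>
  proof -
    have "(\<Sum>\<^sub>\<infinity>k. mix p v (PNat k) * Pr r (Lit k, \<pi>)) = (\<Sum>\<^sub>\<infinity>k. \<Sum>\<^sub>\<infinity>n. p n * (v n (PNat k) * Pr r (Lit k, \<pi>)))"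
      by (simp add: mix_def ennreal_infsum_cmult_left[symmetric] mult.assoc)
    also have "\<dots> = (\<Sum>\<^sub>\<infinity>n. p n * (\<Sum>\<^sub>\<infinity>k. v n (PNat k) * Pr r (Lit k, \<pi>)))"
      by (subst ennreal_infsum_swap) (simp add: ennreal_infsum_cmult_right)
    also have "\<dots> \<le> (\<Sum>\<^sub>\<infinity>n. p n * Pr r (N n, \<pi>))"
      using Nat(2) by (intro ennreal_infsum_mono mult_left_mono) auto
    also have "\<dots> \<le> Pr r (M, \<pi>)" by (rule Nat(1))
    finally show ?thesis .
  qed
  then show ?case by simp
next
  case (Fun \<sigma> \<tau>)
  have "adequate \<tau> r (App M P) (mix p (\<lambda>n. fun_of (v n) u))"
    if "typed Map.empty P \<sigma>" "u \<in> elems (den \<sigma>)" "adequate \<sigma> r P u" for P u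
  proof (rule Fun.IH(2)[where N = "\<lambda>n. App (N n) P"])
    show "(\<Sum>\<^sub>\<infinity>n. p n * Pr r (App (N n) P, \<pi>)) \<le> Pr r (App M P, \<pi>)" for \<pi>
      using Fun.prems(1)[of "FArg P # \<pi>"] by (simp add: Pr_Step)
    show "adequate \<tau> r (App (N n) P) (fun_of (v n) u)" for n
      using Fun.prems(2)[of n] that by simp
  qed
  then show ?case by (simp add: fun_of_mix)
qed

lemma adequate_expand:
  assumes "\<And>\<pi>. Pr r (N, \<pi>) \<le> Pr r (M, \<pi>)" "adequate \<sigma> r N u"
  shows "adequate \<sigma> r M u"
proof -
  \<comment> \<open>A trivial mixture turns expansion into a case of \<open>adequate_mix\<close>:
    all mass is at 0.\<close>
  have "mix (\<lambda>n. dirac 0 (PNat n)) (\<lambda>_. u) = u" by (rule mix_dirac_left)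
  moreover have "(\<Sum>\<^sub>\<infinity>n. dirac 0 (PNat n) * Pr r (N, \<pi>)) \<le> Pr r (M, \<pi>)" for \<pi>
    by (subst ennreal_infsum_single[where a = 0]) (auto simp: dirac_def assms(1))
  ultimately show ?thesis
    using adequate_mix[where N = "\<lambda>_. N" and v = "\<lambda>_. u" and p = "\<lambda>n. dirac 0 (PNat n)"] assms(2)
    by metis
qed

lemma adequate_zero: "adequate \<sigma> r M (\<lambda>_. 0)"
  by (induction \<sigma> arbitrary: M) (simp_all add: fun_of_def)

text \<open>Admissibility of the relation, by monotone convergence. It passes from the iterates of a
  fixpoint to their supremum.\<close>

lemma adequate_SUP:
  fixes u :: "nat \<Rightarrow> vec"
  assumes "\<And>n. adequate \<sigma> r M (u n)" "\<And>a. incseq (\<lambda>n. u n a)"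
  shows "adequate \<sigma> r M (\<lambda>a. SUP n. u n a)"
  using assms
proof (induction \<sigma> arbitrary: M u)
  case Nat
  have "(\<Sum>\<^sub>\<infinity>k. (SUP n. u n (PNat k)) * Pr r (Lit k, \<pi>)) \<le> Pr r (M, \<pi>)" for \<pi>
  proof -
    have "(\<Sum>\<^sub>\<infinity>k. (SUP n. u n (PNat k)) * Pr r (Lit k, \<pi>)) = (SUP n. \<Sum>\<^sub>\<infinity>k. u n (PNat k) * Pr r (Lit k, \<pi>))"
      unfolding SUP_mult_right_ennreal
      by (rule ennreal_infsum_SUP) (use Nat(2) in \<open>auto simp: incseq_def intro: mult_right_mono\<close>)
    also have "\<dots> \<le> Pr r (M, \<pi>)" using Nat(1) by (intro SUP_least) simp
    finally show ?thesis .
  qed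
  then show ?case by simp
next
  case (Fun \<sigma> \<tau>)
  have fun_of_SUP_left: "fun_of (\<lambda>a. SUP n. u n a) v = (\<lambda>b. SUP n. fun_of (u n) v b)" for v
    unfolding fun_of_def SUP_mult_right_ennreal
    by (rule ext, rule ennreal_infsum_SUP)
      (use Fun.prems(2) in \<open>auto simp: incseq_def intro: mult_right_mono\<close>)
  have "adequate \<tau> r (App M P) (\<lambda>b. SUP n. fun_of (u n) v b)"
    if "typed Map.empty P \<sigma>" "v \<in> elems (den \<sigma>)" "adequate \<sigma> r P v" for P v
  proof (rule Fun.IH(2))
    show "adequate \<tau> r (App M P) (fun_of (u n) v)" for n
      using Fun.prems(1)[of n] that by simp
    show "incseq (\<lambda>n. fun_of (u n) v b)" for b
      using Fun.prems(2) unfolding fun_of_def incseq_def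
      by (auto intro!: ennreal_infsum_mono mult_right_mono)
  qed
  then show ?case by (simp add: fun_of_SUP_left)
qed

section \<open>Closing substitutions\<close>

primrec msubst :: "(vname \<Rightarrow> 'l tm option) \<Rightarrow> 'l tm \<Rightarrow> 'l tm" where
  "msubst \<theta> (Lit n) = Lit n"
| "msubst \<theta> (Succ M) = Succ (msubst \<theta> M)"
| "msubst \<theta> (Pred M) = Pred (msubst \<theta> M)"
| "msubst \<theta> (Var y) = (case \<theta> y of None \<Rightarrow> Var y | Some N \<Rightarrow> N)"
| "msubst \<theta> (Coin q) = Coin q"
| "msubst \<theta> (LetIn y M N) = LetIn y (msubst \<theta> M) (msubst (\<theta>(y := None)) N)"
| "msubst \<theta> (IfZ M N P) = IfZ (msubst \<theta> M) (msubst \<theta> N) (msubst \<theta> P)"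
| "msubst \<theta> (App M N) = App (msubst \<theta> M) (msubst \<theta> N)"
| "msubst \<theta> (Lam y \<sigma> M) = Lam y \<sigma> (msubst (\<theta>(y := None)) M)"
| "msubst \<theta> (Fix M) = Fix (msubst \<theta> M)"
| "msubst \<theta> (Lab l M) = Lab l (msubst \<theta> M)"

lemma msubst_empty: "msubst Map.empty M = M"
  by (induction M) (simp_all add: fun_upd_idem)

lemma subst_fresh: "typed \<Gamma> N \<sigma> \<Longrightarrow> x \<notin> dom \<Gamma> \<Longrightarrow> subst x P N = N"
  by (induction rule: typed.induct) (auto simp: dom_def)

text \<open>The terms in \<theta> are closed, so substituting for \<open>x\<close> leaves them alone
  and fills only the occurrences that \<open>\<theta>(x := None)\<close> left open. This matches
  what the machine does: it substitutes into a body whose other variables have been replaced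
  before.\<close>

lemma subst_msubst:
  assumes "\<And>y N. \<theta> y = Some N \<Longrightarrow> \<exists>\<sigma>. typed Map.empty N \<sigma>"
  shows "subst x P (msubst (\<theta>(x := None)) M) = msubst (\<theta>(x \<mapsto> P)) M"
  using assms
proof (induction M arbitrary: \<theta>)
  case (Var y)
  then show ?case by (auto split: option.split dest!: Var subst_fresh[where x = x and P = P])
next
  case (LetIn y M N)
  have cl: "\<And>z N. (\<theta>(y := None)) z = Some N \<Longrightarrow> \<exists>\<sigma>. typed Map.empty N \<sigma>"
    using LetIn.prems by (auto split: if_splits)
  have "(if y = x then msubst (\<theta>(x := None, y := None)) N else subst x P (msubst (\<theta>(x := None, y := None)) N))
      = msubst (\<theta>(x \<mapsto> P, y := None)) N"
  proof (cases "y = x")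
    case False
    then show ?thesis
      using LetIn.IH(2)[of "\<theta>(y := None)", OF cl] by (simp only: if_False fun_upd_twist[OF False])
  qed (simp only: simp_thms if_True fun_upd_upd)
  then show ?case using LetIn.IH(1)[of \<theta>, OF LetIn.prems] by (simp only: msubst.simps subst.simps)
next
  case (Lam y \<sigma> M)
  have cl: "\<And>z N. (\<theta>(y := None)) z = Some N \<Longrightarrow> \<exists>\<sigma>. typed Map.empty N \<sigma>"
    using Lam.prems by (auto split: if_splits)
  have "(if y = x then msubst (\<theta>(x := None, y := None)) M else subst x P (msubst (\<theta>(x := None, y := None)) M))
      = msubst (\<theta>(x \<mapsto> P, y := None)) M"
  proof (cases "y = x")
    case False
    then show ?thesis
      using Lam.IH[of "\<theta>(y := None)", OF cl] by (simp only: if_False fun_upd_twist[OF False])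
  qed (simp only: simp_thms if_True fun_upd_upd)
  then show ?case by (simp only: msubst.simps subst.simps)
qed simp_all

text \<open>\<open>\<Delta>\<close> types the variables that \<theta> leaves alone; it starts empty
  in the application and grows under binders.\<close>

lemma typed_msubst:
  "typed \<Gamma> M \<sigma> \<Longrightarrow>
    (\<And>y \<tau>. \<Gamma> y = Some \<tau> \<Longrightarrow> (case \<theta> y of None \<Rightarrow> \<Delta> y = Some \<tau> | Some N \<Rightarrow> typed Map.empty N \<tau>)) \<Longrightarrow>
    typed \<Delta> (msubst \<theta> M) \<sigma>"
proof (induction arbitrary: \<theta> \<Delta> rule: typed.induct)
  case (4 \<Gamma> x \<sigma>)
  from 4(2)[OF 4(1)] show ?case
    by (auto split: option.splits intro: typed.intros typed_weaken)
next
  case (6 \<Gamma> M x N \<sigma>)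
  have "typed (\<Delta>(x \<mapsto> Nat)) (msubst (\<theta>(x := None)) N) \<sigma>"
  proof (rule 6(4))
    fix z \<tau> assume "(\<Gamma>(x \<mapsto> Nat)) z = Some \<tau>"
    then show "case (\<theta>(x := None)) z of None \<Rightarrow> (\<Delta>(x \<mapsto> Nat)) z = Some \<tau> | Some N \<Rightarrow> typed Map.empty N \<tau>"
      using 6(5)[of z \<tau>] by (cases "z = x") (auto split: option.splits)
  qed
  from typed.intros(6)[OF 6(3)[OF 6(5)] this] show ?case by simp
next
  case (9 \<Gamma> x \<sigma> M \<tau>)
  have "typed (\<Delta>(x \<mapsto> \<sigma>)) (msubst (\<theta>(x := None)) M) \<tau>"
  proof (rule 9(2))
    fix z \<tau>' assume "(\<Gamma>(x \<mapsto> \<sigma>)) z = Some \<tau>'"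
    then show "case (\<theta>(x := None)) z of None \<Rightarrow> (\<Delta>(x \<mapsto> \<sigma>)) z = Some \<tau>' | Some N \<Rightarrow> typed Map.empty N \<tau>'"
      using 9(3)[of z \<tau>'] by (cases "z = x") (auto split: option.splits)
  qed
  from typed.intros(9)[OF this] show ?case by simp
next
  case (8 \<Gamma> M \<sigma> \<tau> N)
  from typed.intros(8)[OF 8(3)[OF 8(5)] 8(4)[OF 8(5)]] show ?case by simp
qed (simp_all add: typed.intros)

text \<open>Since \<theta> is undefined outside the context, every term in it is closed and typable,
  as \<open>subst_msubst\<close> requires.\<close>

definition adequate_env ::
    "('l \<Rightarrow> ennreal) \<Rightarrow> ctx \<Rightarrow> (vname \<Rightarrow> 'l tm option) \<Rightarrow> (vname \<Rightarrow> vec) \<Rightarrow> bool" where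
  "adequate_env r \<Gamma> \<theta> \<rho> \<longleftrightarrow> (\<forall>y. case \<Gamma> y of None \<Rightarrow> \<theta> y = None
     | Some \<tau> \<Rightarrow> \<exists>N. \<theta> y = Some N \<and> typed Map.empty N \<tau> \<and> \<rho> y \<in> elems (den \<tau>) \<and> adequate \<tau> r N (\<rho> y))"

lemma adequate_envD:
  assumes "adequate_env r \<Gamma> \<theta> \<rho>"
  shows "\<Gamma> y = Some \<tau> \<Longrightarrow>
      \<exists>N. \<theta> y = Some N \<and> typed Map.empty N \<tau> \<and> \<rho> y \<in> elems (den \<tau>) \<and> adequate \<tau> r N (\<rho> y)"
    and "\<theta> y = Some N \<Longrightarrow> \<exists>\<tau>. typed Map.empty N \<tau>"
    and "env_ok \<Gamma> \<rho>"
proof -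
  have *: "case \<Gamma> y of None \<Rightarrow> \<theta> y = None
     | Some \<tau> \<Rightarrow> \<exists>N. \<theta> y = Some N \<and> typed Map.empty N \<tau> \<and> \<rho> y \<in> elems (den \<tau>) \<and> adequate \<tau> r N (\<rho> y)" for y
    using assms unfolding adequate_env_def by blast
  show 1: "\<exists>N. \<theta> y = Some N \<and> typed Map.empty N \<tau> \<and> \<rho> y \<in> elems (den \<tau>) \<and> adequate \<tau> r N (\<rho> y)"
    if "\<Gamma> y = Some \<tau>" for y \<tau>
    using *[of y] that by simp
  show "\<exists>\<tau>. typed Map.empty N \<tau>" if "\<theta> y = Some N"
    using *[of y] that by (auto split: option.splits)
  show "env_ok \<Gamma> \<rho>" using 1 by (auto simp: env_ok_def)
qed

lemma adequate_env_upd: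
  assumes "adequate_env r \<Gamma> \<theta> \<rho>" "typed Map.empty N \<tau>" "u \<in> elems (den \<tau>)" "adequate \<tau> r N u"
  shows "adequate_env r (\<Gamma>(x \<mapsto> \<tau>)) (\<theta>(x \<mapsto> N)) (\<rho>(x := u))"
  unfolding adequate_env_def
proof
  fix y
  show "case (\<Gamma>(x \<mapsto> \<tau>)) y of None \<Rightarrow> (\<theta>(x \<mapsto> N)) y = None
     | Some \<tau>' \<Rightarrow> \<exists>N'. (\<theta>(x \<mapsto> N)) y = Some N' \<and> typed Map.empty N' \<tau>' \<and>
         (\<rho>(x := u)) y \<in> elems (den \<tau>') \<and> adequate \<tau>' r N' ((\<rho>(x := u)) y)"
    using assms(2-4) assms(1)[unfolded adequate_env_def, rule_format, of y]
    by (cases "y = x") (auto split: option.splits)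
qed

lemma adequate_env_typed:
  assumes "adequate_env r \<Gamma> \<theta> \<rho>" "typed \<Gamma> M \<sigma>"
  shows "typed Map.empty (msubst \<theta> M) \<sigma>"
  by (rule typed_msubst[OF assms(2)]) (use adequate_envD(1)[OF assms(1)] in fastforce)

lemma adequate_Lit: "adequate Nat r (Lit n) (dirac n)"
proof -
  have "(\<Sum>\<^sub>\<infinity>k. dirac n (PNat k) * Pr r (Lit k, \<pi>)) = Pr r (Lit n, \<pi>)" for \<pi>
    by (subst ennreal_infsum_single[where a = n]) (auto simp: dirac_def)
  then show ?thesis by simp
qed

lemma adequacy:
  assumes "typed \<Gamma> M \<sigma>" "adequate_env r \<Gamma> \<theta> \<rho>" and r: "\<And>l. r l \<le> 1"
  shows "adequate \<sigma> r (msubst \<theta> M) (wsem r M \<rho>)"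
  using assms(1,2)
proof (induction arbitrary: \<theta> \<rho> rule: typed.induct)
  case (1 \<Gamma> n)
  show ?case by (simp only: msubst.simps wsem.simps adequate_Lit)
next
  case (2 \<Gamma> M)
  have IH: "adequate Nat r (msubst \<theta> M) (wsem r M \<rho>)" by (rule 2(2)[OF 2(3)])
  show ?case unfolding msubst.simps wsem.simps
  proof (rule adequate_mix[OF _ adequate_Lit])
    show "(\<Sum>\<^sub>\<infinity>n. wsem r M \<rho> (PNat n) * Pr r (Lit (n + 1), \<pi>)) \<le> Pr r (Succ (msubst \<theta> M), \<pi>)" for \<pi>
      using IH[unfolded adequate.simps, rule_format, of "FSucc # \<pi>"] by (simp add: Pr_Step)
  qed
next
  case (3 \<Gamma> M)
  have IH: "adequate Nat r (msubst \<theta> M) (wsem r M \<rho>)" by (rule 3(2)[OF 3(3)])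
  show ?case unfolding msubst.simps wsem.simps
  proof (rule adequate_mix[OF _ adequate_Lit])
    show "(\<Sum>\<^sub>\<infinity>n. wsem r M \<rho> (PNat n) * Pr r (Lit (n - 1), \<pi>)) \<le> Pr r (Pred (msubst \<theta> M), \<pi>)" for \<pi>
      using IH[unfolded adequate.simps, rule_format, of "FPred # \<pi>"] by (simp add: Pr_Step)
  qed
next
  case (4 \<Gamma> x \<sigma>)
  from adequate_envD(1)[OF 4(2) 4(1)] show ?case by auto
next
  case (5 q \<Gamma>)
  show ?case unfolding msubst.simps wsem.simps
  proof (rule adequate_mix[OF _ adequate_Lit])
    show "(\<Sum>\<^sub>\<infinity>n. (if n = 0 then ennreal (of_rat q) else if n = 1 then ennreal (1 - of_rat q) else 0) *
        Pr r (Lit n, \<pi>)) \<le> Pr r (Coin q, \<pi>)" for \<pi>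
      by (subst ennreal_infsum_nat, subst ennreal_infsum_nat) (simp add: Pr_unfold[of r "(Coin q, \<pi>)"])
  qed
next
  case (6 \<Gamma> M x N \<sigma>)
  have IH: "adequate Nat r (msubst \<theta> M) (wsem r M \<rho>)" by (rule 6(3)[OF 6(5)])
  have sub: "subst x P (msubst (\<theta>(x := None)) N) = msubst (\<theta>(x \<mapsto> P)) N" for P
    by (rule subst_msubst) (rule adequate_envD(2)[OF 6(5)])
  let ?N = "msubst (\<theta>(x := None)) N"
  show ?case unfolding msubst.simps wsem.simps
  proof (rule adequate_mix[where N = "\<lambda>n. subst x (Lit n) ?N"])
    show "(\<Sum>\<^sub>\<infinity>n. wsem r M \<rho> (PNat n) * Pr r (subst x (Lit n) ?N, \<pi>)) \<le>
        Pr r (LetIn x (msubst \<theta> M) ?N, \<pi>)" for \<pi>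
      using IH[unfolded adequate.simps, rule_format, of "FLet x ?N # \<pi>"] by (simp add: Pr_Step)
    show "adequate \<sigma> r (subst x (Lit n) ?N) (wsem r N (\<rho>(x := dirac n)))" for n
      unfolding sub
      by (rule 6(4)[OF adequate_env_upd[OF 6(5) typed.intros(1) dirac_elems adequate_Lit]])
  qed
next
  case (7 \<Gamma> M N \<sigma> P)
  have IH: "adequate Nat r (msubst \<theta> M) (wsem r M \<rho>)" by (rule 7(4)[OF 7(7)])
  show ?case unfolding msubst.simps wsem.simps
  proof (rule adequate_mix[where N = "\<lambda>n. if n = 0 then msubst \<theta> N else msubst \<theta> P"])
    show "(\<Sum>\<^sub>\<infinity>n. wsem r M \<rho> (PNat n) * Pr r (if n = 0 then msubst \<theta> N else msubst \<theta> P, \<pi>)) \<le>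
        Pr r (IfZ (msubst \<theta> M) (msubst \<theta> N) (msubst \<theta> P), \<pi>)" for \<pi>
      using IH[unfolded adequate.simps, rule_format, of "FIf (msubst \<theta> N) (msubst \<theta> P) # \<pi>"]
      by (simp add: Pr_Step)
    show "adequate \<sigma> r (if n = 0 then msubst \<theta> N else msubst \<theta> P)
        (if n = 0 then wsem r N \<rho> else wsem r P \<rho>)" for n :: nat
      using 7(5)[OF 7(7)] 7(6)[OF 7(7)] by (cases "n = 0") simp_all
  qed
next
  case (8 \<Gamma> M \<sigma> \<tau> N)
  have "adequate (Fun \<sigma> \<tau>) r (msubst \<theta> M) (wsem r M \<rho>)" by (rule 8(3)[OF 8(5)])
  moreover have "typed Map.empty (msubst \<theta> N) \<sigma>" by (rule adequate_env_typed[OF 8(5) 8(2)])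
  moreover have "wsem r N \<rho> \<in> elems (den \<sigma>)" by (rule wsem_elems[OF 8(2) r adequate_envD(3)[OF 8(5)]])
  moreover have "adequate \<sigma> r (msubst \<theta> N) (wsem r N \<rho>)" by (rule 8(4)[OF 8(5)])
  ultimately show ?case by simp
next
  case (9 \<Gamma> x \<sigma> M \<tau>)
  have sub: "subst x P (msubst (\<theta>(x := None)) M) = msubst (\<theta>(x \<mapsto> P)) M" for P
    by (rule subst_msubst) (rule adequate_envD(2)[OF 9(3)])
  have "adequate \<tau> r (App (msubst \<theta> (Lam x \<sigma> M)) P) (fun_of (wsem r (Lam x \<sigma> M) \<rho>) u)"
    if P: "typed Map.empty P \<sigma>" "u \<in> elems (den \<sigma>)" "adequate \<sigma> r P u" for P u
  proof (rule adequate_expand)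
    show "adequate \<tau> r (msubst (\<theta>(x \<mapsto> P)) M) (fun_of (wsem r (Lam x \<sigma> M) \<rho>) u)"
      unfolding wsem_beta[OF 9(1) r adequate_envD(3)[OF 9(3)] P(2)]
      by (rule 9(2)[OF adequate_env_upd[OF 9(3) P]])
    show "Pr r (msubst (\<theta>(x \<mapsto> P)) M, \<pi>) \<le> Pr r (App (msubst \<theta> (Lam x \<sigma> M)) P, \<pi>)" for \<pi>
      unfolding sub[symmetric] by (simp add: Pr_Step)
  qed
  then show ?case by (simp del: wsem.simps msubst.simps)
next
  case (10 \<Gamma> M \<sigma>)
  let ?M = "msubst \<theta> M" and ?t = "wsem r M \<rho>"
  have M: "adequate (Fun \<sigma> \<sigma>) r ?M ?t" by (rule 10(2)[OF 10(3)])
  have t: "?t \<in> elems (den (Fun \<sigma> \<sigma>))" by (rule wsem_elems[OF 10(1) r adequate_envD(3)[OF 10(3)]])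
  have ty: "typed Map.empty (Fix ?M) \<sigma>"
    by (rule typed.intros) (rule adequate_env_typed[OF 10(3) 10(1)])
  have "adequate \<sigma> r (Fix ?M) ((fun_of ?t ^^ n) (\<lambda>_. 0))" for n
  proof (induction n)
    case 0
    show ?case by (simp add: adequate_zero)
  next
    case (Suc n)
    \<comment> \<open>\<open>App ?M (Fix ?M)\<close> and \<open>Fix ?M\<close> reach the same state
      in one step, so adequacy of one iterate for \<open>Fix ?M\<close> gives adequacy of the
      next.\<close>
    have "adequate \<sigma> r (App ?M (Fix ?M)) (fun_of ?t ((fun_of ?t ^^ n) (\<lambda>_. 0)))"
      using M ty iterate_elems[OF t] Suc by simp
    then have "adequate \<sigma> r (Fix ?M) (fun_of ?t ((fun_of ?t ^^ n) (\<lambda>_. 0)))"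
      by (rule adequate_expand[rotated]) (simp add: Pr_Step)
    then show ?case by simp
  qed
  from adequate_SUP[OF this iterate_incseq] show ?case by simp
next
  case (11 \<Gamma> M \<sigma> l)
  show ?case unfolding msubst.simps wsem.simps
  proof (rule adequate_mix)
    show "(\<Sum>\<^sub>\<infinity>n::nat. (if n = 0 then r l else 0) * Pr r (msubst \<theta> M, \<pi>)) \<le> Pr r (Lab l (msubst \<theta> M), \<pi>)" for \<pi>
      by (subst ennreal_infsum_single[where a = 0]) (simp_all add: Pr_unfold[of r "(Lab l (msubst \<theta> M), \<pi>)"])
    show "adequate \<sigma> r (msubst \<theta> M) (wsem r M \<rho>)" by (rule 11(2)[OF 11(3)])
  qed
qed

lemma wsem_eq_Pr:
  assumes "typed Map.empty M Nat" "\<And>l. r l \<le> 1"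
  shows "wsem r M null_env (PNat 0) = Pr r (M, [])"
proof (rule antisym)
  have "adequate_env r Map.empty Map.empty null_env" by (simp add: adequate_env_def)
  from adequacy[OF assms(1) this assms(2)]
  have "(\<Sum>\<^sub>\<infinity>n. wsem r M null_env (PNat n) * Pr r (Lit n, [])) \<le> Pr r (M, [])"
    by (simp add: msubst_empty)
  \<comment> \<open>With the empty stack the numeral 0 halts at once with weight 1, so the summand
    at 0 is the value in question.\<close>
  moreover have "wsem r M null_env (PNat 0) * Pr r (Lit 0, []) \<le>
      (\<Sum>\<^sub>\<infinity>n. wsem r M null_env (PNat n) * Pr r (Lit n, []))"
    by (rule ennreal_infsum_ge[where f = "\<lambda>n. wsem r M null_env (PNat n) * Pr r (Lit n, [])"])
  moreover have "Pr r (Lit 0, []) = 1" by (simp add: Pr_unfold[of r "(Lit 0, [])"])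
  ultimately show "wsem r M null_env (PNat 0) \<le> Pr r (M, [])" by (simp add: order_trans)
qed (rule soundness[OF assms])

section \<open>Left derivative and conditional expectation\<close>

lemma Spy_strip: "Spy x \<Gamma> (strip M) = strip M"
  by (induction M arbitrary: \<Gamma>) auto

lemma strip_strip: "strip (strip M) = strip M"
  by (induction M) auto

lemma labels_strip: "labels (strip M) = {}"
  by (induction M) auto

lemma typed_strip: "typed \<Gamma> M \<sigma> \<Longrightarrow> typed \<Gamma> (strip M) \<sigma>"
proof (induction rule: typed.induct)
  case (6 \<Gamma> M x N \<sigma>)
  show ?case unfolding strip.simps by (rule typed.intros(6)[OF 6(3,4)])
next
  case (9 \<Gamma> x \<sigma> M \<tau>)
  show ?case unfolding strip.simps by (rule typed.intros(9)[OF 9(2)])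
qed (auto intro: typed.intros)

lemma prom_one: "prom (\<lambda>_. 1) m = 1"
  by (induction m) auto

lemma prom_upd_one: "prom ((\<lambda>_. 1)(l := z)) m = z ^ count m l"
  by (induction m) auto

lemma closed_sem_strip:
  assumes "typed Map.empty M Nat"
  shows "closed_sem (strip M) (PNat 0) = (\<Sum>\<^sub>\<infinity>\<beta>\<in>Dom (strip M, []). ennreal (Eval (strip M, []) \<beta>))"
    and "closed_sem (strip M) (PNat 0) \<le> 1"
proof -
  note ty = typed_strip[OF assms]
  let ?w = "wsem (\<lambda>_. 1) (strip M) null_env"
  \<comment> \<open>A term without labels is its own spy translation, so \<open>sem_Spy\<close> with
    an empty label set compares \<open>sem\<close> with \<open>wsem\<close>, for any assignment of
    variables to labels.\<close>
  have "sem Map.empty (Spy undefined Map.empty (strip M)) null_env = ?w"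
    by (rule sem_Spy[OF ty, where L = "{}"])
      (auto simp: labels_strip spy_ctx_ext_def spy_env_ext_def env_ok_empty)
  then have closed_sem: "closed_sem (strip M) (PNat 0) = ?w (PNat 0)"
    by (simp add: closed_sem_def Spy_strip)
  also have "\<dots> = Pr (\<lambda>_. 1) (strip M, [])" by (rule wsem_eq_Pr[OF ty]) simp
  also have "\<dots> = (\<Sum>\<^sub>\<infinity>\<beta>\<in>Dom (strip M, []). ennreal (Eval (strip M, []) \<beta>))"
    using Pr_eq_Eval[OF typed_stateI[OF ty typed_stack.intros(1)], of "\<lambda>_. 1"]
    by (simp add: strip_state_def strip_strip prom_one)
  finally show "closed_sem (strip M) (PNat 0) =
      (\<Sum>\<^sub>\<infinity>\<beta>\<in>Dom (strip M, []). ennreal (Eval (strip M, []) \<beta>))" .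
  have "?w (PNat 0) \<le> (\<Sum>\<^sub>\<infinity>n. ?w (PNat n))"
    by (rule ennreal_infsum_ge[where f = "\<lambda>n. ?w (PNat n)"])
  also have "\<dots> \<le> 1" by (rule elems_Nat_sum[OF wsem_elems[OF ty _ env_ok_empty]]) simp
  finally show "closed_sem (strip M) (PNat 0) \<le> 1" by (simp only: closed_sem)
qed

lemma spy_series_eq:
  assumes "typed Map.empty M Nat" "labels M \<subseteq> L" "inj_on x L" "x ` L \<inter> vars M = {}"
    and \<rho>: "\<And>l. \<rho> l \<le> 1"
  shows "spy_series x L M \<rho> = enn2real (\<Sum>\<^sub>\<infinity>\<beta>\<in>Dom (strip M, []).
    ennreal (Eval (strip M, []) \<beta>) * prom (\<lambda>l. ennreal (\<rho> l)) (Eval_lab (M, []) \<beta>))"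
proof -
  let ?r = "\<lambda>l. ennreal (\<rho> l)"
  have r: "?r l \<le> 1" for l using \<rho>[of l] by (simp add: ennreal_le_1)
  have "sem (spy_ctx x L) (Spy x Map.empty M) (spy_env x L \<rho>) = wsem ?r M null_env"
    by (rule sem_Spy[OF assms(1,2,4) _ _ env_ok_empty r])
      (auto simp: spy_ctx_ext_def spy_env_ext_def spy_ctx_def spy_env_def inv_into_f_f[OF assms(3)])
  then have "spy_series x L M \<rho> = enn2real (Pr ?r (M, []))"
    unfolding spy_series_def using wsem_eq_Pr[OF assms(1) r] by simp
  then show ?thesis
    using Pr_eq_Eval[OF typed_stateI[OF assms(1) typed_stack.intros(1)], of ?r]
    by (simp add: strip_state_def)
qed

text \<open>The difference quotient of z^n at 1 is a sum of n powers of 1 - h, which increases to n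
  as h decreases to 0. Monotone convergence along h = 1/(j+1) gives the limit of the series, and
  monotonicity in h extends it to the limit from the right, even if it is infinite.\<close>

lemma left_derivative_power_series:
  fixes e :: "'a \<Rightarrow> real" and n :: "'a \<Rightarrow> nat"
  assumes e: "\<And>\<beta>. 0 \<le> e \<beta>" and fin: "(\<Sum>\<^sub>\<infinity>\<beta>. ennreal (e \<beta>)) \<le> 1"
  defines "G \<equiv> \<lambda>z. enn2real (\<Sum>\<^sub>\<infinity>\<beta>. ennreal (e \<beta>) * ennreal z ^ n \<beta>)"
  shows "((\<lambda>h. ereal ((G 1 - G (1 - h)) / h)) \<longlongrightarrow> enn2ereal (\<Sum>\<^sub>\<infinity>\<beta>. ennreal (e \<beta>) * of_nat (n \<beta>))) (at_right 0)"
proof -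
  define T where "T = (\<Sum>\<^sub>\<infinity>\<beta>. ennreal (e \<beta>) * of_nat (n \<beta>))"
  \<comment> \<open>By the geometric sum, the difference quotient of the monomial with coefficient
    \<open>e \<beta>\<close> between 1 - h and 1, in a form that is visibly antitone in h and equals
    \<open>e \<beta> * n \<beta>\<close> at h = 0.\<close>
  define q where "q h \<beta> = e \<beta> * (\<Sum>k<n \<beta>. (1 - h) ^ k)" for h \<beta>
  define Q where "Q h = (\<Sum>\<^sub>\<infinity>\<beta>. ennreal (q h \<beta>))" for h
  have T: "T = (\<Sum>\<^sub>\<infinity>\<beta>. ennreal (e \<beta> * real (n \<beta>)))"
    unfolding T_def by (rule infsum_cong) (simp add: ennreal_mult e ennreal_of_nat_eq_real_of_nat)
  have q_nonneg: "0 \<le> q h \<beta>" if "h \<le> 1" for h \<beta>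
    unfolding q_def using that e by (intro mult_nonneg_nonneg sum_nonneg) auto
  have q_anti: "q h' \<beta> \<le> q h \<beta>" if "h \<le> h'" "h' \<le> 1" for h h' \<beta>
    unfolding q_def using that e by (intro mult_left_mono sum_mono power_mono) auto
  have Q_le: "Q h \<le> T" if "0 \<le> h" "h \<le> 1" for h
    unfolding Q_def T using q_anti[OF that]
    by (intro ennreal_infsum_mono ennreal_leI) (simp add: q_def)
  have Q_SUP: "(SUP j. Q (inverse (real (Suc j)))) = T"
  proof -
    let ?h = "\<lambda>j. inverse (real (Suc j))"
    have h: "?h j \<le> 1" for j by (simp add: inverse_le_1_iff)
    have inc: "incseq (\<lambda>j. ennreal (q (?h j) \<beta>))" for \<beta>
      by (rule incseq_SucI) (intro ennreal_leI q_anti h, simp)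
    have "(SUP j. ennreal (q (?h j) \<beta>)) = ennreal (e \<beta> * real (n \<beta>))" for \<beta>
    proof (rule LIMSEQ_unique)
      show "(\<lambda>j. ennreal (q (?h j) \<beta>)) \<longlonglongrightarrow> (SUP j. ennreal (q (?h j) \<beta>))"
        by (rule LIMSEQ_SUP[OF inc])
      have "(\<lambda>j. q (?h j) \<beta>) \<longlonglongrightarrow> e \<beta> * (\<Sum>k<n \<beta>. (1 - 0) ^ k)"
        unfolding q_def by (intro tendsto_intros LIMSEQ_inverse_real_of_nat)
      then show "(\<lambda>j. ennreal (q (?h j) \<beta>)) \<longlonglongrightarrow> ennreal (e \<beta> * real (n \<beta>))"
        by (intro tendsto_ennrealI) simp
    qed
    then show ?thesis
      unfolding Q_def T by (subst ennreal_infsum_SUP[OF inc, symmetric]) simp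
  qed
  have Q_lim: "(Q \<longlongrightarrow> T) (at_right 0)"
  proof (rule order_tendstoI)
    fix y assume "y < T"
    \<comment> \<open>As \<open>Q\<close> is antitone on [0, 1], exceeding y at one point means
      exceeding y at all smaller positive h.\<close>
    then obtain j where j: "y < Q (inverse (real (Suc j)))" unfolding Q_SUP[symmetric] less_SUP_iff by auto
    let ?h = "inverse (real (Suc j))"
    have "eventually (\<lambda>h. h \<in> {0<..<?h}) (at_right (0::real))"
      by (rule eventually_at_right_real) simp
    then show "eventually (\<lambda>h. y < Q h) (at_right 0)"
    proof eventually_elim
      case (elim h)
      have "Q ?h \<le> Q h"
        unfolding Q_def using elim
        by (intro ennreal_infsum_mono ennreal_leI q_anti) (auto simp: inverse_le_1_iff)
      with j show ?case by (rule less_le_trans)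
    qed
  next
    fix y assume y: "T < y"
    have "eventually (\<lambda>h. h \<in> {0<..<1}) (at_right (0::real))"
      by (rule eventually_at_right_real) simp
    then show "eventually (\<lambda>h. Q h < y) (at_right 0)"
    proof eventually_elim
      case (elim h)
      then have "Q h \<le> T" by (intro Q_le) auto
      then show ?case using y by (rule le_less_trans)
    qed
  qed
  \<comment> \<open>The series at 1 is at most 1, so all terms are finite and the real difference
    can be read off an addition in \<open>ennreal\<close>; h < 1 keeps 1 - h nonnegative.\<close>
  have diff: "ereal ((G 1 - G (1 - h)) / h) = enn2ereal (Q h)" if h: "0 < h" "h < 1" for h
  proof -
    let ?S = "\<lambda>z. \<Sum>\<^sub>\<infinity>\<beta>. ennreal (e \<beta>) * ennreal z ^ n \<beta>"
    have split: "ennreal (e \<beta>) * ennreal 1 ^ n \<beta> = ennreal (e \<beta>) * ennreal (1 - h) ^ n \<beta> + ennreal h * ennreal (q h \<beta>)" for \<beta>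
    proof -
      have "1 - (1 - h) ^ n \<beta> = h * (\<Sum>k<n \<beta>. (1 - h) ^ k)"
        using one_diff_power_eq[of "1 - h" "n \<beta>"] by simp
      then have "e \<beta> * ((1 - h) ^ n \<beta> + h * (\<Sum>k<n \<beta>. (1 - h) ^ k)) = e \<beta>" by simp
      then have "e \<beta> * (1 - h) ^ n \<beta> + h * q h \<beta> = e \<beta>"
        by (simp only: q_def distrib_left mult.left_commute[of h])
      then have "ennreal (e \<beta>) = ennreal (e \<beta> * (1 - h) ^ n \<beta> + h * q h \<beta>)" by simp
      also have "\<dots> = ennreal (e \<beta>) * ennreal (1 - h) ^ n \<beta> + ennreal h * ennreal (q h \<beta>)"
        using h e q_nonneg[of h \<beta>] by (simp add: ennreal_plus ennreal_mult ennreal_power)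
      finally show ?thesis by simp
    qed
    have S: "?S 1 = ?S (1 - h) + ennreal h * Q h"
      unfolding Q_def split ennreal_infsum_add ennreal_infsum_cmult_right ..
    have "?S 1 < \<top>" using fin by (simp add: le_less_trans[of _ 1])
    then have "?S (1 - h) < \<top>" "ennreal h * Q h < \<top>" unfolding S by auto
    moreover have Qfin: "Q h < \<top>"
      using \<open>ennreal h * Q h < \<top>\<close> h by (intro ennreal_mult_less_topD[of "Q h" "ennreal h"]) (simp_all add: mult.commute)
    ultimately have "G 1 = G (1 - h) + h * enn2real (Q h)"
      unfolding G_def S using h by (simp add: enn2real_plus enn2real_mult)
    then have "(G 1 - G (1 - h)) / h = enn2real (Q h)" using h by simp
    then show ?thesis using Qfin by (metis enn2ereal_ennreal enn2real_nonneg ennreal_enn2real)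
  qed
  have "((\<lambda>h. enn2ereal (Q h)) \<longlongrightarrow> enn2ereal T) (at_right 0)"
    by (rule continuous_on_tendsto_compose[OF continuous_on_enn2ereal Q_lim]) simp_all
  moreover have "eventually (\<lambda>h. enn2ereal (Q h) = ereal ((G 1 - G (1 - h)) / h)) (at_right 0)"
  proof -
    have "eventually (\<lambda>h. h \<in> {0<..<1}) (at_right (0::real))"
      by (rule eventually_at_right_real) simp
    then show ?thesis by eventually_elim (simp add: diff)
  qed
  ultimately show ?thesis unfolding T_def by (rule Lim_transform_eventually)
qed

section \<open>The probability space of runs\<close>

lemma pmf_run_pmf:
  assumes E: "\<And>\<beta>. \<beta> \<in> Dom s \<Longrightarrow> 0 \<le> Eval s \<beta>" and le: "(\<Sum>\<^sub>\<infinity>\<beta>\<in>Dom s. ennreal (Eval s \<beta>)) \<le> 1"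
  shows "pmf (run_pmf s) \<omega> = mass s \<omega>"
proof -
  let ?E = "Eval s" and ?D = "Dom s"
  have sum_le: "sum ?E F \<le> 1" if F: "finite F" "F \<subseteq> ?D" for F
  proof -
    have "ennreal (sum ?E F) = (\<Sum>\<beta>\<in>F. ennreal (?E \<beta>))" using F E by (subst sum_ennreal) auto
    also have "\<dots> \<le> 1" using ennreal_infsum_upper[OF F] le by (rule order_trans)
    finally show ?thesis by (simp add: ennreal_le_1)
  qed
  \<comment> \<open>A real sum that does not converge is 0 by convention; only with summability is
    the mass at \<open>[True]\<close> the missing probability.\<close>
  have summable: "?E summable_on ?D"
    by (rule nonneg_bdd_above_summable_on) (use E sum_le in \<open>auto intro!: bdd_aboveI[of _ 1]\<close>)
  have Z: "ennreal (infsum ?E ?D) = (\<Sum>\<^sub>\<infinity>\<beta>\<in>?D. ennreal (?E \<beta>))"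
  proof -
    have "ennreal (infsum ?E ?D) = (SUP F\<in>{F. finite F \<and> F \<subseteq> ?D}. ennreal (sum ?E F))"
      by (rule infsum_nonneg_is_SUPREMUM_ennreal[OF summable E])
    also have "\<dots> = (SUP F\<in>{F. finite F \<and> F \<subseteq> ?D}. (\<Sum>\<beta>\<in>F. ennreal (?E \<beta>)))"
      using E by (intro SUP_cong refl, subst sum_ennreal) auto
    finally show ?thesis by (simp add: nonneg_infsum_complete)
  qed
  have Z1: "infsum ?E ?D \<le> 1" by (rule infsum_le_finite_sums[OF summable sum_le])
  have Z0: "0 \<le> infsum ?E ?D" by (rule infsum_nonneg[OF E])
  have nonneg: "0 \<le> mass s \<omega>" for \<omega>
    using E Z1 by (auto simp: mass_def split: list.split bool.split)
  have "(\<integral>\<^sup>+\<omega>. ennreal (mass s \<omega>) \<partial>count_space UNIV) = (\<Sum>\<^sub>\<infinity>\<omega>. ennreal (mass s \<omega>))"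
    by (simp add: ennreal_infsum_eq_nn_integral)
  also have "\<dots> = (\<Sum>\<^sub>\<infinity>\<beta>. ennreal (mass s (False # \<beta>))) + (\<Sum>\<^sub>\<infinity>\<beta>. ennreal (mass s (True # \<beta>)))"
    by (subst infsum_bool_list) (simp add: mass_def)
  also have "(\<Sum>\<^sub>\<infinity>\<beta>. ennreal (mass s (False # \<beta>))) = ennreal (infsum ?E ?D)"
    unfolding Z ennreal_infsum_restrict[of _ ?D] by (rule infsum_cong) (simp add: mass_def)
  also have "(\<Sum>\<^sub>\<infinity>\<beta>. ennreal (mass s (True # \<beta>))) = ennreal (1 - infsum ?E ?D)"
    by (subst ennreal_infsum_single[where a = "[]"]) (auto simp: mass_def)
  also have "ennreal (infsum ?E ?D) + ennreal (1 - infsum ?E ?D) = 1"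
    using Z0 Z1 by (simp add: ennreal_plus[symmetric] del: ennreal_plus)
  finally show ?thesis
    unfolding run_pmf_def by (rule pmf_embed_pmf[OF nonneg])
qed

text \<open>Applied to the indicator of \<open>Conv\<close> and to \<open>label_count\<close>, both
  of which vanish except at strings starting with \<open>False\<close>.\<close>

lemma nn_integral_run_pmf:
  assumes "\<And>\<beta>. \<beta> \<in> Dom s \<Longrightarrow> 0 \<le> Eval s \<beta>" "(\<Sum>\<^sub>\<infinity>\<beta>\<in>Dom s. ennreal (Eval s \<beta>)) \<le> 1"
    and f: "f [] = 0" "\<And>\<beta>. f (True # \<beta>) = 0"
  shows "(\<integral>\<^sup>+\<omega>. f \<omega> \<partial>measure_pmf (run_pmf s)) = (\<Sum>\<^sub>\<infinity>\<beta>\<in>Dom s. ennreal (Eval s \<beta>) * f (False # \<beta>))"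
proof -
  have "(\<integral>\<^sup>+\<omega>. f \<omega> \<partial>measure_pmf (run_pmf s)) = (\<Sum>\<^sub>\<infinity>\<omega>. ennreal (mass s \<omega>) * f \<omega>)"
    by (simp add: nn_integral_measure_pmf pmf_run_pmf[OF assms(1,2)] ennreal_infsum_eq_nn_integral)
  also have "\<dots> = (\<Sum>\<^sub>\<infinity>\<beta>. ennreal (mass s (False # \<beta>)) * f (False # \<beta>))"
    by (subst infsum_bool_list) (simp add: f)
  also have "\<dots> = (\<Sum>\<^sub>\<infinity>\<beta>\<in>Dom s. ennreal (Eval s \<beta>) * f (False # \<beta>))"
    unfolding ennreal_infsum_restrict[of _ "Dom s"] by (rule infsum_cong) (simp add: mass_def)
  finally show ?thesis .
qed

theorem theorem2p11:
  fixes L :: "'l set" and M :: "'l tm" and x :: "'l \<Rightarrow> vname" and l :: 'l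
  assumes "finite L"
    and "typed Map.empty M Nat"
    and "labels M \<subseteq> L"
    and "inj_on x L"
    and "x ` L \<inter> vars M = {}"
    and "l \<in> L"
  shows "cond_expectation_label_count (M, []) l =
    e2ennreal (left_pderiv (spy_series x L M) l (\<lambda>_. 1)) / closed_sem (strip M) (PNat 0)"
proof -
  let ?s = "(strip M, [])" and ?c = "\<lambda>\<beta>. count (Eval_lab (M, []) \<beta>) l"
  have strip: "strip_state (M, []) = ?s" by (simp add: strip_state_def)
  have E: "0 \<le> Eval ?s \<beta>" if "\<beta> \<in> Dom ?s" for \<beta>
    using Eval_nonneg[OF typed_stateI[OF assms(2) typed_stack.intros(1)], of \<beta>] that
    by (simp add: strip)
  note le = closed_sem_strip(2)[OF assms(2), unfolded closed_sem_strip(1)[OF assms(2)]]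
  have conv: "emeasure (measure_pmf (run_pmf ?s)) (Conv ?s) = closed_sem (strip M) (PNat 0)"
  proof -
    have "emeasure (measure_pmf (run_pmf ?s)) (Conv ?s) = (\<integral>\<^sup>+\<omega>. indicator (Conv ?s) \<omega> \<partial>measure_pmf (run_pmf ?s))"
      by simp
    also have "\<dots> = (\<Sum>\<^sub>\<infinity>\<beta>\<in>Dom ?s. ennreal (Eval ?s \<beta>) * indicator (Conv ?s) (False # \<beta>))"
      by (rule nn_integral_run_pmf[OF E le]) (auto simp: Conv_def)
    also have "\<dots> = (\<Sum>\<^sub>\<infinity>\<beta>\<in>Dom ?s. ennreal (Eval ?s \<beta>))"
      by (rule infsum_cong) (auto simp: Conv_def)
    finally show ?thesis by (simp add: closed_sem_strip(1)[OF assms(2)])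
  qed
  have expectation: "(\<integral>\<^sup>+\<omega>. of_nat (label_count (M, []) l \<omega>) \<partial>measure_pmf (run_pmf ?s)) =
      (\<Sum>\<^sub>\<infinity>\<beta>\<in>Dom ?s. ennreal (Eval ?s \<beta>) * of_nat (?c \<beta>))"
    by (subst nn_integral_run_pmf[OF E le]) (auto simp: label_count_def strip intro!: infsum_cong)
  \<comment> \<open>Extension by 0 turns the sums over the domain into sums over all bit strings,
    the form in which the series is differentiated.\<close>
  define e where "e \<beta> = (if \<beta> \<in> Dom ?s then Eval ?s \<beta> else 0)" for \<beta>
  have e_sum: "(\<Sum>\<^sub>\<infinity>\<beta>\<in>Dom ?s. ennreal (Eval ?s \<beta>) * f \<beta>) = (\<Sum>\<^sub>\<infinity>\<beta>. ennreal (e \<beta>) * f \<beta>)" for f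
    unfolding ennreal_infsum_restrict[of _ "Dom ?s"] by (rule infsum_cong) (simp add: e_def)
  define G where "G z = enn2real (\<Sum>\<^sub>\<infinity>\<beta>. ennreal (e \<beta>) * ennreal z ^ ?c \<beta>)" for z
  have G: "spy_series x L M ((\<lambda>_. 1)(l := z)) = G z" if "z \<le> 1" for z
  proof -
    have "(\<lambda>l'. ennreal (((\<lambda>_. 1)(l := z)) l')) = (\<lambda>_. 1)(l := ennreal z)" by auto
    moreover have "((\<lambda>_. 1)(l := z)) l' \<le> 1" for l' using that by simp
    ultimately show ?thesis
      using spy_series_eq[OF assms(2-5), of "(\<lambda>_. 1)(l := z)"]
      by (simp only: prom_upd_one e_sum G_def)
  qed
  have "((\<lambda>h. ereal ((G 1 - G (1 - h)) / h)) \<longlongrightarrow> enn2ereal (\<Sum>\<^sub>\<infinity>\<beta>. ennreal (e \<beta>) * of_nat (?c \<beta>)))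
      (at_right 0)"
    unfolding G_def
  proof (rule left_derivative_power_series)
    show "0 \<le> e \<beta>" for \<beta> using E by (simp add: e_def)
    show "(\<Sum>\<^sub>\<infinity>\<beta>. ennreal (e \<beta>)) \<le> 1" using le e_sum[of "\<lambda>_. 1"] by simp
  qed
  \<comment> \<open>The identity with \<open>G\<close> is available for arguments up to 1, that is,
    at 1 - h for h to the right of 0.\<close>
  moreover have "eventually (\<lambda>h. ereal ((G 1 - G (1 - h)) / h) =
      ereal ((spy_series x L M (\<lambda>_. 1) - spy_series x L M ((\<lambda>_. 1)(l := 1 - h))) / h)) (at_right 0)"
    using G[of 1] G by (auto simp: eventually_at_filter fun_upd_idem)
  ultimately have "((\<lambda>h. ereal ((spy_series x L M (\<lambda>_. 1) - spy_series x L M ((\<lambda>_. 1)(l := 1 - h))) / h)) \<longlongrightarrow>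
      enn2ereal (\<Sum>\<^sub>\<infinity>\<beta>. ennreal (e \<beta>) * of_nat (?c \<beta>))) (at_right 0)"
    by (rule Lim_transform_eventually)
  then have "left_pderiv (spy_series x L M) l (\<lambda>_. 1) = enn2ereal (\<Sum>\<^sub>\<infinity>\<beta>. ennreal (e \<beta>) * of_nat (?c \<beta>))"
    unfolding left_pderiv_def by (intro tendsto_Lim) simp_all
  \<comment> \<open>Numerators and denominators agree separately; a term that halts with probability
    0 gives 0 / 0 on both sides.\<close>
  then show ?thesis
    by (simp add: cond_expectation_label_count_def strip conv expectation e_sum)
qed

end
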